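(* Let $(M_k)_{k\in\mathbb N}$ be a sequence of compact orientable $C^2$-manifolds (surfaces without boundary) embedded in $\mathbb R^3$ and let $V_k$ be their induced varifolds. Assume that $V$ is a varifold with mass measure $\|V\|$ such that $$V_k\rightharpoonup V\ \text{ (weakly-* as varifolds)},\qquad \limsup_{k\to\infty}\left[\mathcal W(V_k)+\mathcal H^2(M_k)\right]<\infty.$$ Then $\lim_{k\to\infty}M_k=\operatorname{spt}(V)\cup\{x_1,\dots,x_N\}$ for a finite collection of points $x_i$, $i=1,\dots,N$, in the sense of convergence in Hausdorff distance, for every subsequence along which the limit exists. Moreover, if $M_k$ is connected for all $k\in\mathbb N$ or $\lim_{k\to\infty}\mathcal W(V_k)=\mathcal W(V)$, then (in the same sense) $$\operatorname{spt}(\|V\|)=\lim_{k\to\infty}M_k.$$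
   Context: For a $C^2$ surface $M\subset\mathbb R^3$ with induced (multiplicity one) varifold, $\mathcal W(M)=\int_MH^2\,d\mathcal H^2$ is Willmore's energy, where $H$ is the mean curvature (sum of the principal curvatures, so that $\mathcal W$ of a round sphere is $16\pi$); for a varifold $V$ with square integrable generalised mean curvature $H_V$, $\mathcal W(V)=\int|H_V|^2\,d\|V\|$. $\operatorname{spt}(V)$ denotes $\operatorname{spt}(\|V\|)$. $\mathcal H^2$ is the 2-dimensional Hausdorff measure.
   Formalization: In the case where all M_k are connected, V is additionally assumed nonzero: round spheres shrinking to a point have W = 16π and area tending to 0, so V = 0 with empty support, while M_k converges to that point. *)

theory Defs
  imports "HOL-Analysis.Analysis"
begin

section \<open>Hausdorff distance and Hausdorff measure\<close>

text \<open>
  The value is extended: with \<open>SUP\<close> over the empty set equal to \<open>0\<close> and \<open>INF\<close> over the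
  empty set equal to infinity, the empty set has infinite distance to every nonempty set.
\<close>

definition hausdorff_distance :: "'a::metric_space set \<Rightarrow> 'a set \<Rightarrow> ennreal" where
  "hausdorff_distance A B =
     max (SUP a\<in>A. INF b\<in>B. ennreal (dist a b)) (SUP b\<in>B. INF a\<in>A. ennreal (dist a b))"

text \<open>
  The factor \<open>pi\<close> is the area of the unit disc.  Coverings are restricted to bounded sets
  because \<^const>\<open>diameter\<close> is a real number and carries no information on unbounded sets.
\<close>

definition hausdorff2_delta :: "real \<Rightarrow> 'a::metric_space set \<Rightarrow> ennreal" where
  "hausdorff2_delta \<delta> A =
     (INF C \<in> {C :: nat \<Rightarrow> 'a set. A \<subseteq> (\<Union>i. C i) \<and> (\<forall>i. bounded (C i) \<and> diameter (C i) \<le> \<delta>)}.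
        \<Sum>i. ennreal (pi * (diameter (C i) / 2)\<^sup>2))"

definition hausdorff2_outer :: "'a::metric_space set \<Rightarrow> ennreal" where
  "hausdorff2_outer A = (SUP \<delta>\<in>{0<..}. hausdorff2_delta \<delta> A)"

definition hausdorff2 :: "'a::metric_space measure" where
  "hausdorff2 = measure_of UNIV (sets borel) hausdorff2_outer"


section \<open>Embedded orientable surfaces of class \<open>C\<^sup>2\<close>\<close>

definition C2_on :: "'a::real_normed_vector set \<Rightarrow> ('a \<Rightarrow> 'b::real_normed_vector) \<Rightarrow> bool" where
  "C2_on S f \<longleftrightarrow>
     (\<exists>(f' :: 'a \<Rightarrow> 'a \<Rightarrow>\<^sub>L 'b) (f'' :: 'a \<Rightarrow> 'a \<Rightarrow>\<^sub>L ('a \<Rightarrow>\<^sub>L 'b)).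
        (\<forall>x\<in>S. (f has_derivative blinfun_apply (f' x)) (at x)) \<and>
        (\<forall>x\<in>S. (f' has_derivative blinfun_apply (f'' x)) (at x)) \<and>
        continuous_on S f'')"

definition local_parametrization ::
  "(real^3) set \<Rightarrow> (real^2) set \<Rightarrow> (real^2 \<Rightarrow> real^3) \<Rightarrow> bool" where
  "local_parametrization M U \<phi> \<longleftrightarrow>
     open U \<and> C2_on U \<phi> \<and>
     (\<forall>u\<in>U. inj (frechet_derivative \<phi> (at u))) \<and>
     openin (top_of_set M) (\<phi> ` U) \<and>
     (\<exists>\<psi>. homeomorphism U (\<phi> ` U) \<phi> \<psi>)"

definition C2_surface :: "(real^3) set \<Rightarrow> bool" where
  "C2_surface M \<longleftrightarrow> (\<forall>p\<in>M. \<exists>U \<phi>. local_parametrization M U \<phi> \<and> p \<in> \<phi> ` U)"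

text \<open>Orientability: an atlas all of whose transition maps have positive Jacobian determinant.\<close>

definition orientable_surface :: "(real^3) set \<Rightarrow> bool" where
  "orientable_surface M \<longleftrightarrow>
     (\<exists>\<A>. (\<forall>(U, \<phi>)\<in>\<A>. local_parametrization M U \<phi>) \<and>
          (\<Union>(U, \<phi>)\<in>\<A>. \<phi> ` U) = M \<and>
          (\<forall>(U, \<phi>)\<in>\<A>. \<forall>(W, \<psi>)\<in>\<A>. \<forall>u\<in>U. \<phi> u \<in> \<psi> ` W \<longrightarrow>
             det (matrix (frechet_derivative (inv_into W \<psi> \<circ> \<phi>) (at u))) > 0))"

definition tangent_space :: "(real^3) set \<Rightarrow> real^3 \<Rightarrow> (real^3) set" where
  "tangent_space M p =
     {v. \<exists>(\<gamma> :: real \<Rightarrow> real^3) \<epsilon>. \<epsilon> > 0 \<and> \<gamma> ` {-\<epsilon><..<\<epsilon>} \<subseteq> M \<and> \<gamma> 0 = p \<and>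
           \<gamma> differentiable_on {-\<epsilon><..<\<epsilon>} \<and> (\<gamma> has_vector_derivative v) (at 0)}"


section \<open>Two-dimensional varifolds in three-space\<close>

text \<open>
  The Grassmannian of (unoriented) planes through the origin is represented, as usual in
  geometric measure theory, by the matrices of the orthogonal projections onto these planes.
  For a linear subspace, \<^const>\<open>closest_point\<close> is the orthogonal projection.
\<close>

definition plane_projection :: "(real^3) set \<Rightarrow> real^3^3" where
  "plane_projection S = matrix (closest_point S)"

definition planes :: "(real^3^3) set" where
  "planes = plane_projection ` {S. subspace S \<and> dim S = 2}"

definition grassmann_bundle :: "((real^3) \<times> (real^3^3)) set" where
  "grassmann_bundle = UNIV \<times> planes"

text \<open>
  A varifold is a Radon measure on the Grassmann bundle; as the bundle is locally compact and
  second countable, these are the Borel measures that are finite on compact sets.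
\<close>

definition varifold :: "((real^3) \<times> (real^3^3)) measure \<Rightarrow> bool" where
  "varifold V \<longleftrightarrow>
     sets V = sets (restrict_space borel grassmann_bundle) \<and>
     (\<forall>K. compact K \<and> K \<subseteq> grassmann_bundle \<longrightarrow> emeasure V K < \<infinity>)"

definition mass_measure :: "((real^3) \<times> (real^3^3)) measure \<Rightarrow> (real^3) measure" where
  "mass_measure V = distr V borel fst"

definition spt :: "'a::topological_space measure \<Rightarrow> 'a set" where
  "spt \<mu> = {x. \<forall>U. open U \<and> x \<in> U \<longrightarrow> emeasure \<mu> U > 0}"

definition induced_varifold :: "(real^3) set \<Rightarrow> ((real^3) \<times> (real^3^3)) measure" where
  "induced_varifold M =
     distr (restrict_space hausdorff2 M) (restrict_space borel grassmann_bundle)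
       (\<lambda>x. (x, plane_projection (tangent_space M x)))"

definition varifold_converges ::
  "(nat \<Rightarrow> ((real^3) \<times> (real^3^3)) measure) \<Rightarrow> ((real^3) \<times> (real^3^3)) measure \<Rightarrow> bool" where
  "varifold_converges Vs V \<longleftrightarrow>
     (\<forall>f :: (real^3) \<times> (real^3^3) \<Rightarrow> real.
        continuous_on grassmann_bundle f \<and>
        (\<exists>K. compact K \<and> K \<subseteq> grassmann_bundle \<and> (\<forall>z\<in>grassmann_bundle - K. f z = 0)) \<longrightarrow>
        (\<lambda>k. \<integral>z. f z \<partial>Vs k) \<longlonglongrightarrow> (\<integral>z. f z \<partial>V))"


section \<open>First variation, generalised mean curvature, Willmore energy\<close>

definition C1_compactly_supported :: "(real^3 \<Rightarrow> real^3) \<Rightarrow> bool" where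
  "C1_compactly_supported X \<longleftrightarrow>
     (\<exists>X' :: real^3 \<Rightarrow> (real^3) \<Rightarrow>\<^sub>L (real^3).
        (\<forall>x. (X has_derivative blinfun_apply (X' x)) (at x)) \<and> continuous_on UNIV X') \<and>
     (\<exists>K. compact K \<and> (\<forall>x. x \<notin> K \<longrightarrow> X x = 0))"

text \<open>
  The divergence of \<open>X\<close> along the plane with orthogonal projection \<open>P\<close> is the trace of \<open>P ** DX\<close>.
\<close>

definition first_variation ::
  "((real^3) \<times> (real^3^3)) measure \<Rightarrow> (real^3 \<Rightarrow> real^3) \<Rightarrow> real" where
  "first_variation V X =
     (\<integral>(x, P). trace (P ** matrix (frechet_derivative X (at x))) \<partial>V)"

text \<open>
  For the varifold induced by a \<open>C\<^sup>2\<close> surface the vector field \<open>H\<close> below is the mean curvature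
  vector, whose length is the modulus of the sum (not the average) of the principal curvatures.
\<close>

definition generalised_mean_curvature ::
  "((real^3) \<times> (real^3^3)) measure \<Rightarrow> (real^3 \<Rightarrow> real^3) \<Rightarrow> bool" where
  "generalised_mean_curvature V H \<longleftrightarrow>
     H \<in> borel_measurable borel \<and>
     (\<forall>K. compact K \<longrightarrow> set_integrable (mass_measure V) K H) \<and>
     (\<forall>X. C1_compactly_supported X \<longrightarrow>
        first_variation V X = - (\<integral>x. H x \<bullet> X x \<partial>mass_measure V))"

text \<open>
  The generalised mean curvature is unique up to null sets of the mass measure, so the choice
  does not matter.  The energy is infinite if there is no (square integrable) generalised mean
  curvature.
\<close>

definition willmore :: "((real^3) \<times> (real^3^3)) measure \<Rightarrow> ennreal" where
  "willmore V =
     (if \<exists>H. generalised_mean_curvature V H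
      then \<integral>\<^sup>+ x. ennreal ((norm ((SOME H. generalised_mean_curvature V H) x))\<^sup>2) \<partial>mass_measure V
      else \<infinity>)"

end

theory Submission
  imports Defs
begin

text \<open>
  Let \<open>x\<close> be a point of a Hausdorff limit \<open>K\<close> that is not in the support of the limit varifold. Then the
  surfaces come arbitrarily close to \<open>x\<close>, while their area near \<open>x\<close> tends to zero. Monotonicity
  turns this into a concentration of energy: testing the first variation with the field
  \<open>y / (\<bar>y\<bar>\<^sup>2 + s\<^sup>2)\<close>, cut off at distance \<open>\<rho>\<close> from a point \<open>p\<close> of the surface (\<open>y\<close> is the position relative
  to \<open>p\<close>), bounds the area ratio at scale \<open>s\<close> by the area ratio at scale \<open>\<rho>\<close> plus the Willmore energy in
  the ball of radius \<open>\<rho>\<close> (\<open>density_energy_bound\<close>). As \<open>s\<close> tends to zero the area ratio stays above a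
  universal constant, because a \<open>C\<^sup>2\<close> surface has positive density at each of its points. So every
  such \<open>x\<close> costs a fixed amount of energy (\<open>energy_concentration\<close>), and since the energies are bounded
  there are finitely many of them (\<open>limit_minus_spt_finite\<close>). Conversely \<open>K\<close> contains the support, as
  the surfaces eventually avoid every small ball away from \<open>K\<close> (\<open>spt_subset_limit\<close>).

  If the surfaces are connected, then an isolated point of \<open>K\<close> is all of \<open>K\<close>, so there is no
  exceptional point (\<open>limit_eq_spt_of_connected\<close>). If the energies converge to the energy of the limit,
  an exceptional point is excluded because the energy that concentrates there would be missing
  elsewhere, against lower semicontinuity of the energy on the complement of a ball
  (\<open>limit_eq_spt_of_energy_convergence\<close>). Lower semicontinuity follows from the convergence of
  \<open>2 \<integral> H \<bullet> X - \<integral> \<bar>X\<bar>\<^sup>2\<close> for test fields \<open>X\<close>, and from the density of test fields in \<open>L\<^sup>2\<close>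
  (\<open>tests_dense_in_L2\<close>).

  In the monotonicity estimate the pairing of the test field with the curvature has to be absorbed
  by the normal part of \<open>y\<close>, which is possible only if the curvature vector is normal to the surface.
  A generalised mean curvature is only a representation of the first variation, so this has to be
  proved (\<open>mean_curvature_normal\<close>). In a patch \<open>\<phi>\<close> with partial derivatives \<open>a, b\<close> and unit normal \<open>n\<close> the
  area formula writes the first variation as an integral over the parameter domain, and
  integration by parts gives the vector \<open>cross3 b (\<partial>\<^sub>1 n) + cross3 (\<partial>\<^sub>2 n) a\<close>. It is parallel to \<open>n\<close>, as the
  derivatives of \<open>n\<close> are tangential, and it determines the generalised mean curvature almost
  everywhere, since a locally integrable function is determined by its pairing with \<open>C\<^sup>1\<close> functions
  (\<open>AE_zero_of_orthogonal_to_tests\<close>).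

  The area formula rests on two facts: Hausdorff measure on the plane is a constant multiple
  \<open>planar_factor\<close> of Lebesgue measure, because it is translation invariant, and near each point a
  parametrization is nearly its differential, so that it distorts Hausdorff measure nearly as a linear
  map does (\<open>area_formula\<close>).
\<close>


section \<open>Hausdorff measure is a Borel measure\<close>

abbreviation disc_area :: "'a::metric_space set \<Rightarrow> ennreal" where
  "disc_area C \<equiv> ennreal (pi * (diameter C / 2)\<^sup>2)"

lemma le_mult_INF_ennreal:
  assumes c: "0 < c" and le: "\<And>i. i \<in> S \<Longrightarrow> x \<le> ennreal c * g i"
  shows "x \<le> ennreal c * (INF i\<in>S. g i)"
proof -
  have cancel: "ennreal c * (ennreal (1 / c) * y) = y" "ennreal (1 / c) * (ennreal c * y) = y" for y
    using c by (simp_all add: mult.assoc[symmetric] ennreal_mult[symmetric])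
  have "ennreal (1 / c) * x \<le> (INF i\<in>S. g i)"
  proof (rule INF_greatest)
    fix i assume "i \<in> S"
    from mult_left_mono[OF le[OF this], of "ennreal (1 / c)"]
    show "ennreal (1 / c) * x \<le> g i" by (simp add: cancel)
  qed
  from mult_left_mono[OF this, of "ennreal c"] show ?thesis by (simp add: cancel)
qed

lemma hausdorff2_delta_le_cover:
  assumes "A \<subseteq> (\<Union>i. C i)" "\<And>i. bounded (C i)" "\<And>i. diameter (C i) \<le> \<delta>"
  shows "hausdorff2_delta \<delta> A \<le> (\<Sum>i. disc_area (C (i::nat)))"
  unfolding hausdorff2_delta_def by (rule INF_lower) (use assms in auto)

lemma hausdorff2_delta_antimono:
  "\<delta> \<le> \<delta>' \<Longrightarrow> hausdorff2_delta \<delta>' A \<le> hausdorff2_delta \<delta> A"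
  unfolding hausdorff2_delta_def by (rule INF_superset_mono) (auto intro: order_trans)

lemma hausdorff2_delta_mono:
  "A \<subseteq> B \<Longrightarrow> hausdorff2_delta \<delta> A \<le> hausdorff2_delta \<delta> B"
  unfolding hausdorff2_delta_def by (rule INF_superset_mono) auto

lemma hausdorff2_delta_empty:
  assumes "0 < \<delta>" shows "hausdorff2_delta \<delta> {} = 0"
  using hausdorff2_delta_le_cover[of "{}" "\<lambda>_. {}" \<delta>] assms by simp

text \<open>Coverings of the sets \<open>A n\<close> that are optimal up to \<open>e / 2^(n+1)\<close> are merged into one sequence.\<close>

lemma hausdorff2_delta_subadditive:
  "hausdorff2_delta \<delta> (\<Union>n. A n) \<le> (\<Sum>n. hausdorff2_delta \<delta> (A (n::nat)))"
proof (rule ennreal_le_epsilon)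
  fix e :: real assume e: "0 < e" and fin: "(\<Sum>n. hausdorff2_delta \<delta> (A n)) < top"
  have dfin: "hausdorff2_delta \<delta> (A n) < top" for n
    using ennreal_suminf_lessD[OF fin] .
  have "\<exists>C. A n \<subseteq> (\<Union>i. C i) \<and> (\<forall>i. bounded (C i) \<and> diameter (C i) \<le> \<delta>) \<and>
      (\<Sum>i. disc_area (C (i::nat))) \<le> hausdorff2_delta \<delta> (A n) + ennreal (e * (1/2) ^ Suc n)" for n
  proof -
    have "hausdorff2_delta \<delta> (A n) < hausdorff2_delta \<delta> (A n) + ennreal (e * (1/2) ^ Suc n)"
      using dfin[of n] e by (simp add: ennreal_zero_less_mult_iff less_top)
    then show ?thesis
      unfolding hausdorff2_delta_def INF_less_iff by (auto intro: less_imp_le)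
  qed
  then obtain C where C: "\<And>n. A n \<subseteq> (\<Union>i. C n i)" "\<And>n i. bounded (C n i)"
      "\<And>n i. diameter (C n i) \<le> \<delta>"
      "\<And>n. (\<Sum>i. disc_area (C n (i::nat))) \<le> hausdorff2_delta \<delta> (A n) + ennreal (e * (1/2) ^ Suc n)"
    by metis
  let ?D = "\<lambda>j. case prod_decode j of (n, i) \<Rightarrow> C n i"
  have "hausdorff2_delta \<delta> (\<Union>n. A n) \<le> (\<Sum>j. disc_area (?D j))"
  proof (rule hausdorff2_delta_le_cover)
    show "(\<Union>n. A n) \<subseteq> (\<Union>j. ?D j)"
    proof
      fix x assume "x \<in> (\<Union>n. A n)"
      then obtain n i where "x \<in> C n i" using C(1) by blast
      then have "x \<in> ?D (prod_encode (n, i))" by simp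
      then show "x \<in> (\<Union>j. ?D j)" by (rule UN_I[OF UNIV_I])
    qed
  qed (use C in \<open>auto split: prod.split\<close>)
  also have "\<dots> = (\<Sum>n. \<Sum>i. disc_area (C n i))"
  proof -
    have "(\<Sum>j. disc_area (?D j)) = (\<Sum>j. (\<lambda>(n, i). disc_area (C n i)) (prod_decode j))"
      by (intro suminf_cong) (auto split: prod.split)
    also have "\<dots> = (\<Sum>n. \<Sum>i. disc_area (C n i))"
      by (rule suminf_ennreal_2dimen[unfolded comp_def]) simp
    finally show ?thesis .
  qed
  also have "\<dots> \<le> (\<Sum>n. hausdorff2_delta \<delta> (A n) + ennreal (e * (1/2) ^ Suc n))"
    by (intro suminf_le C) auto
  also have "\<dots> = (\<Sum>n. hausdorff2_delta \<delta> (A n)) + (\<Sum>n. ennreal (e * (1/2) ^ Suc n))"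
    by (intro suminf_add[symmetric]) auto
  also have "(\<Sum>n. ennreal (e * (1/2) ^ Suc n)) = ennreal e"
  proof -
    have "(\<lambda>n. e * (1/2) ^ Suc n) sums (e * 1)"
      using power_half_series by (rule sums_mult)
    then have "(\<Sum>n. ennreal (e * (1/2) ^ Suc n)) = ennreal (e * 1)"
      by (intro suminf_ennreal_eq) (use e in auto)
    then show ?thesis by (simp only: mult_1_right)
  qed
  finally show "hausdorff2_delta \<delta> (\<Union>n. A n) \<le> (\<Sum>n. hausdorff2_delta \<delta> (A n)) + ennreal e" .
qed

lemma hausdorff2_delta_le_outer:
  "0 < \<delta> \<Longrightarrow> hausdorff2_delta \<delta> A \<le> hausdorff2_outer A"
  unfolding hausdorff2_outer_def by (rule SUP_upper) auto

lemma hausdorff2_outer_mono: "A \<subseteq> B \<Longrightarrow> hausdorff2_outer A \<le> hausdorff2_outer B"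
  unfolding hausdorff2_outer_def by (intro SUP_mono) (auto intro: hausdorff2_delta_mono)

lemma hausdorff2_outer_empty [simp]: "hausdorff2_outer {} = 0"
  unfolding hausdorff2_outer_def
  by (intro antisym SUP_least) (auto simp: hausdorff2_delta_empty)

lemma hausdorff2_outer_subadditive:
  "hausdorff2_outer (\<Union>n. A n) \<le> (\<Sum>n. hausdorff2_outer (A (n::nat)))"
proof -
  have "hausdorff2_delta \<delta> (\<Union>n. A n) \<le> (\<Sum>n. hausdorff2_outer (A n))" if "0 < \<delta>" for \<delta>
    using hausdorff2_delta_subadditive hausdorff2_delta_le_outer[OF that]
    by (rule order_trans[OF _ suminf_le]) auto
  then show ?thesis
    by (subst (1) hausdorff2_outer_def) (auto intro!: SUP_least)
qed

lemma hausdorff2_outer_space: "outer_measure_space UNIV hausdorff2_outer"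
  unfolding outer_measure_space_def positive_def increasing_def countably_subadditive_def
  by (auto intro: hausdorff2_outer_mono hausdorff2_outer_subadditive)

lemma hausdorff2_outer_Un: "hausdorff2_outer (A \<union> B) \<le> hausdorff2_outer A + hausdorff2_outer B"
proof -
  have "hausdorff2_outer (A \<union> B) = hausdorff2_outer (\<Union>n. binaryset A B n)"
    by (simp add: UN_binaryset_eq)
  also have "\<dots> \<le> (\<Sum>n. hausdorff2_outer (binaryset A B n))"
    by (rule hausdorff2_outer_subadditive)
  also have "\<dots> = hausdorff2_outer A + hausdorff2_outer B"
    by (intro suminf_binaryset_eq) simp
  finally show ?thesis .
qed

text \<open>A set of diameter less than \<open>d\<close> cannot meet two sets at distance \<open>d\<close>, so a fine
  covering of their union splits into a covering of each.\<close>

lemma hausdorff2_delta_separated: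
  assumes sep: "\<And>x y. x \<in> A \<Longrightarrow> y \<in> B \<Longrightarrow> d \<le> dist x y" and d: "0 < \<delta>" "\<delta> < d"
  shows "hausdorff2_delta \<delta> A + hausdorff2_delta \<delta> B \<le> hausdorff2_delta \<delta> (A \<union> B)"
  unfolding hausdorff2_delta_def[of \<delta> "A \<union> B"]
proof (rule INF_greatest)
  fix C assume "C \<in> {C :: nat \<Rightarrow> 'a set. A \<union> B \<subseteq> (\<Union>i. C i) \<and> (\<forall>i. bounded (C i) \<and> diameter (C i) \<le> \<delta>)}"
  then have C: "A \<union> B \<subseteq> (\<Union>i. C i)" "\<And>i. bounded (C i)" "\<And>i. diameter (C i) \<le> \<delta>"
    by auto
  define CA where "CA i = (if C i \<inter> A = {} then {} else C i)" for i
  define CB where "CB i = (if C i \<inter> B = {} then {} else C i)" for i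
  have disj: "CA i = {} \<or> CB i = {}" for i
  proof (rule ccontr)
    assume "\<not> ?thesis"
    then obtain x y where "x \<in> C i" "x \<in> A" "y \<in> C i" "y \<in> B"
      unfolding CA_def CB_def by (auto split: if_splits)
    moreover from this have "dist x y \<le> diameter (C i)"
      using C(2) diameter_bounded_bound by blast
    ultimately show False using sep[of x y] C(3)[of i] d by simp
  qed
  have "hausdorff2_delta \<delta> A \<le> (\<Sum>i. disc_area (CA i))"
  proof (rule hausdorff2_delta_le_cover)
    show "A \<subseteq> (\<Union>i. CA i)" unfolding CA_def using C(1) by fastforce
  qed (use C d in \<open>auto simp: CA_def\<close>)
  moreover have "hausdorff2_delta \<delta> B \<le> (\<Sum>i. disc_area (CB i))"
  proof (rule hausdorff2_delta_le_cover)
    show "B \<subseteq> (\<Union>i. CB i)" unfolding CB_def using C(1) by fastforce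
  qed (use C d in \<open>auto simp: CB_def\<close>)
  ultimately have "hausdorff2_delta \<delta> A + hausdorff2_delta \<delta> B
      \<le> (\<Sum>i. disc_area (CA i)) + (\<Sum>i. disc_area (CB i))"
    by (rule add_mono)
  also have "\<dots> = (\<Sum>i. disc_area (CA i) + disc_area (CB i))"
    by (intro suminf_add) auto
  also have "\<dots> \<le> (\<Sum>i. disc_area (C i))"
  proof (rule suminf_le)
    show "disc_area (CA i) + disc_area (CB i) \<le> disc_area (C i)" for i
    proof (cases "CA i = {}")
      case True
      have "CB i = {} \<or> CB i = C i" by (simp add: CB_def)
      with True show ?thesis by auto
    next
      case False
      then have "CB i = {}" "CA i = C i" using disj[of i] by (auto simp: CA_def)
      then show ?thesis by simp
    qed
  qed auto
  finally show "hausdorff2_delta \<delta> A + hausdorff2_delta \<delta> B \<le> (\<Sum>i. disc_area (C i))" .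
qed

lemma hausdorff2_outer_separated:
  assumes sep: "\<And>x y. x \<in> A \<Longrightarrow> y \<in> B \<Longrightarrow> d \<le> dist x y" and d: "0 < d"
  shows "hausdorff2_outer A + hausdorff2_outer B \<le> hausdorff2_outer (A \<union> B)"
proof -
  have "hausdorff2_outer A + hausdorff2_outer B
    = (SUP \<delta>\<in>{0<..}. hausdorff2_delta \<delta> A + hausdorff2_delta \<delta> B)"
    unfolding hausdorff2_outer_def
  proof (rule SUP_add_directed_ennreal[symmetric])
    fix i j :: real assume "i \<in> {0<..}" "j \<in> {0<..}"
    then show "\<exists>k\<in>{0<..}. hausdorff2_delta i A + hausdorff2_delta j B \<le> hausdorff2_delta k A + hausdorff2_delta k B"
      by (intro bexI[of _ "min i j"] add_mono hausdorff2_delta_antimono) auto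
  qed
  also have "\<dots> \<le> hausdorff2_outer (A \<union> B)"
  proof (rule SUP_least)
    fix \<delta> :: real assume \<delta>: "\<delta> \<in> {0<..}"
    let ?m = "min \<delta> (d/2)"
    have "hausdorff2_delta \<delta> A + hausdorff2_delta \<delta> B \<le> hausdorff2_delta ?m A + hausdorff2_delta ?m B"
      by (intro add_mono hausdorff2_delta_antimono) auto
    also have "\<dots> \<le> hausdorff2_delta ?m (A \<union> B)"
      by (rule hausdorff2_delta_separated[OF sep]) (use \<delta> d in auto)
    also have "\<dots> \<le> hausdorff2_outer (A \<union> B)"
      by (rule hausdorff2_delta_le_outer) (use \<delta> d in auto)
    finally show "hausdorff2_delta \<delta> A + hausdorff2_delta \<delta> B \<le> hausdorff2_outer (A \<union> B)" .
  qed
  finally show ?thesis .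
qed

text \<open>The distance to \<open>F\<close> separates each \<open>R N\<close> from the union of the earlier sets, so additivity on
  separated sets applies inductively.\<close>

lemma sum_hausdorff2_outer_shells_le:
  assumes sep: "\<And>N. 0 < N \<Longrightarrow> \<exists>a b. b < a \<and> (\<forall>i<N. \<forall>x\<in>R i. a \<le> infdist x F) \<and> (\<forall>x\<in>R N. infdist x F \<le> b)"
  shows "(\<Sum>i<N. hausdorff2_outer (R i)) \<le> hausdorff2_outer (\<Union>i<(N::nat). R i)"
proof (induction N)
  case (Suc N)
  show ?case
  proof (cases "N = 0")
    case True then show ?thesis by (simp add: lessThan_Suc)
  next
    case False
    then obtain a b where ab: "b < a" "\<And>i x. i < N \<Longrightarrow> x \<in> R i \<Longrightarrow> a \<le> infdist x F"
      "\<And>x. x \<in> R N \<Longrightarrow> infdist x F \<le> b"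
      using sep[of N] by auto
    have "(\<Sum>i<Suc N. hausdorff2_outer (R i)) \<le> hausdorff2_outer (\<Union>i<N. R i) + hausdorff2_outer (R N)"
      using Suc by (simp add: add_right_mono)
    also have "\<dots> \<le> hausdorff2_outer ((\<Union>i<N. R i) \<union> R N)"
    proof (rule hausdorff2_outer_separated)
      show "a - b \<le> dist x y" if xy: "x \<in> (\<Union>i<N. R i)" "y \<in> R N" for x y
      proof -
        have "a \<le> infdist x F" using xy ab(2) by auto
        moreover have "infdist y F \<le> b" using xy ab(3) by auto
        moreover have "infdist x F \<le> infdist y F + dist x y" by (rule infdist_triangle)
        ultimately show ?thesis by simp
      qed
    qed (use ab in simp)
    also have "(\<Union>i<N. R i) \<union> R N = (\<Union>i<Suc N. R i)" by (auto simp: less_Suc_eq)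
    finally show ?thesis .
  qed
qed simp

text \<open>The Caratheodory criterion. A point of \<open>T - F\<close> close to \<open>F\<close> lies in one of the shells
  \<open>R m\<close>; shells of the same parity have positive distance from each other, so their measures
  are summable and the part of \<open>T - F\<close> close to \<open>F\<close> has small measure.\<close>

lemma closed_in_lambda_system:
  assumes F: "closed F"
  shows "F \<in> lambda_system UNIV UNIV (hausdorff2_outer :: 'a::metric_space set \<Rightarrow> ennreal)"
proof -
  let ?h = "hausdorff2_outer :: 'a set \<Rightarrow> ennreal"
  have main: "?h (F \<inter> T) + ?h ((UNIV - F) \<inter> T) \<le> ?h T" for T
  proof (cases "F = {} \<or> ?h T = \<infinity>")
    case True then show ?thesis by auto
  next
    case False
    then have ne: "F \<noteq> {}" and fin: "?h T < \<infinity>" by (auto simp: less_top)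
    define R where "R m = {x\<in>T. 1 / real (m+2) \<le> infdist x F \<and> infdist x F < 1 / real (m+1)}" for m
    define A where "A n = {x\<in>T. 1 / real (n+1) \<le> infdist x F}" for n
    have parity: "(\<Sum>i<N. ?h (R (2*i+c))) \<le> ?h (\<Union>i<N. R (2*i+c))" for N c
    proof (rule sum_hausdorff2_outer_shells_le)
      fix N :: nat assume N: "0 < N"
      show "\<exists>a b. b < a \<and> (\<forall>i<N. \<forall>x\<in>R (2*i+c). a \<le> infdist x F) \<and> (\<forall>x\<in>R (2*N+c). infdist x F \<le> b)"
      proof (rule exI[of _ "1 / real (2*N+c)"], rule exI[of _ "1 / real (2*N+c+1)"], intro conjI allI impI ballI)
        show "1 / real (2*N+c) \<le> infdist x F" if "i < N" "x \<in> R (2*i+c)" for i x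
        proof -
          have "1 / real (2*N+c) \<le> 1 / real (2*i+c+2)" using that by (intro divide_left_mono) auto
          then show ?thesis using that by (auto simp: R_def)
        qed
        show "infdist x F \<le> 1 / real (2*N+c+1)" if "x \<in> R (2*N+c)" for x
          using that by (auto simp: R_def)
      qed (use N in \<open>simp add: divide_simps\<close>)
    qed
    have shell_sum: "(\<Sum>i<N. ?h (R (2*i+c))) \<le> ?h T" for N c
      by (rule order_trans[OF parity hausdorff2_outer_mono]) (auto simp: R_def)
    have sum_R: "(\<Sum>m<2*N. ?h (R m)) \<le> 2 * ?h T" for N
    proof -
      have "(\<Sum>m<2*N. ?h (R m)) = (\<Sum>i<N. ?h (R (2*i))) + (\<Sum>i<N. ?h (R (2*i+1)))"
        by (induction N) (auto simp: algebra_simps)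
      also have "\<dots> \<le> ?h T + ?h T"
        using shell_sum[where N = N and c = 0] shell_sum[where N = N and c = 1] by (intro add_mono) simp_all
      finally show ?thesis by (simp add: mult_2)
    qed
    have "(\<Sum>m. ?h (R m)) \<le> 2 * ?h T"
      unfolding suminf_eq_SUP
    proof (rule SUP_least)
      fix N :: nat
      have "(\<Sum>m<N. ?h (R m)) \<le> (\<Sum>m<2*N. ?h (R m))" by (rule sum_mono2) auto
      then show "(\<Sum>m<N. ?h (R m)) \<le> 2 * ?h T" using sum_R[of N] by simp
    qed
    also have "\<dots> < \<infinity>" using fin by (simp add: ennreal_mult_less_top)
    finally have Rfin: "(\<Sum>m. ?h (R m)) \<noteq> \<infinity>" by simp
    define r where "r m = enn2real (?h (R m))" for m
    have hr: "?h (R m) = ennreal (r m)" for m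
    proof -
      have "?h (R m) < top" using Rfin ennreal_suminf_lessD[of "\<lambda>m. ?h (R m)" top m]
        by (simp add: less_top)
      then show ?thesis by (simp add: r_def)
    qed
    have r0: "0 \<le> r m" for m by (simp add: r_def)
    have summ: "summable r"
      by (rule summable_suminf_not_top) (use Rfin r0 in \<open>auto simp: hr\<close>)
    show ?thesis
    proof (rule ennreal_le_epsilon)
      fix e :: real assume e: "0 < e"
      obtain n where n: "norm (\<Sum>i. r (i + n)) < e"
        using suminf_exist_split[OF e summ] by blast
      have "(UNIV - F) \<inter> T \<subseteq> A n \<union> (\<Union>i. R (i + n))"
      proof
        fix x assume x: "x \<in> (UNIV - F) \<inter> T"
        then have pos: "0 < infdist x F"
          using in_closed_iff_infdist_zero[OF F ne, of x] infdist_nonneg[of x F] by (auto simp: less_le)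
        show "x \<in> A n \<union> (\<Union>i. R (i + n))"
        proof (cases "x \<in> A n")
          case False
          then have xn: "infdist x F < 1 / real (n+1)" using x by (auto simp: A_def)
          define P where "P m \<longleftrightarrow> 1 / real (m+2) \<le> infdist x F" for m
          obtain m where "inverse (real (Suc m)) < infdist x F"
            using reals_Archimedean[OF pos] by blast
          moreover have "1 / real (m+2) \<le> inverse (real (Suc m))" by (simp add: divide_simps)
          ultimately have Pm: "P m" unfolding P_def by linarith
          define l where "l = (LEAST m. P m)"
          have Pl: "P l" unfolding l_def by (rule LeastI[of P, OF Pm])
          have ln: "n \<le> l"
          proof (rule ccontr)
            assume "\<not> n \<le> l"
            then have "1 / real (n+1) \<le> 1 / real (l+2)" by (intro divide_left_mono) auto
            then show False using Pl xn by (simp add: P_def)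
          qed
          have "infdist x F < 1 / real (l+1)"
          proof (cases "l = n")
            case False
            then have "l - 1 < l" using ln by simp
            then have "\<not> P (l - 1)" unfolding l_def by (rule not_less_Least)
            moreover have "real (l - 1 + 2) = real (l + 1)" using False ln by auto
            ultimately show ?thesis unfolding P_def by simp
          qed (use xn in simp)
          then have "x \<in> R l" using Pl x by (simp add: R_def P_def)
          then have "x \<in> R ((l - n) + n)" using ln by simp
          then show ?thesis by (intro UnI2 UN_I[OF UNIV_I])
        qed simp
      qed
      then have "?h ((UNIV - F) \<inter> T) \<le> ?h (A n \<union> (\<Union>i. R (i + n)))"
        by (rule hausdorff2_outer_mono)
      also have "\<dots> \<le> ?h (A n) + ?h (\<Union>i. R (i + n))" by (rule hausdorff2_outer_Un)
      also have "\<dots> \<le> ?h (A n) + (\<Sum>i. ?h (R (i + n)))"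
        by (intro add_left_mono hausdorff2_outer_subadditive)
      also have "(\<Sum>i. ?h (R (i + n))) = ennreal (\<Sum>i. r (i + n))"
        unfolding hr by (rule suminf_ennreal2) (use r0 summ in \<open>auto simp: summable_iff_shift\<close>)
      also have "\<dots> \<le> ennreal e" using n by (intro ennreal_leI) auto
      finally have 1: "?h ((UNIV - F) \<inter> T) \<le> ?h (A n) + ennreal e"
        by (simp add: add_left_mono)
      have "?h (F \<inter> T) + ?h (A n) \<le> ?h (F \<inter> T \<union> A n)"
      proof (rule hausdorff2_outer_separated)
        show "1 / real (n+1) \<le> dist x y" if "x \<in> F \<inter> T" "y \<in> A n" for x y
          using that infdist_le[of x F y] by (auto simp: A_def dist_commute)
      qed simp
      also have "\<dots> \<le> ?h T" by (rule hausdorff2_outer_mono) (auto simp: A_def)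
      finally have "?h (F \<inter> T) + ?h (A n) \<le> ?h T" .
      then have "?h (F \<inter> T) + (?h (A n) + ennreal e) \<le> ?h T + ennreal e"
        unfolding add.assoc[symmetric] by (rule add_right_mono)
      then show "?h (F \<inter> T) + ?h ((UNIV - F) \<inter> T) \<le> ?h T + ennreal e"
        by (rule order_trans[OF add_left_mono[OF 1]])
    qed
  qed
  have "?h (F \<inter> T) + ?h ((UNIV - F) \<inter> T) = ?h T" for T
  proof (rule antisym[OF main])
    have "T = F \<inter> T \<union> (UNIV - F) \<inter> T" by auto
    then show "?h T \<le> ?h (F \<inter> T) + ?h ((UNIV - F) \<inter> T)"
      using hausdorff2_outer_Un[of "F \<inter> T" "(UNIV - F) \<inter> T"] by simp
  qed
  then show ?thesis unfolding lambda_system_def by auto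
qed

lemma measure_space_hausdorff2_outer:
  "measure_space UNIV (sets borel) (hausdorff2_outer :: 'a::metric_space set \<Rightarrow> ennreal)"
proof -
  let ?L = "lambda_system UNIV UNIV (hausdorff2_outer :: 'a set \<Rightarrow> ennreal)"
  have L: "measure_space UNIV ?L (hausdorff2_outer :: 'a set \<Rightarrow> ennreal)"
    using sigma_algebra.caratheodory_lemma[OF sigma_algebra_Pow hausdorff2_outer_space[unfolded Pow_UNIV[symmetric]]]
    by simp
  then have "sigma_algebra UNIV ?L" by (simp add: measure_space_def)
  then have "sigma_sets UNIV (Collect closed) \<subseteq> ?L"
    by (intro sigma_algebra.sigma_sets_subset) (auto intro: closed_in_lambda_system)
  then have sub: "sets borel \<subseteq> ?L" by (simp add: borel_eq_closed)
  show ?thesis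
    by (rule measure_down[OF L _ sub]) (metis sets.sigma_algebra_axioms space_borel)
qed

lemma sets_hausdorff2 [simp, measurable_cong]: "sets hausdorff2 = sets borel"
  unfolding hausdorff2_def
  by (subst sets_measure_of) (auto simp: sets.sigma_sets_eq[of borel, simplified])

lemma space_hausdorff2 [simp]: "space hausdorff2 = UNIV"
  using sets_eq_imp_space_eq[OF sets_hausdorff2] by simp

lemma emeasure_hausdorff2:
  assumes "A \<in> sets borel" shows "emeasure hausdorff2 A = hausdorff2_outer A"
  unfolding hausdorff2_def
proof (rule emeasure_measure_of_sigma)
  show "sigma_algebra UNIV (sets (borel::'a measure))"
    by (metis sets.sigma_algebra_axioms space_borel)
qed (use measure_space_hausdorff2_outer assms in \<open>auto simp: measure_space_def\<close>)

text \<open>The images of the covering sets have diameters scaled by at most \<open>L\<close>, hence areas scaled by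
  \<open>L\<^sup>2\<close>; that the mesh \<open>\<delta>\<close> turns into \<open>L \<delta>\<close> is harmless, because the supremum over all meshes is
  taken.\<close>

lemma hausdorff2_outer_lipschitz_image:
  fixes f :: "'a::metric_space \<Rightarrow> 'b::metric_space"
  assumes lip: "\<And>x y. x \<in> A \<Longrightarrow> y \<in> A \<Longrightarrow> dist (f x) (f y) \<le> L * dist x y" and L: "0 < L"
  shows "hausdorff2_outer (f ` A) \<le> ennreal (L\<^sup>2) * hausdorff2_outer A"
proof -
  have delta: "hausdorff2_delta (L * \<delta>) (f ` A) \<le> ennreal (L\<^sup>2) * hausdorff2_delta \<delta> A" if \<delta>: "0 < \<delta>" for \<delta>
  proof -
    let ?S = "{C :: nat \<Rightarrow> 'a set. A \<subseteq> (\<Union>i. C i) \<and> (\<forall>i. bounded (C i) \<and> diameter (C i) \<le> \<delta>)}"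
    have "hausdorff2_delta (L * \<delta>) (f ` A) \<le> ennreal (L\<^sup>2) * (\<Sum>i. disc_area (C i))" if C: "C \<in> ?S" for C
    proof -
      have diam: "diameter (f ` (C i \<inter> A)) \<le> L * diameter (C i) \<and> bounded (f ` (C i \<inter> A))" for i
      proof -
        have b: "bounded (C i)" using C by auto
        have d: "dist u v \<le> L * diameter (C i)" if "u \<in> f ` (C i \<inter> A)" "v \<in> f ` (C i \<inter> A)" for u v
        proof -
          obtain x y where xy: "x \<in> C i" "x \<in> A" "y \<in> C i" "y \<in> A" "u = f x" "v = f y"
            using \<open>u \<in> _\<close> \<open>v \<in> _\<close> by auto
          have "dist u v \<le> L * dist x y" using lip xy by auto
          also have "\<dots> \<le> L * diameter (C i)"
            using L xy diameter_bounded_bound[OF b] by (intro mult_left_mono) auto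
          finally show ?thesis .
        qed
        have "0 \<le> L * diameter (C i)" using L diameter_ge_0[OF b] by simp
        moreover have "bounded (f ` (C i \<inter> A))"
          using d by (auto simp: bounded_two_points)
        moreover have "diameter (f ` (C i \<inter> A)) \<le> L * diameter (C i)"
        proof (cases "f ` (C i \<inter> A) = {}")
          case False
          then have "(SUP (u, v)\<in>f ` (C i \<inter> A) \<times> f ` (C i \<inter> A). dist u v) \<le> L * diameter (C i)"
          proof (intro cSUP_least)
            fix p assume "p \<in> f ` (C i \<inter> A) \<times> f ` (C i \<inter> A)"
            then show "(case p of (u, v) \<Rightarrow> dist u v) \<le> L * diameter (C i)"
              using d[of "fst p" "snd p"] by (simp add: mem_Times_iff split_beta)
          qed simp
          then show ?thesis using False unfolding diameter_def by simp
        qed (use calculation(1) in simp)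
        ultimately show ?thesis by blast
      qed
      have "hausdorff2_delta (L * \<delta>) (f ` A) \<le> (\<Sum>i. disc_area (f ` (C i \<inter> A)))"
      proof (rule hausdorff2_delta_le_cover)
        have "A \<subseteq> (\<Union>i. C i \<inter> A)" using C by auto
        then show "f ` A \<subseteq> (\<Union>i. f ` (C i \<inter> A))" unfolding image_UN[symmetric] by (rule image_mono)
        show "diameter (f ` (C i \<inter> A)) \<le> L * \<delta>" for i
          using diam[of i] C mult_left_mono[of "diameter (C i)" \<delta> L] L by (auto intro: order_trans)
      qed (use diam in auto)
      also have "\<dots> \<le> (\<Sum>i. ennreal (L\<^sup>2) * disc_area (C i))"
      proof (rule suminf_le)
        show "disc_area (f ` (C i \<inter> A)) \<le> ennreal (L\<^sup>2) * disc_area (C i)" for i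
        proof -
          have "0 \<le> diameter (f ` (C i \<inter> A))" using diam by (intro diameter_ge_0) auto
          then have "(diameter (f ` (C i \<inter> A)) / 2)\<^sup>2 \<le> (L * diameter (C i) / 2)\<^sup>2"
            using diam[of i] by (intro power_mono) auto
          then have "pi * (diameter (f ` (C i \<inter> A)) / 2)\<^sup>2 \<le> L\<^sup>2 * (pi * (diameter (C i) / 2)\<^sup>2)"
            by (simp add: power2_eq_square field_simps)
          then show ?thesis by (subst ennreal_mult[symmetric]) (auto intro: ennreal_leI)
        qed
      qed auto
      also have "\<dots> = ennreal (L\<^sup>2) * (\<Sum>i. disc_area (C i))" by simp
      finally show ?thesis .
    qed
    then show ?thesis
      unfolding hausdorff2_delta_def[of \<delta> A] using L by (intro le_mult_INF_ennreal) auto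
  qed
  show ?thesis
    unfolding hausdorff2_outer_def[of "f ` A"]
  proof (rule SUP_least)
    fix \<delta> :: real assume "\<delta> \<in> {0<..}"
    then have "0 < \<delta> / L" using L by simp
    from delta[OF this] L have "hausdorff2_delta \<delta> (f ` A) \<le> ennreal (L\<^sup>2) * hausdorff2_delta (\<delta> / L) A"
      by simp
    also have "\<dots> \<le> ennreal (L\<^sup>2) * hausdorff2_outer A"
      by (intro mult_left_mono hausdorff2_delta_le_outer) (use \<open>0 < \<delta> / L\<close> in auto)
    finally show "hausdorff2_delta \<delta> (f ` A) \<le> ennreal (L\<^sup>2) * hausdorff2_outer A" .
  qed
qed

lemma hausdorff2_outer_expanding_image:
  fixes f :: "'a::metric_space \<Rightarrow> 'b::metric_space"
  assumes exp: "\<And>x y. x \<in> A \<Longrightarrow> y \<in> A \<Longrightarrow> l * dist x y \<le> dist (f x) (f y)" and l: "0 < l"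
  shows "ennreal (l\<^sup>2) * hausdorff2_outer A \<le> hausdorff2_outer (f ` A)"
proof -
  have inj: "inj_on f A" using exp l by (force intro!: inj_onI simp: mult_le_0_iff)
  have "hausdorff2_outer (inv_into A f ` f ` A) \<le> ennreal ((1/l)\<^sup>2) * hausdorff2_outer (f ` A)"
  proof (rule hausdorff2_outer_lipschitz_image)
    fix u v assume "u \<in> f ` A" "v \<in> f ` A"
    then show "dist (inv_into A f u) (inv_into A f v) \<le> 1 / l * dist u v"
      using exp l inj by (auto simp: field_simps)
  qed (use l in simp)
  then have "ennreal (l\<^sup>2) * hausdorff2_outer A \<le> ennreal (l\<^sup>2) * (ennreal ((1/l)\<^sup>2) * hausdorff2_outer (f ` A))"
    using inj by (intro mult_left_mono) auto
  also have "\<dots> = hausdorff2_outer (f ` A)"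
    using l by (simp add: mult.assoc[symmetric] ennreal_mult[symmetric] power_divide)
  finally show ?thesis .
qed

lemma hausdorff2_outer_isometric_image:
  assumes "\<And>x y. x \<in> A \<Longrightarrow> y \<in> A \<Longrightarrow> dist (f x) (f y) = dist x y"
  shows "hausdorff2_outer (f ` A) = hausdorff2_outer A"
  using hausdorff2_outer_lipschitz_image[of A f 1] hausdorff2_outer_expanding_image[of A 1 f] assms
  by (intro antisym) auto


section \<open>Hausdorff measure on planes\<close>

lemma One_component [simp]: "(\<Sum>x\<in>Basis. (x :: real^'n) $ i) = 1"
proof -
  have "axis i 1 \<in> (Basis :: (real^'n) set)" by (simp add: axis_in_Basis_iff)
  then have "(One :: real^'n) \<bullet> axis i 1 = 1" by simp
  then show ?thesis by (simp only: inner_axis) (simp add: sum_component)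
qed

text \<open>Fubini for \<open>indicator A (x + y) * indicator B y\<close>, where \<open>B\<close> is a unit cube and \<open>x\<close> is integrated
  against \<open>m\<close>: integration in \<open>x\<close> first gives \<open>m A\<close>, and integration in \<open>y\<close> first gives, after the
  substitution \<open>z = x + y\<close>, the product of \<open>m (- B)\<close> with the Lebesgue measure of \<open>A\<close>.\<close>

lemma translation_invariant_eq_lborel:
  fixes m :: "'a::euclidean_space measure"
  assumes sets_m [measurable_cong]: "sets m = sets borel"
    and inv: "\<And>A t. A \<in> sets borel \<Longrightarrow> emeasure m ((+) t ` A) = emeasure m A"
    and fin: "\<And>n::nat. emeasure m (cbox (- (real n *\<^sub>R One)) (real n *\<^sub>R One)) < \<infinity>"
    and A [measurable]: "A \<in> sets borel"
  shows "emeasure m A = emeasure m (cbox 0 One) * emeasure lborel A"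
proof -
  have space_m: "space m = UNIV" using sets_eq_imp_space_eq[OF sets_m] by simp
  have "sigma_finite_measure m"
  proof
    show "\<exists>\<A>. countable \<A> \<and> \<A> \<subseteq> sets m \<and> \<Union> \<A> = space m \<and> (\<forall>a\<in>\<A>. emeasure m a \<noteq> \<infinity>)"
    proof (intro exI[of _ "range (\<lambda>n::nat. cbox (- (real n *\<^sub>R One)) (real n *\<^sub>R One))"] conjI)
      have "UNIV \<subseteq> (\<Union>n::nat. cbox (- (real n *\<^sub>R One)) (real n *\<^sub>R One) :: 'a set)"
        using UN_box_eq_UNIV box_subset_cbox by (metis (mono_tags, lifting) SUP_mono' )
      then show "\<Union> (range (\<lambda>n::nat. cbox (- (real n *\<^sub>R One)) (real n *\<^sub>R One))) = space m"
        using space_m by auto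
    qed (use fin sets_m in \<open>auto simp: less_top\<close>)
  qed
  then interpret m: sigma_finite_measure m .
  interpret P: pair_sigma_finite m "lborel :: 'a measure" ..
  define B :: "'a set" where "B = cbox (- One) 0"
  have [measurable]: "B \<in> sets borel" by (simp add: B_def)
  have "(\<integral>\<^sup>+ y. \<integral>\<^sup>+ x. indicator A (x + y) * indicator B y \<partial>m \<partial>lborel)
      = (\<integral>\<^sup>+ y. emeasure m A * indicator B y \<partial>lborel)"
  proof (rule nn_integral_cong)
    fix y :: 'a
    have eq: "(\<lambda>x. x + y) -` A = (+) (- y) ` A"
      by (auto simp: image_iff) (metis add.commute add_diff_cancel_right' uminus_add_conv_diff)
    have "(\<integral>\<^sup>+ x. indicator A (x + y) \<partial>m) = (\<integral>\<^sup>+ x. indicator ((\<lambda>x. x + y) -` A) x \<partial>m)"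
      by (simp add: indicator_vimage)
    also have "\<dots> = emeasure m ((\<lambda>x. x + y) -` A)"
      by (rule nn_integral_indicator)
        (use measurable_sets[of "\<lambda>x. x + y" borel borel A] sets_m in simp)
    also have "\<dots> = emeasure m A" unfolding eq by (rule inv) simp
    finally show "(\<integral>\<^sup>+ x. indicator A (x + y) * indicator B y \<partial>m) = emeasure m A * indicator B y"
      by (simp add: nn_integral_multc)
  qed
  also have "\<dots> = emeasure m A * emeasure lborel B"
    by (simp add: nn_integral_cmult)
  also have "emeasure lborel B = 1"
    unfolding B_def by (simp add: emeasure_lborel_cbox_eq)
  finally have lhs: "(\<integral>\<^sup>+ y. \<integral>\<^sup>+ x. indicator A (x + y) * indicator B y \<partial>m \<partial>lborel) = emeasure m A"
    by simp
  have "(\<integral>\<^sup>+ y. \<integral>\<^sup>+ x. indicator A (x + y) * indicator B y \<partial>m \<partial>lborel)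
     = (\<integral>\<^sup>+ x. \<integral>\<^sup>+ y. indicator A (x + y) * indicator B y \<partial>lborel \<partial>m)"
    by (rule P.Fubini') measurable
  also have "\<dots> = (\<integral>\<^sup>+ x. \<integral>\<^sup>+ z. indicator A z * indicator B (z - x) \<partial>lborel \<partial>m)"
  proof (rule nn_integral_cong)
    fix x :: 'a
    have "(\<integral>\<^sup>+ z. indicator A z * indicator B (z - x) \<partial>lborel)
       = (\<integral>\<^sup>+ z. indicator A z * indicator B (z - x) \<partial>distr lborel borel ((+) x))"
      by (simp add: lborel_distr_plus)
    also have "\<dots> = (\<integral>\<^sup>+ y. indicator A (x + y) * indicator B y \<partial>lborel)"
      by (subst nn_integral_distr) auto
    finally show "(\<integral>\<^sup>+ y. indicator A (x + y) * indicator B y \<partial>lborel)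
       = (\<integral>\<^sup>+ z. indicator A z * indicator B (z - x) \<partial>lborel)" ..
  qed
  also have "\<dots> = (\<integral>\<^sup>+ z. \<integral>\<^sup>+ x. indicator A z * indicator B (z - x) \<partial>m \<partial>lborel)"
    by (rule P.Fubini'[symmetric]) measurable
  also have "\<dots> = (\<integral>\<^sup>+ z. emeasure m (cbox 0 One) * indicator A z \<partial>lborel)"
  proof (rule nn_integral_cong)
    fix z :: 'a
    have eq: "(\<lambda>x. z - x) -` B = (+) z ` cbox 0 One"
    proof -
      have "(\<lambda>x. z - x) -` B = {x. x - z \<in> cbox 0 One}"
        unfolding B_def by (auto simp: mem_box inner_simps algebra_simps)
      also have "\<dots> = (+) z ` cbox 0 One"
        by (auto simp: image_iff) (metis add.commute diff_add_cancel)
      finally show ?thesis .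
    qed
    have "(\<integral>\<^sup>+ x. indicator B (z - x) \<partial>m) = (\<integral>\<^sup>+ x. indicator ((\<lambda>x. z - x) -` B) x \<partial>m)"
      by (simp add: indicator_vimage)
    also have "\<dots> = emeasure m ((\<lambda>x. z - x) -` B)"
      by (rule nn_integral_indicator)
        (use measurable_sets[of "\<lambda>x. z - x" borel borel B] sets_m in simp)
    also have "\<dots> = emeasure m (cbox 0 One)" unfolding eq by (rule inv) simp
    finally show "(\<integral>\<^sup>+ x. indicator A z * indicator B (z - x) \<partial>m) = emeasure m (cbox 0 One) * indicator A z"
      by (simp add: nn_integral_cmult mult.commute)
  qed
  also have "\<dots> = emeasure m (cbox 0 One) * emeasure lborel A"
    by (simp add: nn_integral_cmult)
  finally show ?thesis using lhs by simp
qed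

text \<open>The ratio of Hausdorff measure to Lebesgue measure on the plane (by the isodiametric
  inequality it is \<open>1\<close>).\<close>

definition planar_factor :: real where
  "planar_factor = enn2real (hausdorff2_outer (cbox 0 One :: (real^2) set))"

text \<open>The square is covered by the \<open>n\<^sup>2\<close> squares of a grid, and \<open>2 / n\<close> is a bound for their diameters.\<close>

lemma hausdorff2_outer_unit_square_finite:
  "hausdorff2_outer (cbox 0 One :: (real^2) set) \<le> ennreal pi"
  unfolding hausdorff2_outer_def
proof (rule SUP_least)
  fix \<delta> :: real assume "\<delta> \<in> {0<..}"
  then obtain n :: nat where n: "2 / \<delta> < real n" and \<delta>: "0 < \<delta>" using reals_Archimedean2 by auto
  moreover have "0 < 2 / \<delta>" using \<delta> by simp
  ultimately have n0: "0 < real n" "n > 0" by linarith+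
  define C where "C k = (if k < n*n then
      {x::real^2. real (k div n) / n \<le> x$1 \<and> x$1 \<le> (real (k div n) + 1) / n \<and>
                  real (k mod n) / n \<le> x$2 \<and> x$2 \<le> (real (k mod n) + 1) / n} else {})" for k
  have dC: "dist x y \<le> 2 / n" if "x \<in> C k" "y \<in> C k" for x y k
  proof -
    have "\<bar>x$1 - y$1\<bar> \<le> 1/n" "\<bar>x$2 - y$2\<bar> \<le> 1/n"
      using that by (auto simp: C_def add_divide_distrib split: if_splits)
    moreover have "dist x y \<le> (\<Sum>i\<in>UNIV. \<bar>(x - y)$i\<bar>)"
      unfolding dist_norm by (rule norm_le_l1_cart)
    ultimately show ?thesis by (simp add: sum_2)
  qed
  have bC: "bounded (C k)" for k using dC by (auto simp: bounded_two_points)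
  have diamC: "diameter (C k) \<le> 2 / n" for k
    by (rule diameter_le) (use dC in \<open>auto simp: dist_norm\<close>)
  have floor_bound: "\<exists>i<n. real i / n \<le> t \<and> t \<le> (real i + 1) / n" if t: "0 \<le> t" "t \<le> 1" for t :: real
  proof (cases "t = 1")
    case True
    show ?thesis using n0 by (intro exI[of _ "n - 1"]) (auto simp: True of_nat_diff)
  next
    case False
    define i where "i = nat \<lfloor>t * n\<rfloor>"
    have i: "real i = of_int \<lfloor>t * n\<rfloor>" using t n0 by (simp add: i_def)
    then have "real i \<le> t * n" "t * n \<le> real i + 1" by linarith+
    moreover have "t * real n < 1 * real n" using t False n0 by (intro mult_strict_right_mono) auto
    ultimately have "real i < real n" by linarith
    with \<open>real i \<le> t * n\<close> \<open>t * n \<le> real i + 1\<close> show ?thesis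
      using n0 by (intro exI[of _ i]) (auto simp: field_simps)
  qed
  have cover: "cbox 0 One \<subseteq> (\<Union>k. C k)"
  proof
    fix x :: "real^2" assume "x \<in> cbox 0 One"
    then have x: "0 \<le> x$1" "x$1 \<le> 1" "0 \<le> x$2" "x$2 \<le> 1" by (auto simp: mem_box_cart)
    obtain i where i: "i < n" "real i / n \<le> x$1" "x$1 \<le> (real i + 1) / n" using floor_bound[OF x(1,2)] by auto
    obtain j where j: "j < n" "real j / n \<le> x$2" "x$2 \<le> (real j + 1) / n" using floor_bound[OF x(3,4)] by auto
    have k: "(i * n + j) div n = i" "(i * n + j) mod n = j" using j by auto
    have "i * n + j < (i + 1) * n" using j by simp
    also have "\<dots> \<le> n * n" using i by (intro mult_right_mono) auto
    finally have "x \<in> C (i * n + j)" unfolding C_def k using i j by auto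
    then show "x \<in> (\<Union>k. C k)" by (rule UN_I[OF UNIV_I])
  qed
  have "hausdorff2_delta \<delta> (cbox 0 One :: (real^2) set) \<le> (\<Sum>k. disc_area (C k))"
  proof (rule hausdorff2_delta_le_cover[OF cover bC])
    have "2 / n \<le> \<delta>" using n n0 \<delta> by (simp add: field_simps)
    then show "diameter (C k) \<le> \<delta>" for k using diamC[of k] by simp
  qed
  also have "\<dots> = (\<Sum>k<n*n. disc_area (C k))"
    by (rule suminf_finite) (auto simp: C_def)
  also have "\<dots> \<le> (\<Sum>k<n*n. ennreal (pi * (1 / n)\<^sup>2))"
  proof (rule sum_mono)
    fix k
    have "(diameter (C k) / 2)\<^sup>2 \<le> (1/n)\<^sup>2"
      using diamC[of k] diameter_ge_0[OF bC[of k]] by (intro power_mono) auto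
    then show "disc_area (C k) \<le> ennreal (pi * (1 / n)\<^sup>2)" by (intro ennreal_leI mult_left_mono) auto
  qed
  also have "\<dots> = ennreal (\<Sum>k<n*n. pi * (1 / n)\<^sup>2)" by (rule sum_ennreal) simp
  also have "(\<Sum>k<n*n. pi * (1 / n)\<^sup>2) = pi" using n0 by (simp add: power2_eq_square)
  finally show "hausdorff2_delta \<delta> (cbox 0 One :: (real^2) set) \<le> ennreal pi" .
qed

text \<open>A set of diameter \<open>d\<close> lies in a square of side \<open>2 d\<close>, whose area is \<open>16 / pi\<close> times
  \<open>pi (d / 2)\<^sup>2\<close>.\<close>

lemma emeasure_lborel_le_hausdorff2_outer:
  fixes A :: "(real^2) set"
  assumes A: "A \<in> sets borel"
  shows "emeasure lborel A \<le> ennreal (16 / pi) * hausdorff2_outer A"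
proof -
  have "emeasure lborel A \<le> ennreal (16 / pi) * (\<Sum>i. disc_area (C i))"
    if C: "A \<subseteq> (\<Union>i. C i)" "\<And>i. bounded (C i)" for C :: "nat \<Rightarrow> (real^2) set"
  proof -
    define p where "p i = (SOME x. x \<in> C i)" for i
    define Q where "Q i = cbox (p i - diameter (C i) *\<^sub>R One) (p i + diameter (C i) *\<^sub>R One)" for i
    have "C i \<subseteq> Q i" for i
    proof
      fix x assume x: "x \<in> C i"
      then have "p i \<in> C i" unfolding p_def by (rule someI)
      then have "dist x (p i) \<le> diameter (C i)" using x diameter_bounded_bound[OF C(2)] by blast
      then have "\<bar>(x - p i)$j\<bar> \<le> diameter (C i)" for j
        using component_le_norm_cart[of "x - p i" j] by (simp add: dist_norm)
      then have "\<bar>x$j - p i$j\<bar> \<le> diameter (C i)" for j by simp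
      then show "x \<in> Q i" unfolding Q_def mem_box_cart abs_le_iff by (simp add: algebra_simps)
    qed
    then have "A \<subseteq> (\<Union>i. Q i)" using C(1) by (meson SUP_mono order_trans)
    then have "emeasure lborel A \<le> emeasure lborel (\<Union>i. Q i)"
      by (intro emeasure_mono) (auto simp: Q_def)
    also have "\<dots> \<le> (\<Sum>i. emeasure lborel (Q i))"
      by (rule emeasure_subadditive_countably) (auto simp: Q_def)
    also have "\<dots> \<le> (\<Sum>i. ennreal (16 / pi) * disc_area (C i))"
    proof (rule suminf_le)
      show "emeasure lborel (Q i) \<le> ennreal (16 / pi) * disc_area (C i)" for i
      proof -
        have d: "0 \<le> diameter (C i)" using C(2) by (rule diameter_ge_0)
        have diff: "p i + diameter (C i) *\<^sub>R One - (p i - diameter (C i) *\<^sub>R One) = (2 * diameter (C i)) *\<^sub>R One"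
          unfolding mult_2 scaleR_add_left by (simp only: add_diff_eq diff_diff_eq2 add.commute add.left_commute add_diff_cancel_left')
        have "emeasure lborel (Q i) = ennreal (\<Prod>b\<in>Basis. ((2 * diameter (C i)) *\<^sub>R (One :: real^2)) \<bullet> b)"
          unfolding Q_def diff[symmetric]
          by (rule emeasure_lborel_cbox) (use d in \<open>simp add: inner_diff_left inner_add_left\<close>)
        also have "(\<Prod>b\<in>Basis. ((2 * diameter (C i)) *\<^sub>R (One :: real^2)) \<bullet> b) = (\<Prod>b\<in>(Basis :: (real^2) set). 2 * diameter (C i))"
          by (rule prod.cong[OF refl]) (simp only: inner_scaleR_left inner_sum_left_Basis[of _ "\<lambda>_. 1", unfolded scaleR_one] mult_1_right)
        also have "\<dots> = (2 * diameter (C i))\<^sup>2" by simp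
        also have "\<dots> = (16 / pi) * (pi * (diameter (C i) / 2)\<^sup>2)"
          by (simp add: power2_eq_square)
        finally show ?thesis by (simp add: ennreal_mult[symmetric])
      qed
    qed auto
    also have "\<dots> = ennreal (16 / pi) * (\<Sum>i. disc_area (C i))" by simp
    finally show ?thesis .
  qed
  then have "emeasure lborel A \<le> ennreal (16 / pi) * hausdorff2_delta 1 A"
    unfolding hausdorff2_delta_def by (intro le_mult_INF_ennreal) auto
  also have "\<dots> \<le> ennreal (16 / pi) * hausdorff2_outer A"
    by (intro mult_left_mono hausdorff2_delta_le_outer) auto
  finally show ?thesis .
qed

lemma planar_factor_pos: "0 < planar_factor"
proof -
  have "emeasure lborel (cbox 0 One :: (real^2) set) = 1" by (simp add: emeasure_lborel_cbox_eq)
  then have "1 \<le> ennreal (16 / pi) * hausdorff2_outer (cbox 0 One :: (real^2) set)"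
    using emeasure_lborel_le_hausdorff2_outer[of "cbox 0 One"] by simp
  then have "hausdorff2_outer (cbox 0 One :: (real^2) set) \<noteq> 0" by (auto simp: not_le)
  moreover have "hausdorff2_outer (cbox 0 One :: (real^2) set) < \<infinity>"
    using hausdorff2_outer_unit_square_finite by (auto intro: le_less_trans)
  ultimately show ?thesis
    unfolding planar_factor_def by (simp add: enn2real_positive_iff zero_less_iff_neq_zero)
qed

lemma planar_factor_eq: "hausdorff2_outer (cbox 0 One :: (real^2) set) = ennreal planar_factor"
  unfolding planar_factor_def
  using hausdorff2_outer_unit_square_finite by (subst ennreal_enn2real) (auto intro: le_less_trans)

text \<open>The differential of a parametrization whose partial derivatives are \<open>a\<close> and \<open>b\<close>.\<close>

definition frame_map :: "real^3 \<Rightarrow> real^3 \<Rightarrow> real^2 \<Rightarrow> real^3" where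
  "frame_map a b x = x$1 *\<^sub>R a + x$2 *\<^sub>R b"

lemma linear_frame_map [simp]: "linear (frame_map a b)"
  unfolding frame_map_def by (intro linearI) (auto simp: algebra_simps)

lemma inj_frame_map:
  assumes "cross3 a b \<noteq> 0" shows "inj (frame_map a b)"
  unfolding linear_injective_0[OF linear_frame_map]
proof (intro allI impI)
  fix x assume "frame_map a b x = 0"
  then have "cross3 (frame_map a b x) b = 0" "cross3 a (frame_map a b x) = 0" by auto
  then have "x$1 *\<^sub>R cross3 a b = 0" "x$2 *\<^sub>R cross3 a b = 0"
    by (auto simp: frame_map_def cross_add_left cross_mult_left cross_add_right cross_mult_right)
  then have "x$1 = 0" "x$2 = 0" using assms by auto
  then show "x = 0" by (simp add: vec_eq_iff forall_2)
qed

lemma hausdorff2_outer_box_finite: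
  fixes f :: "real^2 \<Rightarrow> 'b::metric_space"
  assumes lip: "\<And>x y. dist (f x) (f y) \<le> L * dist x y" and L: "0 < L"
  shows "hausdorff2_outer (f ` cbox (- (real n *\<^sub>R One)) (real n *\<^sub>R One)) < \<infinity>"
proof -
  define g :: "real^2 \<Rightarrow> real^2" where "g x = (2 * real n) *\<^sub>R x - real n *\<^sub>R One" for x
  have sub: "cbox (- (real n *\<^sub>R One)) (real n *\<^sub>R One) \<subseteq> g ` cbox 0 One"
  proof (cases "n = 0")
    case True
    then show ?thesis by (auto simp: g_def image_constant_conv mem_box_cart)
  next
    case False
    show ?thesis
    proof
      fix x :: "real^2" assume x: "x \<in> cbox (- (real n *\<^sub>R One)) (real n *\<^sub>R One)"
      have "(1/2) *\<^sub>R One + (1 / (2 * real n)) *\<^sub>R x \<in> cbox 0 One"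
        using x False by (auto simp: mem_box_cart field_simps) (smt (verit))
      moreover have "x = g ((1/2) *\<^sub>R One + (1 / (2 * real n)) *\<^sub>R x)"
        using False by (simp add: g_def algebra_simps)
      ultimately show "x \<in> g ` cbox 0 One" by blast
    qed
  qed
  have "hausdorff2_outer (f ` cbox (- (real n *\<^sub>R One)) (real n *\<^sub>R One)) \<le> hausdorff2_outer ((\<lambda>x. f (g x)) ` cbox 0 One)"
    using sub by (intro hausdorff2_outer_mono) blast
  also have "\<dots> \<le> ennreal ((L * (2 * real n + 1))\<^sup>2) * hausdorff2_outer (cbox 0 One :: (real^2) set)"
  proof (rule hausdorff2_outer_lipschitz_image)
    fix x y
    have "dist (f (g x)) (f (g y)) \<le> L * dist (g x) (g y)" by (rule lip)
    also have "dist (g x) (g y) = (2 * real n) * dist x y"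
      unfolding g_def dist_norm by (simp add: scaleR_diff_right[symmetric])
    also have "L * \<dots> \<le> (L * (2 * real n + 1)) * dist x y" using L by (simp add: algebra_simps)
    finally show "dist (f (g x)) (f (g y)) \<le> (L * (2 * real n + 1)) * dist x y" .
  qed (use L in \<open>simp add: add_nonneg_pos\<close>)
  also have "\<dots> < \<infinity>" unfolding planar_factor_eq by (simp add: ennreal_mult[symmetric] less_top planar_factor_def)
  finally show ?thesis .
qed

text \<open>The area of \<open>f ` A\<close> is a translation invariant measure in \<open>A\<close>; it is the image under a left
  inverse of \<open>f\<close> of Hausdorff measure on the range of \<open>f\<close>.\<close>

lemma hausdorff2_outer_linear_image:
  fixes f :: "real^2 \<Rightarrow> 'b::euclidean_space"
  assumes f: "linear f" "inj f" and A: "A \<in> sets borel"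
  shows "hausdorff2_outer (f ` A) = hausdorff2_outer (f ` cbox 0 One) * emeasure lborel A"
proof -
  obtain g where g: "linear g" "g \<circ> f = id" using linear_injective_left_inverse[OF f] by blast
  have gf: "g (f x) = x" for x using g(2) by (metis comp_apply id_apply)
  have [measurable]: "g \<in> borel_measurable borel"
    using g(1) by (intro borel_measurable_continuous_onI linear_continuous_on) (simp add: linear_conv_bounded_linear)
  have [measurable]: "range f \<in> sets borel"
    using f(1) by (intro borel_closed closed_subspace linear_subspace_image) auto
  define m where "m = distr (density hausdorff2 (indicator (range f))) borel g"
  have em: "emeasure m B = hausdorff2_outer (f ` B)" if [measurable]: "B \<in> sets borel" for B
  proof -
    have "emeasure m B = emeasure (density hausdorff2 (indicator (range f))) (g -` B)"
      unfolding m_def by (subst emeasure_distr) auto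
    also have "\<dots> = emeasure hausdorff2 (range f \<inter> g -` B)"
      using measurable_sets[of g borel borel B] by (subst emeasure_restricted) auto
    also have "range f \<inter> g -` B = f ` B" using gf by (auto simp: image_iff)
    also have "emeasure hausdorff2 (f ` B) = hausdorff2_outer (f ` B)"
    proof (rule emeasure_hausdorff2)
      have "range f \<inter> g -` B \<in> sets borel"
        using measurable_sets[of g borel borel B] by auto
      then show "f ` B \<in> sets borel" using \<open>range f \<inter> g -` B = f ` B\<close> by simp
    qed
    finally show ?thesis .
  qed
  have "emeasure m A = emeasure m (cbox 0 One) * emeasure lborel A"
  proof (rule translation_invariant_eq_lborel[OF _ _ _ A])
    show "sets m = sets borel" by (simp add: m_def)
    show "emeasure m ((+) t ` B) = emeasure m B" if B: "B \<in> sets borel" for B t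
    proof -
      have "(+) t ` B = (\<lambda>x. x - t) -` B" by (auto simp: image_iff) (metis add.commute diff_add_cancel)
      moreover have "(\<lambda>x. x - t) -` B \<in> sets borel"
        using measurable_sets[of "\<lambda>x. x - t" borel borel B] B by simp
      ultimately have tB: "(+) t ` B \<in> sets borel" by simp
      have "f ` (+) t ` B = (+) (f t) ` f ` B" using f by (auto simp: image_image linear_add)
      then show ?thesis unfolding em[OF tB] em[OF B]
        by (simp add: hausdorff2_outer_isometric_image dist_norm)
    qed
    obtain L where L: "L > 0" "\<And>x. norm (f x) \<le> L * norm x"
      using linear_bounded_pos[OF f(1)] by auto
    show "emeasure m (cbox (- (real n *\<^sub>R One)) (real n *\<^sub>R One)) < \<infinity>" for n
      using L f(1) by (simp add: em) (intro hausdorff2_outer_box_finite[unfolded infinity_ennreal_def], auto simp: dist_norm linear_diff[symmetric])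
  qed
  then show ?thesis using A by (simp add: em)
qed

lemma hausdorff2_outer_plane:
  "A \<in> sets borel \<Longrightarrow> hausdorff2_outer (A :: (real^2) set) = ennreal planar_factor * emeasure lborel A"
  using hausdorff2_outer_linear_image[of "\<lambda>x::real^2. x" A] by (simp add: linear_id[unfolded id_def] planar_factor_eq)

text \<open>Gram-Schmidt, written as a triangular change of parameters.\<close>

lemma orthonormal_reparametrization:
  assumes ab: "cross3 a b \<noteq> 0"
  shows "\<exists>B :: real^2 \<Rightarrow> real^2. linear B \<and> (\<forall>x. norm (frame_map a b (B x)) = norm x) \<and>
    det (matrix B) = 1 / norm (cross3 a b)"
proof -
  define u where "u = norm a"
  have u: "u > 0" using ab by (auto simp: u_def)
  define c where "c = b - ((a \<bullet> b) / u\<^sup>2) *\<^sub>R a"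
  have aa: "a \<bullet> a = u\<^sup>2" by (simp add: u_def power2_norm_eq_inner)
  have ac: "a \<bullet> c = 0" using u by (simp add: c_def inner_diff_right aa)
  have cross: "cross3 a b = cross3 a c"
    by (simp add: c_def bilinear_rsub[OF bilinear_cross] cross_mult_right)
  then have ncr: "norm (cross3 a b) = u * norm c"
    using norm_cross_dot[of a c] ac
    by (metis add.right_neutral norm_ge_zero power2_eq_iff_nonneg u_def zero_le_mult_iff zero_power2)
  have c0: "norm c > 0" using ab cross by (auto)
  define B :: "real^2 \<Rightarrow> real^2" where
    "B x = vector [x$1 / u - x$2 * ((a \<bullet> b) / u\<^sup>2) / norm c, x$2 / norm c]" for x
  have linB: "linear B" unfolding B_def
    by (intro linearI) (auto simp: vec_eq_iff forall_2 add_divide_distrib distrib_right distrib_left algebra_simps)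
  have fB: "frame_map a b (B x) = (x$1 / u) *\<^sub>R a + (x$2 / norm c) *\<^sub>R c" for x
    unfolding frame_map_def B_def c_def by (simp add: algebra_simps)
  have norm_fB: "norm (frame_map a b (B x)) = norm x" for x
  proof -
    have "(norm (frame_map a b (B x)))\<^sup>2 = (x$1)\<^sup>2 + (x$2)\<^sup>2"
      unfolding power2_norm_eq_inner fB using u c0 ac
      by (simp add: inner_add_left inner_add_right inner_commute[of c a] aa power2_eq_square[symmetric])
         (simp add: power2_norm_eq_inner[symmetric] power_divide power2_eq_square)
    also have "\<dots> = (norm x)\<^sup>2"
      unfolding power2_norm_eq_inner by (simp add: inner_vec_def sum_2 power2_eq_square)
    finally show ?thesis by simp
  qed
  have "det (matrix B) = 1 / norm (cross3 a b)"
    unfolding det_2 ncr by (simp add: matrix_def B_def axis_def)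
  then show ?thesis using linB norm_fB by blast
qed

text \<open>Both sides are multiples of Lebesgue measure, so it suffices to compare them on one
  parallelogram: the one on which the orthonormal reparametrization makes \<open>frame_map a b\<close> an
  isometry. The determinant of the reparametrization supplies the factor \<open>norm (cross3 a b)\<close>.\<close>

lemma hausdorff2_outer_frame_map:
  assumes ab: "cross3 a b \<noteq> 0" and A: "A \<in> sets borel"
  shows "hausdorff2_outer (frame_map a b ` A) = ennreal (planar_factor * norm (cross3 a b)) * emeasure lborel A"
proof -
  obtain B :: "real^2 \<Rightarrow> real^2" where linB: "linear B" and norm_fB: "\<And>x. norm (frame_map a b (B x)) = norm x"
    and detB: "det (matrix B) = 1 / norm (cross3 a b)"
    using orthonormal_reparametrization[OF ab] by metis
  let ?Q = "cbox 0 One :: (real^2) set"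
  have "hausdorff2_outer (frame_map a b ` B ` ?Q) = hausdorff2_outer ?Q"
    unfolding image_image
    by (rule hausdorff2_outer_isometric_image)
      (simp add: dist_norm norm_fB linear_diff[OF linear_frame_map, symmetric] linear_diff[OF linB, symmetric])
  moreover have cB: "compact (B ` ?Q)"
    using linB by (intro compact_continuous_image linear_continuous_on) (auto simp: linear_conv_bounded_linear)
  ultimately have 1: "hausdorff2_outer (frame_map a b ` ?Q) * emeasure lborel (B ` ?Q) = ennreal planar_factor"
    using hausdorff2_outer_linear_image[OF linear_frame_map inj_frame_map[OF ab], of "B ` ?Q"]
    by (simp add: planar_factor_eq borel_compact)
  have "emeasure lborel (B ` ?Q) = ennreal (measure lebesgue (B ` ?Q))"
    using cB emeasure_bounded_finite[OF compact_imp_bounded[OF cB]]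
    by (subst emeasure_eq_ennreal_measure[symmetric]) (auto simp: borel_compact)
  also have "measure lebesgue (B ` ?Q) = \<bar>det (matrix B)\<bar> * measure lebesgue ?Q"
    by (rule measure_linear_image[OF linB]) simp
  also have "measure lebesgue ?Q = 1" by (simp add: content_cbox_if)
  finally have "emeasure lborel (B ` ?Q) = ennreal (1 / norm (cross3 a b))"
    by (simp add: detB)
  with 1 have 2: "hausdorff2_outer (frame_map a b ` ?Q) * ennreal (1 / norm (cross3 a b)) = ennreal planar_factor"
    by simp
  have "hausdorff2_outer (frame_map a b ` ?Q) = hausdorff2_outer (frame_map a b ` ?Q) * (ennreal (1 / norm (cross3 a b)) * ennreal (norm (cross3 a b)))"
    using ab by (subst ennreal_mult[symmetric]) auto
  also have "\<dots> = ennreal (planar_factor * norm (cross3 a b))"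
    unfolding mult.assoc[symmetric] 2 using planar_factor_pos by (simp add: ennreal_mult)
  finally show ?thesis
    using hausdorff2_outer_linear_image[OF linear_frame_map inj_frame_map[OF ab] A] by simp
qed


section \<open>The area formula for a parametrized patch\<close>

lemma hausdorff2_outer_comparison:
  assumes "\<And>x y. x \<in> A \<Longrightarrow> y \<in> A \<Longrightarrow> dist (g x) (g y) \<le> L * dist (f x) (f y)" "inj_on f A" "0 < L"
  shows "hausdorff2_outer (g ` A) \<le> ennreal (L\<^sup>2) * hausdorff2_outer (f ` A)"
proof -
  have "hausdorff2_outer ((g \<circ> inv_into A f) ` (f ` A)) \<le> ennreal (L\<^sup>2) * hausdorff2_outer (f ` A)"
    by (rule hausdorff2_outer_lipschitz_image) (use assms in auto)
  moreover have "(g \<circ> inv_into A f) ` (f ` A) = g ` A"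
    using assms(2) by (auto simp: image_iff)
  ultimately show ?thesis by simp
qed

lemma norm_frame_map_diff_le:
  "norm (frame_map a b x - frame_map a' b' x) \<le> (norm (a - a') + norm (b - b')) * norm x"
proof -
  have "frame_map a b x - frame_map a' b' x = x$1 *\<^sub>R (a - a') + x$2 *\<^sub>R (b - b')"
    by (simp add: frame_map_def algebra_simps)
  also have "norm \<dots> \<le> \<bar>x$1\<bar> * norm (a - a') + \<bar>x$2\<bar> * norm (b - b')"
    using norm_triangle_ineq[of "x$1 *\<^sub>R (a - a')" "x$2 *\<^sub>R (b - b')"] by simp
  also have "\<dots> \<le> norm x * norm (a - a') + norm x * norm (b - b')"
    by (intro add_mono mult_right_mono component_le_norm_cart) auto
  finally show ?thesis by (simp add: algebra_simps)
qed

text \<open>The fields \<open>a\<close> and \<open>b\<close> are the partial derivatives of \<open>\<phi>\<close>. Their cross product spans the normal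
  line, and its length \<open>jac\<close> is the area density of the parametrization.\<close>

locale C1_patch =
  fixes U :: "(real^2) set" and \<phi> :: "real^2 \<Rightarrow> real^3" and \<psi> :: "real^3 \<Rightarrow> real^2"
    and a b :: "real^2 \<Rightarrow> real^3"
  assumes open_U: "open U"
    and homeo: "homeomorphism U (\<phi> ` U) \<phi> \<psi>"
    and deriv: "\<And>u. u \<in> U \<Longrightarrow> (\<phi> has_derivative frame_map (a u) (b u)) (at u)"
    and cont_a: "continuous_on U a" and cont_b: "continuous_on U b"
    and immersed: "\<And>u. u \<in> U \<Longrightarrow> cross3 (a u) (b u) \<noteq> 0"
begin

definition jac :: "real^2 \<Rightarrow> real" where "jac u = norm (cross3 (a u) (b u))"

lemma jac_pos: "u \<in> U \<Longrightarrow> 0 < jac u"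
  using immersed by (simp add: jac_def)

lemma cont_jac: "continuous_on U jac"
  unfolding jac_def[abs_def] by (intro continuous_on_norm continuous_on_cross cont_a cont_b)

lemma psi_phi [simp]: "u \<in> U \<Longrightarrow> \<psi> (\<phi> u) = u"
  using homeo by (simp add: homeomorphism_def)

lemma cont_phi: "continuous_on U \<phi>" and cont_psi: "continuous_on (\<phi> ` U) \<psi>"
  using homeo by (auto simp: homeomorphism_def)

lemma inj_phi: "inj_on \<phi> U"
  by (metis inj_onI psi_phi)

text \<open>The mean value inequality for the difference of \<open>\<phi>\<close> and its differential at \<open>u\<close>, on a ball on
  which the partial derivatives vary by less than \<open>e / 2\<close>.\<close>

lemma local_linear_approximation:
  assumes u: "u \<in> U" and e: "0 < e"
  shows "\<exists>r>0. ball u r \<subseteq> U \<and>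
    (\<forall>x\<in>ball u r. \<forall>y\<in>ball u r. norm (\<phi> x - \<phi> y - frame_map (a u) (b u) (x - y)) \<le> e * norm (x - y)) \<and>
    (\<forall>x\<in>ball u r. \<bar>jac x - jac u\<bar> \<le> e)"
proof -
  have ev: "\<forall>\<^sub>F x in nhds u. x \<in> U \<and> dist (a x) (a u) < e/2 \<and> dist (b x) (b u) < e/2 \<and> dist (jac x) (jac u) < e"
  proof (intro eventually_conj)
    show "\<forall>\<^sub>F x in nhds u. x \<in> U" using open_U u by (rule eventually_nhds_in_open)
    have at_U: "at u within U = at u" using u open_U by (rule at_within_open)
    have *: "\<forall>\<^sub>F x in nhds u. dist (f x) (f u) < d" if "continuous_on U f" "0 < d" for d and f :: "real^2 \<Rightarrow> 'c::metric_space"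
    proof -
      have "isCont f u" using that(1) u open_U by (simp add: continuous_on_eq_continuous_at)
      then have "(f \<longlongrightarrow> f u) (nhds u)" by (simp add: continuous_within tendsto_at_iff_tendsto_nhds)
      then show ?thesis using that(2) by (rule tendstoD)
    qed
    show "\<forall>\<^sub>F x in nhds u. dist (a x) (a u) < e/2" using e by (intro * cont_a) simp
    show "\<forall>\<^sub>F x in nhds u. dist (b x) (b u) < e/2" using e by (intro * cont_b) simp
    show "\<forall>\<^sub>F x in nhds u. dist (jac x) (jac u) < e" using e by (intro * cont_jac)
  qed
  then obtain r where r: "r > 0" and ball: "\<And>x. x \<in> ball u r \<Longrightarrow> x \<in> U \<and> dist (a x) (a u) < e/2 \<and> dist (b x) (b u) < e/2 \<and> dist (jac x) (jac u) < e"
    unfolding eventually_nhds_metric by (auto simp: dist_commute)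
  let ?L = "frame_map (a u) (b u)"
  have "norm (\<phi> x - \<phi> y - ?L (x - y)) \<le> e * norm (x - y)" if xy: "x \<in> ball u r" "y \<in> ball u r" for x y
  proof -
    have "norm ((\<phi> x - ?L x) - (\<phi> y - ?L y)) \<le> e * norm (x - y)"
    proof (rule differentiable_bound[where S = "ball u r" and f = "\<lambda>x. \<phi> x - ?L x" and f' = "\<lambda>x v. frame_map (a x) (b x) v - ?L v"])
      show "((\<lambda>x. \<phi> x - ?L x) has_derivative (\<lambda>v. frame_map (a z) (b z) v - ?L v)) (at z within ball u r)" if "z \<in> ball u r" for z
        using deriv ball[OF that]
        by (intro has_derivative_diff has_derivative_at_withinI[OF deriv] has_derivative_at_withinI[OF linear_imp_has_derivative]) auto
      show "onorm (\<lambda>v. frame_map (a z) (b z) v - ?L v) \<le> e" if "z \<in> ball u r" for z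
      proof (rule onorm_bound)
        show "norm (frame_map (a z) (b z) v - ?L v) \<le> e * norm v" for v
        proof -
          have "norm (a z - a u) + norm (b z - b u) \<le> e" using ball[OF that] by (simp add: dist_norm)
          then show ?thesis
            using norm_frame_map_diff_le[of "a z" "b z" v "a u" "b u"] mult_right_mono[of _ e "norm v"]
            by (meson norm_ge_zero order_trans)
        qed
      qed (use e in simp)
    qed (use xy in auto)
    then show ?thesis by (simp add: linear_diff[OF linear_frame_map] algebra_simps)
  qed
  moreover have "ball u r \<subseteq> U" using ball by auto
  moreover have "\<bar>jac x - jac u\<bar> \<le> e" if "x \<in> ball u r" for x
    using ball[OF that] by (simp add: dist_real_def)
  ultimately show ?thesis using r by blast
qed

lemma sets_image: "\<phi> ` U \<in> sets borel"
proof -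
  obtain D :: "nat \<Rightarrow> (real^2) set" where D: "\<And>n. compact (D n)" "\<And>n. D n \<subseteq> U" "(\<Union>n. D n) = U"
    using open_Union_compact_subsets[OF open_U] by metis
  have "\<phi> ` U = (\<Union>n. \<phi> ` D n)" using D(3) by blast
  moreover have "\<phi> ` D n \<in> sets borel" for n
    using D continuous_on_subset[OF cont_phi] by (intro borel_compact compact_continuous_image) auto
  ultimately show ?thesis by auto
qed

lemma psi_measurable: "\<psi> \<in> borel_measurable (restrict_space hausdorff2 (\<phi> ` U))"
  using borel_measurable_continuous_on_restrict[OF cont_psi]
  by (simp add: measurable_def sets_restrict_space space_restrict_space)

text \<open>The area of \<open>\<phi> ` A\<close> as a function of \<open>A\<close>. As an image measure under \<open>\<psi>\<close> it is a measure by
  construction.\<close>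

definition pullback_measure :: "(real^2) measure" where
  "pullback_measure = distr (restrict_space hausdorff2 (\<phi> ` U)) borel \<psi>"

definition area_measure :: "(real^2) measure" where
  "area_measure = density lborel (\<lambda>u. ennreal (planar_factor * jac u) * indicator U u)"

lemma jac_measurable [measurable]: "(\<lambda>u. ennreal (planar_factor * jac u) * indicator U u) \<in> borel_measurable borel"
proof -
  have "(\<lambda>u. indicator U u *\<^sub>R (planar_factor * jac u)) \<in> borel_measurable borel"
    using open_U by (intro borel_measurable_continuous_on_indicator continuous_intros cont_jac) auto
  then have "(\<lambda>u. ennreal (indicator U u *\<^sub>R (planar_factor * jac u))) \<in> borel_measurable borel"
    by measurable
  also have "(\<lambda>u. ennreal (indicator U u *\<^sub>R (planar_factor * jac u))) = (\<lambda>u. ennreal (planar_factor * jac u) * indicator U u)"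
    by (auto simp: indicator_def)
  finally show ?thesis .
qed

lemma emeasure_pullback:
  assumes A: "A \<in> sets borel"
  shows "emeasure pullback_measure A = hausdorff2_outer (\<phi> ` (A \<inter> U))"
proof -
  have eq: "\<psi> -` A \<inter> \<phi> ` U = \<phi> ` (A \<inter> U)" by (auto simp: image_iff)
  have sp: "space (restrict_space hausdorff2 (\<phi> ` U)) = \<phi> ` U" by (simp add: space_restrict_space)
  have m: "\<psi> -` A \<inter> \<phi> ` U \<in> sets (restrict_space hausdorff2 (\<phi> ` U))"
    using measurable_sets[OF psi_measurable A] sp by simp
  then have b: "\<phi> ` (A \<inter> U) \<in> sets borel"
    unfolding eq using sets_image by (subst (asm) sets_restrict_space_iff) auto
  have "emeasure pullback_measure A = emeasure (restrict_space hausdorff2 (\<phi> ` U)) (\<phi> ` (A \<inter> U))"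
    unfolding pullback_measure_def using psi_measurable A by (subst emeasure_distr) (auto simp: sp eq)
  also have "\<dots> = emeasure hausdorff2 (\<phi> ` (A \<inter> U))"
    using sets_image by (intro emeasure_restrict_space) auto
  finally show ?thesis using emeasure_hausdorff2[OF b] by simp
qed

lemma emeasure_area_measure:
  "A \<in> sets borel \<Longrightarrow> emeasure area_measure A = (\<integral>\<^sup>+u. ennreal (planar_factor * jac u) * indicator (A \<inter> U) u \<partial>lborel)"
  unfolding area_measure_def using jac_measurable
  by (subst emeasure_density) (auto simp: indicator_def intro!: nn_integral_cong)

text \<open>Equality up to the factor \<open>((1 + e) / (1 - e))\<^sup>2\<close>, in a form that makes sense for infinite values.\<close>

definition comparable :: "real \<Rightarrow> (real^2) set \<Rightarrow> bool" where
  "comparable e A \<longleftrightarrow>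
     ennreal ((1 - e)\<^sup>2) * emeasure area_measure A \<le> ennreal ((1 + e)\<^sup>2) * emeasure pullback_measure A \<and>
     ennreal ((1 - e)\<^sup>2) * emeasure pullback_measure A \<le> ennreal ((1 + e)\<^sup>2) * emeasure area_measure A"

text \<open>Near \<open>u\<close> the parametrization is, up to factors close to \<open>1\<close>, the linear map \<open>D\<phi>(u)\<close>.\<close>

lemma local_comparison:
  assumes u: "u \<in> U" and e: "0 < e" "e < 1"
  shows "\<exists>r>0. ball u r \<subseteq> U \<and> (\<forall>A\<in>sets borel. A \<subseteq> ball u r \<longrightarrow> comparable e A)"
proof -
  let ?L = "frame_map (a u) (b u)"
  let ?k = "planar_factor * jac u"
  have k0: "0 < ?k" using planar_factor_pos jac_pos[OF u] by simp
  obtain m where m: "m > 0" "\<And>x. m * norm x \<le> norm (?L x)"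
    using linear_inj_bounded_below_pos[OF linear_frame_map inj_frame_map[OF immersed[OF u]]] by metis
  define d where "d = min (e * m) (e * jac u)"
  have d: "0 < d" using e m jac_pos[OF u] by (simp add: d_def)
  obtain r where r: "r > 0" "ball u r \<subseteq> U"
    and approx: "\<And>x y. x \<in> ball u r \<Longrightarrow> y \<in> ball u r \<Longrightarrow> norm (\<phi> x - \<phi> y - ?L (x - y)) \<le> d * norm (x - y)"
    and jac: "\<And>x. x \<in> ball u r \<Longrightarrow> \<bar>jac x - jac u\<bar> \<le> d"
    using local_linear_approximation[OF u d] by metis
  have approx': "norm (\<phi> x - \<phi> y - ?L (x - y)) \<le> e * norm (?L (x - y))" if "x \<in> ball u r" "y \<in> ball u r" for x y
  proof -
    have "d * norm (x - y) \<le> e * m * norm (x - y)" by (intro mult_right_mono) (auto simp: d_def)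
    also have "\<dots> \<le> e * norm (?L (x - y))" using m(2)[of "x - y"] e by (simp add: mult.assoc)
    finally show ?thesis using approx[OF that] by simp
  qed
  show ?thesis
  proof (intro exI[of _ r] conjI ballI impI)
    fix A :: "(real^2) set" assume A [measurable]: "A \<in> sets borel" and AB: "A \<subseteq> ball u r"
    then have AU: "A \<inter> U = A" using r by auto
    have injA: "inj_on \<phi> A" "inj_on ?L A"
      using AU inj_phi inj_frame_map[OF immersed[OF u]] by (auto intro: inj_on_subset)
    have HL: "hausdorff2_outer (?L ` A) = ennreal ?k * emeasure lborel A"
      unfolding jac_def by (rule hausdorff2_outer_frame_map[OF immersed[OF u] A])
    have up: "emeasure pullback_measure A \<le> ennreal ((1 + e)\<^sup>2) * (ennreal ?k * emeasure lborel A)"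
      unfolding emeasure_pullback[OF A] AU HL[symmetric]
    proof (rule hausdorff2_outer_comparison[OF _ injA(2)])
      fix x y assume "x \<in> A" "y \<in> A"
      then have "x \<in> ball u r" "y \<in> ball u r" using AB by blast+
      then have "norm (\<phi> x - \<phi> y - ?L (x - y)) \<le> e * norm (?L (x - y))" by (rule approx')
      then show "dist (\<phi> x) (\<phi> y) \<le> (1 + e) * dist (?L x) (?L y)"
        using norm_triangle_sub[of "\<phi> x - \<phi> y" "?L (x - y)"]
        by (simp add: dist_norm linear_diff[OF linear_frame_map, symmetric] algebra_simps)
    qed (use e in simp)
    have low: "ennreal ((1 - e)\<^sup>2) * (ennreal ?k * emeasure lborel A) \<le> emeasure pullback_measure A"
    proof -
      have "ennreal ?k * emeasure lborel A \<le> ennreal ((1 / (1 - e))\<^sup>2) * emeasure pullback_measure A"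
        unfolding emeasure_pullback[OF A] AU HL[symmetric]
      proof (rule hausdorff2_outer_comparison[OF _ injA(1)])
        fix x y assume "x \<in> A" "y \<in> A"
        then have "x \<in> ball u r" "y \<in> ball u r" using AB by blast+
        then have "norm (\<phi> x - \<phi> y - ?L (x - y)) \<le> e * norm (?L (x - y))" by (rule approx')
        then have "(1 - e) * norm (?L (x - y)) \<le> norm (\<phi> x - \<phi> y)"
          using norm_triangle_sub[of "?L (x - y)" "\<phi> x - \<phi> y"]
          by (simp add: algebra_simps norm_minus_commute)
        then show "dist (?L x) (?L y) \<le> 1 / (1 - e) * dist (\<phi> x) (\<phi> y)"
          using e by (simp add: dist_norm linear_diff[OF linear_frame_map, symmetric] field_simps)
      qed (use e in simp)
      from mult_left_mono[OF this, of "ennreal ((1 - e)\<^sup>2)"] show ?thesis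
        using e by (simp add: mult.assoc[symmetric] ennreal_mult[symmetric] power_divide)
    qed
    have jacA: "(1 - e) * jac u \<le> jac x \<and> jac x \<le> (1 + e) * jac u" if "x \<in> A" for x
      using jac[of x] AB that by (auto simp: d_def abs_le_iff algebra_simps)
    have kk: "ennreal ((1 + e) * ?k) = ennreal (1 + e) * ennreal ?k" "ennreal ((1 - e) * ?k) = ennreal (1 - e) * ennreal ?k"
      by (rule ennreal_mult; use e k0 in simp)+
    have area_up: "emeasure area_measure A \<le> ennreal (1 + e) * (ennreal ?k * emeasure lborel A)"
    proof -
      have "emeasure area_measure A \<le> (\<integral>\<^sup>+x. ennreal ((1 + e) * ?k) * indicator A x \<partial>lborel)"
        unfolding emeasure_area_measure[OF A] AU
        using jacA planar_factor_pos by (intro nn_integral_mono) (auto simp: indicator_def intro!: ennreal_leI)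
      also have "\<dots> = ennreal (1 + e) * (ennreal ?k * emeasure lborel A)"
        unfolding mult.assoc[symmetric] kk(1)[symmetric, unfolded mult.assoc[symmetric]] using A by (simp add: nn_integral_cmult_indicator)
      finally show ?thesis .
    qed
    have area_low: "ennreal (1 - e) * (ennreal ?k * emeasure lborel A) \<le> emeasure area_measure A"
    proof -
      have "ennreal (1 - e) * (ennreal ?k * emeasure lborel A) = (\<integral>\<^sup>+x. ennreal ((1 - e) * ?k) * indicator A x \<partial>lborel)"
        unfolding mult.assoc[symmetric] kk(2)[symmetric, unfolded mult.assoc[symmetric]] using A by (simp add: nn_integral_cmult_indicator)
      also have "\<dots> \<le> emeasure area_measure A"
        unfolding emeasure_area_measure[OF A] AU
        using jacA planar_factor_pos by (intro nn_integral_mono) (auto simp: indicator_def intro!: ennreal_leI)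
      finally show ?thesis .
    qed
    have e2: "ennreal (1 + e) \<le> ennreal ((1 + e)\<^sup>2)" "ennreal ((1 - e)\<^sup>2) \<le> ennreal (1 - e)"
    proof -
      have "1 + e \<le> (1 + e)\<^sup>2" "(1 - e)\<^sup>2 \<le> 1 - e"
        using e mult_strict_right_mono[of e 1 e] by (simp_all add: power2_eq_square algebra_simps)
      then show "ennreal (1 + e) \<le> ennreal ((1 + e)\<^sup>2)" "ennreal ((1 - e)\<^sup>2) \<le> ennreal (1 - e)"
        by (auto intro: ennreal_leI)
    qed
    have "ennreal ((1 - e)\<^sup>2) * emeasure area_measure A \<le> ennreal ((1 - e)\<^sup>2) * (ennreal (1 + e) * (ennreal ?k * emeasure lborel A))"
      by (intro mult_left_mono area_up) simp
    also have "\<dots> = ennreal (1 + e) * (ennreal ((1 - e)\<^sup>2) * (ennreal ?k * emeasure lborel A))"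
      by (simp add: mult_ac)
    also have "\<dots> \<le> ennreal ((1 + e)\<^sup>2) * emeasure pullback_measure A"
      by (intro mult_mono low e2) auto
    finally have 1: "ennreal ((1 - e)\<^sup>2) * emeasure area_measure A \<le> ennreal ((1 + e)\<^sup>2) * emeasure pullback_measure A" .
    have "ennreal ((1 - e)\<^sup>2) * emeasure pullback_measure A \<le> ennreal (1 - e) * (ennreal ((1 + e)\<^sup>2) * (ennreal ?k * emeasure lborel A))"
      by (intro mult_mono up e2) auto
    also have "\<dots> = ennreal ((1 + e)\<^sup>2) * (ennreal (1 - e) * (ennreal ?k * emeasure lborel A))"
      by (simp add: mult_ac)
    also have "\<dots> \<le> ennreal ((1 + e)\<^sup>2) * emeasure area_measure A"
      by (intro mult_left_mono area_low) auto
    finally show "comparable e A" using 1 by (simp add: comparable_def)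
  qed (use r in auto)
qed

text \<open>Comparability passes to countable disjoint unions, and countably many of the balls from
  \<open>local_comparison\<close> cover \<open>U\<close>.\<close>

lemma global_comparison:
  assumes e: "0 < e" "e < 1" and A [measurable]: "A \<in> sets borel"
  shows "comparable e A"
proof -
  define good where "good B \<longleftrightarrow> open B \<and> B \<subseteq> U \<and> (\<forall>A\<in>sets borel. A \<subseteq> B \<longrightarrow> comparable e A)" for B
  have "\<exists>B. good B \<and> u \<in> B" if u: "u \<in> U" for u
  proof -
    obtain r where "r > 0" "ball u r \<subseteq> U" "\<forall>A\<in>sets borel. A \<subseteq> ball u r \<longrightarrow> comparable e A"
      using local_comparison[OF u e] by blast
    moreover from this have "good (ball u r)" by (simp add: good_def)
    ultimately show ?thesis by (intro exI[of _ "ball u r"]) simp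
  qed
  then have cover: "\<Union>(Collect good) = U" unfolding good_def by blast
  obtain \<B> where \<B>: "\<B> \<subseteq> Collect good" "countable \<B>" "\<Union>\<B> = U"
    using Lindelof[of "Collect good"] cover unfolding good_def by (metis (mono_tags, lifting) mem_Collect_eq)
  have \<B>': "countable (insert {} \<B>)" "insert {} \<B> \<noteq> {}" using \<B> by auto
  define B where "B = from_nat_into (insert {} \<B>)"
  have gB: "good (B n)" for n
  proof -
    have "B n \<in> insert {} \<B>" unfolding B_def by (rule from_nat_into) simp
    moreover have "good {}" by (simp add: good_def comparable_def)
    ultimately show ?thesis using \<B> by auto
  qed
  have UB: "(\<Union>n. B n) = U"
  proof -
    have "range B = insert {} \<B>" unfolding B_def using \<B>' by (intro range_from_nat_into) auto
    then show ?thesis using \<B>(3) by simp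
  qed
  define D where "D n = A \<inter> disjointed B n" for n
  have [measurable]: "B n \<in> sets borel" for n using gB[of n] by (simp add: good_def)
  then have rB: "range B \<subseteq> sets borel" by auto
  have D_meas [measurable]: "D n \<in> sets borel" for n
    unfolding D_def using sets.range_disjointed_sets[OF rB] by auto
  have disj: "disjoint_family D"
    using disjoint_family_disjointed[of B] by (auto simp: D_def disjoint_family_on_def)
  have UD: "(\<Union>n. D n) = A \<inter> U"
    using UN_disjointed_eq[of B] UB by (auto simp: D_def)
  have split: "emeasure N A = (\<Sum>n. emeasure N (D n))"
    if "sets N = sets borel" "emeasure N (A - U) = 0" for N :: "(real^2) measure"
  proof -
    have [measurable]: "U \<in> sets borel" using open_U by simp
    have "emeasure N A = emeasure N (A \<inter> U) + emeasure N (A - U)"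
      by (subst plus_emeasure) (auto simp: that Un_Diff_Int Int_commute intro!: arg_cong[of _ _ "emeasure N"])
    also have "\<dots> = emeasure N (\<Union>n. D n)" using that UD by simp
    also have "\<dots> = (\<Sum>n. emeasure N (D n))"
    proof (rule suminf_emeasure[symmetric])
      show "range D \<subseteq> sets N" using D_meas that(1) by blast
    qed (rule disj)
    finally show ?thesis .
  qed
  have U [measurable]: "U \<in> sets borel" using open_U by simp
  have "(A - U) \<inter> U = {}" by auto
  then have null: "emeasure area_measure (A - U) = 0" "emeasure pullback_measure (A - U) = 0"
    using A by (simp_all add: emeasure_area_measure emeasure_pullback)
  have sets: "sets area_measure = sets borel" "sets pullback_measure = sets borel"
    by (simp_all add: area_measure_def pullback_measure_def)
  have comp: "comparable e (D n)" for n
  proof -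
    have "D n \<subseteq> B n" using disjointed_subset[of B n] by (auto simp: D_def)
    then show ?thesis using gB[of n] D_meas[of n] unfolding good_def by auto
  qed
  show ?thesis
    unfolding comparable_def split[OF sets(1) null(1)] split[OF sets(2) null(2)] ennreal_suminf_cmult[symmetric]
    using comp by (intro conjI suminf_le) (auto simp: comparable_def)
qed

theorem area_formula: "pullback_measure = area_measure"
proof (rule measure_eqI)
  show sets: "sets pullback_measure = sets area_measure"
    by (simp add: pullback_measure_def area_measure_def)
  fix A assume "A \<in> sets pullback_measure"
  then have A: "A \<in> sets borel" by (simp add: pullback_measure_def)
  have le: "x \<le> y" if *: "\<And>e. 0 < e \<Longrightarrow> e < 1 \<Longrightarrow> ennreal ((1 - e)\<^sup>2) * x \<le> ennreal ((1 + e)\<^sup>2) * y" for x y :: ennreal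
  proof -
    have ev: "\<forall>\<^sub>F e in at_right (0::real). 0 < e \<and> e < 1"
      using eventually_at_right_less[of "0::real"] eventually_at_right_real[of 0 1] by (auto elim: eventually_mono)
    have "((\<lambda>e. ennreal ((1 - e)\<^sup>2) * x) \<longlongrightarrow> ennreal ((1 - 0)\<^sup>2) * x) (at_right (0::real))"
      by (intro tendsto_mult_ennreal tendsto_ennrealI tendsto_intros) auto
    moreover have "((\<lambda>e. ennreal ((1 + e)\<^sup>2) * y) \<longlongrightarrow> ennreal ((1 + 0)\<^sup>2) * y) (at_right (0::real))"
      by (intro tendsto_mult_ennreal tendsto_ennrealI tendsto_intros) auto
    ultimately have "ennreal ((1 - 0)\<^sup>2) * x \<le> ennreal ((1 + 0)\<^sup>2) * y"
      using ev by (intro tendsto_le[of "at_right (0::real)"]) (auto elim: eventually_mono intro: *)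
    then show ?thesis by simp
  qed
  show "emeasure pullback_measure A = emeasure area_measure A"
  proof (rule antisym)
    show "emeasure pullback_measure A \<le> emeasure area_measure A"
      by (rule le) (use global_comparison[OF _ _ A] in \<open>simp add: comparable_def\<close>)
    show "emeasure area_measure A \<le> emeasure pullback_measure A"
      by (rule le) (use global_comparison[OF _ _ A] in \<open>simp add: comparable_def\<close>)
  qed
qed

lemma phi_indicator_measurable:
  fixes h :: "real^3 \<Rightarrow> real"
  assumes h: "h \<in> borel_measurable borel"
  shows "(\<lambda>u. indicator U u * h (\<phi> u)) \<in> borel_measurable borel"
proof -
  have U: "U \<in> sets borel" using open_U by simp
  have "\<phi> \<in> measurable (restrict_space borel U) borel"
    using cont_phi by (rule borel_measurable_continuous_on_restrict)
  then have "(\<lambda>u. h (\<phi> u)) \<in> borel_measurable (restrict_space borel U)"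
    using h by (rule measurable_compose)
  then show ?thesis
    using U by (subst (asm) borel_measurable_restrict_space_iff) (auto simp: mult.commute)
qed

text \<open>Measurability is asked for in the parameter domain only, because this will be applied to
  functions that involve the tangent plane and make sense only on the surface.\<close>

lemma integral_patch:
  fixes h :: "real^3 \<Rightarrow> real"
  assumes g [measurable]: "(\<lambda>u. indicator U u * h (\<phi> u)) \<in> borel_measurable borel"
  shows "(\<integral>y. indicator (\<phi> ` U) y * h y \<partial>hausdorff2) = planar_factor * (\<integral>u. indicator U u * (jac u * h (\<phi> u)) \<partial>lborel)"
proof -
  let ?g = "\<lambda>u. indicator U u * h (\<phi> u)"
  have "(\<integral>y. indicator (\<phi> ` U) y * h y \<partial>hausdorff2) = (\<integral>y. h y \<partial>restrict_space hausdorff2 (\<phi> ` U))"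
    using sets_image by (subst integral_restrict_space) (auto simp: set_lebesgue_integral_def)
  also have "\<dots> = (\<integral>y. ?g (\<psi> y) \<partial>restrict_space hausdorff2 (\<phi> ` U))"
    by (rule Bochner_Integration.integral_cong) (auto simp: space_restrict_space)
  also have "\<dots> = (\<integral>u. ?g u \<partial>pullback_measure)"
    unfolding pullback_measure_def using psi_measurable by (subst integral_distr) auto
  also have "\<dots> = (\<integral>u. ?g u \<partial>density lborel (\<lambda>u. ennreal (indicator U u * (planar_factor * jac u))))"
    unfolding area_formula area_measure_def
    by (intro arg_cong[of _ _ "\<lambda>M. integral\<^sup>L M ?g"] arg_cong[of _ _ "density lborel"]) (auto simp: indicator_def)
  also have "\<dots> = (\<integral>u. (indicator U u * (planar_factor * jac u)) *\<^sub>R ?g u \<partial>lborel)"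
  proof (rule integral_density)
    have "(\<lambda>u. indicator U u *\<^sub>R (planar_factor * jac u)) \<in> borel_measurable borel"
      using open_U by (intro borel_measurable_continuous_on_indicator continuous_intros cont_jac) auto
    then show "(\<lambda>u. indicator U u * (planar_factor * jac u)) \<in> borel_measurable lborel" by simp
    show "AE u in lborel. 0 \<le> indicator U u * (planar_factor * jac u)"
      using planar_factor_pos by (auto simp: jac_def)
  qed (use g in simp)
  also have "\<dots> = (\<integral>u. planar_factor * (indicator U u * (jac u * h (\<phi> u))) \<partial>lborel)"
    by (intro Bochner_Integration.integral_cong) (auto simp: indicator_def)
  finally show ?thesis by simp
qed

text \<open>In coordinates in which \<open>D\<phi>(u)\<close> is an isometry the parametrization is nearly isometric
  close to \<open>u\<close>; this gives a lower density bound that does not depend on the surface.\<close>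

lemma patch_lower_density:
  assumes u: "u \<in> U"
  shows "\<exists>s0>0. \<forall>s. 0 < s \<and> s < s0 \<longrightarrow>
    ennreal (planar_factor / 9 * s\<^sup>2) \<le> hausdorff2_outer (\<phi> ` U \<inter> cball (\<phi> u) s)"
proof -
  let ?L = "frame_map (a u) (b u)"
  obtain B :: "real^2 \<Rightarrow> real^2" where B: "linear B" "\<And>x. norm (?L (B x)) = norm x"
    using orthonormal_reparametrization[OF immersed[OF u]] by metis
  obtain m where m: "m > 0" "\<And>x. m * norm x \<le> norm (?L x)"
    using linear_inj_bounded_below_pos[OF linear_frame_map inj_frame_map[OF immersed[OF u]]] by metis
  obtain r where r: "r > 0" "ball u r \<subseteq> U"
    and approx: "\<And>x y. x \<in> ball u r \<Longrightarrow> y \<in> ball u r \<Longrightarrow> norm (\<phi> x - \<phi> y - ?L (x - y)) \<le> (m / 2) * norm (x - y)"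
    using local_linear_approximation[OF u, of "m / 2"] m(1) by auto
  have near: "u + B q \<in> ball u r" if "norm q < m * r" for q
  proof -
    have "m * norm (B q) \<le> norm q" using m(2)[of "B q"] B(2)[of q] by simp
    then have "m * norm (B q) < m * r" using that by simp
    then show ?thesis using m(1) by (simp add: dist_norm)
  qed
  have almost: "dist q q' / 2 \<le> dist (\<phi> (u + B q)) (\<phi> (u + B q'))" "dist (\<phi> (u + B q)) (\<phi> (u + B q')) \<le> 3 / 2 * dist q q'"
    if q: "norm q < m * r" "norm q' < m * r" for q q'
  proof -
    have L: "?L ((u + B q) - (u + B q')) = ?L (B (q - q'))" by (simp add: linear_diff[OF B(1)])
    have n: "norm (?L (B (q - q'))) = dist q q'" by (simp add: B(2) dist_norm)
    have "norm (\<phi> (u + B q) - \<phi> (u + B q') - ?L (B (q - q'))) \<le> (m / 2) * norm (B (q - q'))"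
      using approx[OF near[OF q(1)] near[OF q(2)]] unfolding L by (simp add: linear_diff[OF B(1)])
    also have "\<dots> \<le> dist q q' / 2" using m(2)[of "B (q - q')"] n by simp
    finally have e: "norm (\<phi> (u + B q) - \<phi> (u + B q') - ?L (B (q - q'))) \<le> dist q q' / 2" .
    show "dist q q' / 2 \<le> dist (\<phi> (u + B q)) (\<phi> (u + B q'))"
      using e n norm_triangle_sub[of "?L (B (q - q'))" "\<phi> (u + B q) - \<phi> (u + B q')"]
      by (simp add: dist_norm norm_minus_commute)
    show "dist (\<phi> (u + B q)) (\<phi> (u + B q')) \<le> 3 / 2 * dist q q'"
      using e n norm_triangle_sub[of "\<phi> (u + B q) - \<phi> (u + B q')" "?L (B (q - q'))"]
      by (simp add: dist_norm)
  qed
  have "ennreal (planar_factor / 9 * s\<^sup>2) \<le> hausdorff2_outer (\<phi> ` U \<inter> cball (\<phi> u) s)"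
    if s: "0 < s" "s < m * r" for s
  proof -
    \<comment> \<open>Points of \<open>Q\<close> have norm at most \<open>2 s / 3\<close>, and the parametrization stretches by at most \<open>3 / 2\<close>.\<close>
    define Q where "Q = cbox (- ((s / 3) *\<^sub>R One)) ((s / 3) *\<^sub>R (One :: real^2))"
    have nQ: "norm q \<le> 2 / 3 * s" if "q \<in> Q" for q
    proof -
      have "\<bar>q$i\<bar> \<le> s / 3" for i
      proof -
        have "- (s / 3) \<le> q$i \<and> q$i \<le> s / 3" using that unfolding Q_def mem_box_cart by simp
        then show ?thesis by linarith
      qed
      then have "norm q \<le> (\<Sum>i\<in>(UNIV::2 set). s / 3)"
        by (intro order_trans[OF norm_le_l1_cart] sum_mono) auto
      then show ?thesis by simp
    qed
    have nQ': "norm q < m * r" if "q \<in> Q" for q using nQ[OF that] s by simp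
    have "ennreal ((1/2)\<^sup>2) * hausdorff2_outer Q \<le> hausdorff2_outer ((\<lambda>q. \<phi> (u + B q)) ` Q)"
      by (rule hausdorff2_outer_expanding_image) (use almost(1) nQ' in auto)
    also have "\<dots> \<le> hausdorff2_outer (\<phi> ` U \<inter> cball (\<phi> u) s)"
    proof (rule hausdorff2_outer_mono, rule image_subsetI)
      fix q assume q: "q \<in> Q"
      have "0 < m * r" using m r by simp
      then have "dist (\<phi> (u + B q)) (\<phi> (u + B 0)) \<le> 3 / 2 * dist q 0"
        by (intro almost(2) nQ'[OF q]) simp
      also have "\<dots> \<le> s" using nQ[OF q] by simp
      finally have "dist (\<phi> (u + B q)) (\<phi> u) \<le> s" using B(1) by (simp add: linear_0)
      then show "\<phi> (u + B q) \<in> \<phi> ` U \<inter> cball (\<phi> u) s"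
        using near[OF nQ'[OF q]] r(2) by (auto simp: dist_commute)
    qed
    finally have low: "ennreal ((1/2)\<^sup>2) * hausdorff2_outer Q \<le> hausdorff2_outer (\<phi> ` U \<inter> cball (\<phi> u) s)" .
    have diff: "(s / 3) *\<^sub>R One - - ((s / 3) *\<^sub>R One) = (2 * s / 3) *\<^sub>R (One :: real^2)"
      unfolding vec_eq_iff by simp
    have "emeasure lborel Q = ennreal (\<Prod>b\<in>Basis. ((2 * s / 3) *\<^sub>R (One :: real^2)) \<bullet> b)"
      unfolding Q_def diff[symmetric]
      by (rule emeasure_lborel_cbox) (use s in \<open>simp add: inner_minus_left\<close>)
    also have "(\<Prod>b\<in>Basis. ((2 * s / 3) *\<^sub>R (One :: real^2)) \<bullet> b) = (\<Prod>b\<in>(Basis :: (real^2) set). 2 * s / 3)"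
      by (rule prod.cong[OF refl]) (simp only: inner_scaleR_left inner_sum_left_Basis[of _ "\<lambda>_. 1", unfolded scaleR_one] mult_1_right)
    also have "\<dots> = (2 * s / 3)\<^sup>2" by simp
    finally have "hausdorff2_outer Q = ennreal planar_factor * ennreal ((2 * s / 3)\<^sup>2)"
      using hausdorff2_outer_plane[of Q] by (simp add: Q_def)
    then have "ennreal ((1/2)\<^sup>2) * hausdorff2_outer Q = ennreal ((1/2)\<^sup>2 * (planar_factor * (2 * s / 3)\<^sup>2))"
      using planar_factor_pos by (simp add: ennreal_mult)
    also have "(1/2)\<^sup>2 * (planar_factor * (2 * s / 3)\<^sup>2) = planar_factor / 9 * s\<^sup>2"
      by (simp add: power2_eq_square)
    finally show ?thesis using low by simp
  qed
  then show ?thesis using m r by (intro exI[of _ "m * r"]) simp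
qed

end


section \<open>Tangent planes and the induced varifold\<close>

text \<open>Schwarz: the second difference \<open>f(u+tv+tw) - f(u+tv) - f(u+tw) + f(u)\<close> is symmetric in
  \<open>v\<close> and \<open>w\<close> and equals \<open>t\<^sup>2 f''(v)(w) + o(t\<^sup>2)\<close>.\<close>

lemma second_derivative_symmetric:
  fixes f :: "'a::real_normed_vector \<Rightarrow> 'b::real_normed_vector"
    and f' :: "'a \<Rightarrow> 'a \<Rightarrow>\<^sub>L 'b" and f'' :: "'a \<Rightarrow>\<^sub>L ('a \<Rightarrow>\<^sub>L 'b)"
  assumes S: "open S" "u \<in> S"
    and f': "\<And>x. x \<in> S \<Longrightarrow> (f has_derivative blinfun_apply (f' x)) (at x)"
    and f'': "(f' has_derivative blinfun_apply f'') (at u)"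
  shows "f'' v w = f'' w v"
proof -
  define \<Delta> where "\<Delta> v w t = f (u + t *\<^sub>R w + t *\<^sub>R v) - f (u + t *\<^sub>R w) - (f (u + t *\<^sub>R v) - f u)" for v w and t :: real
  have dist_add: "dist u (u + x) = norm x" for x by (simp add: dist_norm)
  have key: "\<exists>d>0. \<forall>t. 0 < t \<and> t < d \<longrightarrow> norm (\<Delta> v w t - (t * t) *\<^sub>R f'' v w) \<le> e * (t * t)" if e: "0 < e" for e v w
  proof -
    define N where "N = norm v + norm w + 1"
    have N: "N \<ge> 1" "norm w \<le> N" by (simp_all add: N_def)
    obtain r where r: "r > 0" "ball u r \<subseteq> S" using S openE by blast
    have e': "0 < e / (2 * N * N)" using e N by simp
    obtain d0 where d0: "d0 > 0" "\<And>y. norm (y - u) < d0 \<Longrightarrow> norm (f' y - f' u - f'' (y - u)) \<le> e / (2 * N * N) * norm (y - u)"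
      using f'' e' unfolding has_derivative_at_alt by blast
    define d where "d = min r d0 / N"
    have "norm (\<Delta> v w t - (t * t) *\<^sub>R f'' v w) \<le> e * (t * t)" if t: "0 < t" "t < d" for t
    proof -
      have tN: "t * N < r" "t * N < d0" using t N r d0 by (auto simp: d_def field_simps)
      have near: "norm (s *\<^sub>R w + c *\<^sub>R v) \<le> t * N" if "0 \<le> s" "s \<le> t" "0 \<le> c" "c \<le> t" for s c
      proof -
        have "norm (s *\<^sub>R w + c *\<^sub>R v) \<le> s * norm w + c * norm v"
          using norm_triangle_ineq[of "s *\<^sub>R w" "c *\<^sub>R v"] that by simp
        also have "\<dots> \<le> t * norm w + t * norm v" using that by (intro add_mono mult_right_mono) auto
        finally show ?thesis using t by (simp add: N_def algebra_simps)
      qed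
      define G where "G s = f (u + s *\<^sub>R w + t *\<^sub>R v) - f (u + s *\<^sub>R w)" for s
      have bound: "norm ((G t - t *\<^sub>R (t *\<^sub>R f'' v w)) - (G 0 - 0 *\<^sub>R (t *\<^sub>R f'' v w))) \<le> e * t * norm (t - 0)"
      proof (rule differentiable_bound[where S = "{0..t}" and f = "\<lambda>s. G s - s *\<^sub>R (t *\<^sub>R f'' v w)"
            and f' = "\<lambda>s h. (h *\<^sub>R f' (u + s *\<^sub>R w + t *\<^sub>R v) w - h *\<^sub>R f' (u + s *\<^sub>R w) w) - h *\<^sub>R (t *\<^sub>R f'' v w)"])
        fix s assume s: "s \<in> {0..t}"
        have in1: "u + s *\<^sub>R w + t *\<^sub>R v \<in> S"
          using near[of s t] s t tN r by (intro subsetD[OF r(2)]) (auto simp: add.assoc dist_add)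
        have in2: "u + s *\<^sub>R w \<in> S"
          using near[of s 0] s t tN r by (intro subsetD[OF r(2)]) (auto simp: dist_add)
        have "((\<lambda>s. f (u + s *\<^sub>R w + t *\<^sub>R v)) has_derivative (\<lambda>h. f' (u + s *\<^sub>R w + t *\<^sub>R v) (h *\<^sub>R w))) (at s)"
          by (rule has_derivative_compose[of "\<lambda>s. u + s *\<^sub>R w + t *\<^sub>R v" _ s UNIV f, OF _ f'[OF in1]]) (auto intro!: derivative_eq_intros)
        moreover have "((\<lambda>s. f (u + s *\<^sub>R w)) has_derivative (\<lambda>h. f' (u + s *\<^sub>R w) (h *\<^sub>R w))) (at s)"
          by (rule has_derivative_compose[of "\<lambda>s. u + s *\<^sub>R w" _ s UNIV f, OF _ f'[OF in2]]) (auto intro!: derivative_eq_intros)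
        moreover have "((\<lambda>s. s *\<^sub>R (t *\<^sub>R f'' v w)) has_derivative (\<lambda>h. h *\<^sub>R (t *\<^sub>R f'' v w))) (at s)"
          by (auto intro!: derivative_eq_intros)
        ultimately have "((\<lambda>s. G s - s *\<^sub>R (t *\<^sub>R f'' v w)) has_derivative
          (\<lambda>h. (f' (u + s *\<^sub>R w + t *\<^sub>R v) (h *\<^sub>R w) - f' (u + s *\<^sub>R w) (h *\<^sub>R w)) - h *\<^sub>R (t *\<^sub>R f'' v w))) (at s)"
          unfolding G_def by (intro has_derivative_diff)
        then show "((\<lambda>s. G s - s *\<^sub>R (t *\<^sub>R f'' v w)) has_derivative
          (\<lambda>h. (h *\<^sub>R f' (u + s *\<^sub>R w + t *\<^sub>R v) w - h *\<^sub>R f' (u + s *\<^sub>R w) w) - h *\<^sub>R (t *\<^sub>R f'' v w))) (at s within {0..t})"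
          by (simp add: blinfun.scaleR_right has_derivative_at_withinI)
        let ?y1 = "u + s *\<^sub>R w + t *\<^sub>R v" and ?y2 = "u + s *\<^sub>R w"
        let ?R = "\<lambda>y. f' y - f' u - f'' (y - u)"
        have y1: "norm (?y1 - u) \<le> t * N" using near[of s t] s t by (simp add: algebra_simps)
        have y2: "norm (?y2 - u) \<le> t * N" using near[of s 0] s t by simp
        have R: "norm (?R y) \<le> e / (2 * N) * t" if "norm (y - u) \<le> t * N" for y
        proof -
          have "norm (?R y) \<le> e / (2 * N * N) * norm (y - u)" using that tN by (intro d0) simp
          also have "\<dots> \<le> e / (2 * N * N) * (t * N)" using that e' by (intro mult_left_mono) auto
          also have "\<dots> = e / (2 * N) * t" using N by simp
          finally show ?thesis .
        qed
        have "f' ?y1 w - f' ?y2 w - t *\<^sub>R f'' v w = ?R ?y1 w - ?R ?y2 w"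
          by (simp add: blinfun.diff_left blinfun.diff_right blinfun.add_right blinfun.add_left blinfun.scaleR_right blinfun.scaleR_left algebra_simps)
        also have "norm \<dots> \<le> norm (?R ?y1 w) + norm (?R ?y2 w)" by (rule norm_triangle_ineq4)
        also have "\<dots> \<le> norm (?R ?y1) * norm w + norm (?R ?y2) * norm w"
          by (intro add_mono norm_blinfun)
        also have "\<dots> \<le> (e / (2 * N) * t) * N + (e / (2 * N) * t) * N"
          using R[OF y1] R[OF y2] N e t by (intro add_mono mult_mono) auto
        also have "\<dots> = e * t" using N by simp
        finally have b: "norm (f' ?y1 w - f' ?y2 w - t *\<^sub>R f'' v w) \<le> e * t" .
        show "onorm (\<lambda>h. (h *\<^sub>R f' ?y1 w - h *\<^sub>R f' ?y2 w) - h *\<^sub>R (t *\<^sub>R f'' v w)) \<le> e * t"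
        proof (rule onorm_bound)
          fix h :: real
          have "(h *\<^sub>R f' ?y1 w - h *\<^sub>R f' ?y2 w) - h *\<^sub>R (t *\<^sub>R f'' v w) = h *\<^sub>R (f' ?y1 w - f' ?y2 w - t *\<^sub>R f'' v w)"
            by (simp add: scaleR_diff_right)
          then show "norm ((h *\<^sub>R f' ?y1 w - h *\<^sub>R f' ?y2 w) - h *\<^sub>R (t *\<^sub>R f'' v w)) \<le> e * t * norm h"
            using mult_left_mono[OF b, of "\<bar>h\<bar>"] by (simp add: mult.commute)
        qed (use e t in simp)
      qed (use t in auto)
      have eq: "(G t - t *\<^sub>R (t *\<^sub>R f'' v w)) - (G 0 - 0 *\<^sub>R (t *\<^sub>R f'' v w)) = \<Delta> v w t - (t * t) *\<^sub>R f'' v w"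
        by (simp add: G_def \<Delta>_def algebra_simps)
      show ?thesis using bound t unfolding eq by (simp add: mult.assoc)
    qed
    moreover have "d > 0" using r d0 N by (simp add: d_def)
    ultimately show ?thesis by blast
  qed
  have small: "norm (f'' v w - f'' w v) \<le> e" if e: "0 < e" for e
  proof -
    obtain d1 where d1: "d1 > 0" "\<And>t. 0 < t \<Longrightarrow> t < d1 \<Longrightarrow> norm (\<Delta> v w t - (t * t) *\<^sub>R f'' v w) \<le> e/2 * (t * t)"
      using key[of "e/2" v w] e by auto
    obtain d2 where d2: "d2 > 0" "\<And>t. 0 < t \<Longrightarrow> t < d2 \<Longrightarrow> norm (\<Delta> w v t - (t * t) *\<^sub>R f'' w v) \<le> e/2 * (t * t)"
      using key[of "e/2" w v] e by auto
    define t where "t = min d1 d2 / 2"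
    have t: "0 < t" "t < d1" "t < d2" using d1 d2 by (auto simp: t_def)
    have sym: "\<Delta> v w t = \<Delta> w v t" by (simp add: \<Delta>_def algebra_simps)
    have "(t * t) *\<^sub>R (f'' v w - f'' w v) = (\<Delta> w v t - (t * t) *\<^sub>R f'' w v) - (\<Delta> v w t - (t * t) *\<^sub>R f'' v w)"
      by (simp add: sym scaleR_diff_right)
    also have "norm \<dots> \<le> e/2 * (t * t) + e/2 * (t * t)"
      using norm_triangle_ineq4[of "\<Delta> w v t - (t * t) *\<^sub>R f'' w v" "\<Delta> v w t - (t * t) *\<^sub>R f'' v w"] d1(2)[of t] d2(2)[of t] t
      by linarith
    finally have "norm ((t * t) *\<^sub>R (f'' v w - f'' w v)) \<le> (t * t) * e" by (simp add: algebra_simps)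
    moreover have "norm ((t * t) *\<^sub>R (f'' v w - f'' w v)) = (t * t) * norm (f'' v w - f'' w v)"
      unfolding norm_scaleR by simp
    ultimately show ?thesis using t by (simp add: mult_le_cancel_left)
  qed
  have "norm (f'' v w - f'' w v) \<le> 0"
  proof (rule field_le_epsilon)
    show "norm (f'' v w - f'' w v) \<le> 0 + e" if "0 < e" for e using small[OF that] by simp
  qed
  then show ?thesis by simp
qed

definition normal_projection :: "real^3 \<Rightarrow> real^3^3" where
  "normal_projection n = matrix (\<lambda>v. v - (v \<bullet> n) *\<^sub>R n)"

lemma normal_projection_component: "normal_projection n $ i $ j = (if i = j then 1 else 0) - n$i * n$j"
  by (simp only: normal_projection_def matrix_def vec_lambda_beta vector_minus_component
      vector_scaleR_component inner_axis') (simp add: axis_def)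

lemma trace_normal_projection:
  "trace (normal_projection n ** A) = trace A - n \<bullet> (A *v n)"
  by (simp add: trace_def matrix_matrix_mult_def normal_projection_component matrix_vector_mult_def
      inner_vec_def sum_3 algebra_simps)

lemma normal_projection_mult: "normal_projection n *v v = v - (v \<bullet> n) *\<^sub>R n"
  by (simp add: vec_eq_iff matrix_vector_mult_def normal_projection_component inner_vec_def sum_3 forall_3 algebra_simps)

lemma continuous_normal_projection: "continuous_on S normal_projection"
proof -
  have eq: "normal_projection = (\<lambda>n. \<chi> i j. (if i = j then 1 else 0) - n$i * n$j)"
    by (auto simp: vec_eq_iff normal_projection_component)
  show ?thesis unfolding eq by (intro continuous_on_vec_lambda continuous_intros)
qed

lemma plane_projection_hyperplane:
  assumes n: "norm n = 1"
  shows "plane_projection {z. z \<bullet> n = 0} = normal_projection n"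
proof -
  let ?S = "{z. z \<bullet> n = 0}"
  have nn: "n \<bullet> n = 1" using n by (simp add: norm_eq_1)
  have "closest_point ?S v = v - (v \<bullet> n) *\<^sub>R n" for v
  proof (rule closest_point_unique[symmetric])
    show "convex ?S" "closed ?S"
      using convex_hyperplane[of n 0] closed_hyperplane[of n 0] by (simp_all add: inner_commute)
    show "v - (v \<bullet> n) *\<^sub>R n \<in> ?S" by (simp add: inner_diff_left nn)
    show "\<forall>z\<in>?S. dist v (v - (v \<bullet> n) *\<^sub>R n) \<le> dist v z"
    proof
      fix z assume "z \<in> ?S"
      then have "(v - z) \<bullet> n = v \<bullet> n" by (simp add: inner_diff_left)
      then have "\<bar>v \<bullet> n\<bar> \<le> norm (v - z)" using Cauchy_Schwarz_ineq2[of "v - z" n] n by simp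
      then show "dist v (v - (v \<bullet> n) *\<^sub>R n) \<le> dist v z" using n by (simp add: dist_norm)
    qed
  qed
  then show ?thesis unfolding plane_projection_def normal_projection_def by presburger
qed

text \<open>A plane through the origin is the orthogonal complement of a unit vector; so the Grassmannian
  is a continuous image of the sphere, and compact.\<close>

lemma planes_eq: "planes = normal_projection ` sphere 0 1"
proof
  show "planes \<subseteq> normal_projection ` sphere 0 1"
  proof
    fix P assume "P \<in> planes"
    then obtain S where S: "subspace S" "dim S = 2" "P = plane_projection S" by (auto simp: planes_def)
    then obtain m where m: "m \<noteq> 0" "span S \<subseteq> {x. m \<bullet> x = 0}"
      using lowdim_subset_hyperplane[of S] by auto
    define n where "n = (1 / norm m) *\<^sub>R m"
    have n: "norm n = 1" "{x. m \<bullet> x = 0} = {x. x \<bullet> n = 0}" using m by (auto simp: n_def inner_commute)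
    have "S = {x. m \<bullet> x = 0}"
    proof (rule subspace_dim_equal[OF S(1) subspace_hyperplane])
      show "S \<subseteq> {x. m \<bullet> x = 0}" using m(2) span_superset by blast
      show "dim {x. m \<bullet> x = 0} \<le> dim S" using dim_hyperplane[OF m(1)] S(2) by simp
    qed
    then show "P \<in> normal_projection ` sphere 0 1"
      using S(3) plane_projection_hyperplane[OF n(1)] n by auto
  qed
  show "normal_projection ` sphere 0 1 \<subseteq> planes"
  proof
    fix P assume "P \<in> normal_projection ` sphere 0 1"
    then obtain n where n: "norm n = 1" "P = normal_projection n" by auto
    have "n \<noteq> 0" using n(1) by auto
    then have "subspace {z. z \<bullet> n = 0}" "dim {z. z \<bullet> n = 0} = 2"
      using subspace_hyperplane[of n] dim_hyperplane[of n] by (auto simp: inner_commute)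
    then show "P \<in> planes"
      unfolding planes_def using n plane_projection_hyperplane[OF n(1)] by (metis (mono_tags, lifting) image_eqI mem_Collect_eq)
  qed
qed

lemma compact_planes: "compact planes"
  unfolding planes_eq by (intro compact_continuous_image continuous_normal_projection) simp

text \<open>With \<open>N = cross3 a b\<close>, the vectors \<open>cross3 b N\<close> and \<open>cross3 N a\<close> are \<open>\<bar>N\<bar>\<^sup>2\<close> times the basis that is
  dual to \<open>a, b\<close> in the plane spanned by them.\<close>

lemma frame_decomposition:
  "(norm (cross3 a b))\<^sup>2 *\<^sub>R v = (v \<bullet> cross3 b (cross3 a b)) *\<^sub>R a + (v \<bullet> cross3 (cross3 a b) a) *\<^sub>R b + (v \<bullet> cross3 a b) *\<^sub>R cross3 a b"
  unfolding power2_norm_eq_inner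
  by (simp add: vec_eq_iff forall_3 inner_vec_def sum_3 cross3_def vector_def algebra_simps)

lemma range_frame_map:
  assumes "cross3 a b \<noteq> 0"
  shows "range (frame_map a b) = {z. z \<bullet> cross3 a b = 0}"
proof
  show "range (frame_map a b) \<subseteq> {z. z \<bullet> cross3 a b = 0}"
    by (auto simp: frame_map_def inner_add_left dot_cross_self)
  show "{z. z \<bullet> cross3 a b = 0} \<subseteq> range (frame_map a b)"
  proof
    fix v assume "v \<in> {z. z \<bullet> cross3 a b = 0}"
    then have "(norm (cross3 a b))\<^sup>2 *\<^sub>R v = frame_map a b (vector [v \<bullet> cross3 b (cross3 a b), v \<bullet> cross3 (cross3 a b) a])"
      using frame_decomposition[of a b v] by (simp add: frame_map_def)
    then have "(1 / (norm (cross3 a b))\<^sup>2) *\<^sub>R ((norm (cross3 a b))\<^sup>2 *\<^sub>R v) = frame_map a b ((1 / (norm (cross3 a b))\<^sup>2) *\<^sub>R (vector [v \<bullet> cross3 b (cross3 a b), v \<bullet> cross3 (cross3 a b) a]))"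
      by (simp add: linear_scale[OF linear_frame_map])
    moreover have "(1 / (norm (cross3 a b))\<^sup>2) *\<^sub>R ((norm (cross3 a b))\<^sup>2 *\<^sub>R v) = v" using assms by simp
    ultimately show "v \<in> range (frame_map a b)" by (metis rangeI)
  qed
qed

text \<open>For \<open>A = DX\<close> this expresses the tangential divergence of \<open>X\<close>, times the area density, by the
  derivatives of \<open>X\<close> in the coordinate directions; the vectors \<open>cross3 b n\<close> and \<open>cross3 n a\<close> are \<open>J\<close>
  times the dual basis of \<open>a, b\<close>.\<close>

lemma trace_normal_projection_frame:
  assumes "cross3 a b \<noteq> 0"
  defines "J \<equiv> norm (cross3 a b)" and "n \<equiv> (1 / norm (cross3 a b)) *\<^sub>R cross3 a b"
  shows "J * trace (normal_projection n ** A) = (A *v a) \<bullet> cross3 b n + (A *v b) \<bullet> cross3 n a"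
proof -
  have J: "J > 0" using assms(1) by (simp add: J_def)
  let ?N = "cross3 a b"
  have N: "?N = J *\<^sub>R n" using J by (simp add: n_def J_def)
  have JJ: "J * J = ?N \<bullet> ?N" by (simp add: J_def dot_square_norm power2_eq_square)
  have "(?N \<bullet> ?N) * trace A - ?N \<bullet> (A *v ?N) = (A *v a) \<bullet> cross3 b ?N + (A *v b) \<bullet> cross3 ?N a"
    by (simp add: inner_vec_def sum_3 cross3_def vector_def matrix_vector_mult_def trace_def algebra_simps)
  then have "J * (J * trace A - J * (n \<bullet> (A *v n))) = J * ((A *v a) \<bullet> cross3 b n + (A *v b) \<bullet> cross3 n a)"
    unfolding JJ[symmetric] unfolding N
    by (simp add: cross_mult_left cross_mult_right matrix_vector_mult_scaleR algebra_simps)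
  then have "J * trace A - J * (n \<bullet> (A *v n)) = (A *v a) \<bullet> cross3 b n + (A *v b) \<bullet> cross3 n a"
    unfolding mult_cancel_left using J by simp
  then show ?thesis by (simp add: trace_normal_projection right_diff_distrib)
qed

context C1_patch
begin

definition unit_normal :: "real^2 \<Rightarrow> real^3" where
  "unit_normal u = (1 / jac u) *\<^sub>R cross3 (a u) (b u)"

lemma norm_unit_normal: "u \<in> U \<Longrightarrow> norm (unit_normal u) = 1"
  using jac_pos[of u] by (simp add: unit_normal_def jac_def)

lemma cont_unit_normal: "continuous_on U unit_normal"
  unfolding unit_normal_def[abs_def] using jac_pos
  by (intro continuous_intros continuous_on_cross cont_a cont_b cont_jac) force

text \<open>A curve in the surface stays on the patch, and near \<open>u\<close> the distance of the parameters
  is controlled by the distance in space; so its velocity is orthogonal to the normal.\<close>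

lemma tangent_space_patch:
  assumes M: "openin (top_of_set M) (\<phi> ` U)" and u: "u \<in> U"
  shows "tangent_space M (\<phi> u) = {z. z \<bullet> unit_normal u = 0}"
proof -
  let ?L = "frame_map (a u) (b u)"
  let ?N = "cross3 (a u) (b u)"
  have N0: "?N \<noteq> 0" using immersed[OF u] .
  have eq: "{z. z \<bullet> unit_normal u = 0} = {z. z \<bullet> ?N = 0}"
    using jac_pos[OF u] by (simp add: unit_normal_def)
  obtain W where W: "open W" "\<phi> ` U = M \<inter> W" using M by (auto simp: openin_open)
  have "range ?L \<subseteq> tangent_space M (\<phi> u)"
  proof
    fix v assume "v \<in> range ?L"
    then obtain x where x: "v = ?L x" by auto
    have "((\<lambda>t::real. u + t *\<^sub>R x) \<longlongrightarrow> u + 0 *\<^sub>R x) (nhds 0)"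
      by (intro tendsto_add tendsto_const tendsto_scaleR filterlim_ident)
    then have "((\<lambda>t::real. u + t *\<^sub>R x) \<longlongrightarrow> u) (nhds 0)" by simp
    then have "\<forall>\<^sub>F t in nhds (0::real). u + t *\<^sub>R x \<in> U" using open_U u by (rule topological_tendstoD)
    then obtain d where d: "d > 0" "\<And>t. \<bar>t\<bar> < d \<Longrightarrow> u + t *\<^sub>R x \<in> U"
      unfolding eventually_nhds_metric by (auto simp: dist_real_def)
    have der: "((\<lambda>t. \<phi> (u + t *\<^sub>R x)) has_derivative (\<lambda>h. frame_map (a (u + t *\<^sub>R x)) (b (u + t *\<^sub>R x)) (h *\<^sub>R x))) (at t)" if "\<bar>t\<bar> < d" for t
      by (rule has_derivative_compose[of "\<lambda>t. u + t *\<^sub>R x" _ t UNIV \<phi>, OF _ deriv[OF d(2)[OF that]]]) (auto intro!: derivative_eq_intros)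
    show "v \<in> tangent_space M (\<phi> u)"
      unfolding tangent_space_def
    proof (intro CollectI exI[of _ "\<lambda>t. \<phi> (u + t *\<^sub>R x)"] exI[of _ d] conjI)
      show "(\<lambda>t. \<phi> (u + t *\<^sub>R x)) ` {-d<..<d} \<subseteq> M" using d W by (auto simp: image_subset_iff abs_less_iff)
      show "(\<lambda>t. \<phi> (u + t *\<^sub>R x)) differentiable_on {-d<..<d}"
        unfolding differentiable_on_def
      proof
        fix t assume "t \<in> {-d<..<d}"
        then have "\<bar>t\<bar> < d" by auto
        from has_derivative_at_withinI[OF der[OF this]]
        show "(\<lambda>t. \<phi> (u + t *\<^sub>R x)) differentiable (at t within {-d<..<d})" by (rule differentiableI)
      qed
      show "((\<lambda>t. \<phi> (u + t *\<^sub>R x)) has_vector_derivative v) (at 0)"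
        unfolding has_vector_derivative_def using der[of 0] d x by (simp add: linear_scale[OF linear_frame_map])
    qed (use d in auto)
  qed
  moreover have "tangent_space M (\<phi> u) \<subseteq> {z. z \<bullet> ?N = 0}"
  proof
    fix v assume "v \<in> tangent_space M (\<phi> u)"
    then obtain \<gamma> \<epsilon> where \<gamma>: "\<epsilon> > 0" "\<gamma> ` {-\<epsilon><..<\<epsilon>} \<subseteq> M" "\<gamma> 0 = \<phi> u" "(\<gamma> has_vector_derivative v) (at (0::real))"
      unfolding tangent_space_def by blast
    obtain m where m: "m > 0" "\<And>x. m * norm x \<le> norm (?L x)"
      using linear_inj_bounded_below_pos[OF linear_frame_map inj_frame_map[OF N0]] by metis
    have cont: "(\<gamma> \<longlongrightarrow> \<phi> u) (at 0)"
      using has_vector_derivative_continuous[OF \<gamma>(4)] \<gamma>(3) by (simp add: continuous_within)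
    have ev_patch: "\<forall>\<^sub>F t in at 0. \<gamma> t \<in> \<phi> ` U"
    proof -
      have "\<forall>\<^sub>F t in at 0. \<gamma> t \<in> W"
        using topological_tendstoD[OF cont W(1)] u W(2) by blast
      moreover have "\<forall>\<^sub>F t in at 0. t \<in> {-\<epsilon><..<\<epsilon>}"
        using \<gamma>(1) by (intro eventually_at_in_open') auto
      ultimately show ?thesis by eventually_elim (use \<gamma>(2) W(2) in auto)
    qed
    have "(\<psi> \<longlongrightarrow> \<psi> (\<phi> u)) (at (\<phi> u) within \<phi> ` U)"
      using cont_psi u by (auto simp: continuous_on_def)
    then have psi_lim: "((\<lambda>t. \<psi> (\<gamma> t)) \<longlongrightarrow> u) (at 0)"
    proof -
      have *: "continuous_on (\<phi> ` U) \<psi>" by (rule cont_psi)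
      have "((\<lambda>t. \<psi> (\<gamma> t)) \<longlongrightarrow> \<psi> (\<phi> u)) (at 0)"
        by (rule continuous_on_tendsto_compose[OF * cont _ ev_patch]) (use u in auto)
      then show ?thesis using u by simp
    qed
    have quot: "((\<lambda>t. ((\<gamma> t - \<phi> u) /\<^sub>R t)) \<longlongrightarrow> v) (at 0)"
    proof -
      have "(\<lambda>t. norm (\<gamma> (0 + t) - \<gamma> 0 - t *\<^sub>R v) / norm t) \<midarrow>0\<rightarrow> 0"
        using \<gamma>(4) unfolding has_vector_derivative_def has_derivative_at by blast
      then have "(\<lambda>t. norm ((\<gamma> t - \<phi> u) /\<^sub>R t - v)) \<midarrow>0\<rightarrow> 0"
      proof (rule Lim_transform_eventually)
        show "\<forall>\<^sub>F t in at 0. norm (\<gamma> (0 + t) - \<gamma> 0 - t *\<^sub>R v) / norm t = norm ((\<gamma> t - \<phi> u) /\<^sub>R t - v)"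
          using eventually_neq_at_within[of "0::real" 0 UNIV]
        proof eventually_elim
          case (elim t)
          have "(\<gamma> t - \<phi> u) /\<^sub>R t - v = (\<gamma> t - \<phi> u - t *\<^sub>R v) /\<^sub>R t"
            using elim by (simp add: scaleR_diff_right)
          then show ?case using \<gamma>(3) by (simp add: divide_inverse mult.commute)
        qed
      qed
      then show ?thesis by (rule LIM_zero_cancel[OF tendsto_norm_zero_cancel])
    qed
    have small: "\<bar>v \<bullet> ?N\<bar> \<le> e" if e: "0 < e" for e
    proof -
      \<comment> \<open>The first bound on \<open>d\<close> makes \<open>norm (w - u)\<close> comparable with \<open>norm (\<gamma> t - \<phi> u)\<close>, the second one
        makes the normal component of the difference quotient at most \<open>e / 2\<close>.\<close>
      define d where "d = min (m / 2) (e * m / (4 * (norm v + 1) * norm ?N))"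
      have d: "d > 0" using m e N0 by (simp add: d_def add_nonneg_pos)
      obtain r where r: "r > 0" "ball u r \<subseteq> U"
        and approx: "\<And>x y. x \<in> ball u r \<Longrightarrow> y \<in> ball u r \<Longrightarrow> norm (\<phi> x - \<phi> y - ?L (x - y)) \<le> d * norm (x - y)"
        using local_linear_approximation[OF u d] by metis
      have ev1: "\<forall>\<^sub>F t in at 0. dist (\<psi> (\<gamma> t)) u < r" using tendstoD[OF psi_lim r(1)] .
      have ev2: "\<forall>\<^sub>F t in at 0. dist ((\<gamma> t - \<phi> u) /\<^sub>R t) v < 1" using tendstoD[OF quot] by simp
      have "\<forall>\<^sub>F t in at 0. \<bar>((\<gamma> t - \<phi> u) /\<^sub>R t) \<bullet> ?N\<bar> \<le> e/2"
        using ev1 ev2 ev_patch eventually_neq_at_within[of "0::real" 0 UNIV]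
      proof eventually_elim
        case (elim t)
        define w where "w = \<psi> (\<gamma> t)"
        have \<gamma>w: "\<gamma> t = \<phi> w" using elim(3) by (auto simp: w_def)
        have t0: "t \<noteq> 0" by (rule elim(4))
        have ap: "norm (\<gamma> t - \<phi> u - ?L (w - u)) \<le> d * norm (w - u)"
          unfolding \<gamma>w using elim(1) r by (intro approx) (auto simp: w_def dist_commute)
        have "m * norm (w - u) \<le> norm (?L (w - u))" by (rule m)
        also have "\<dots> \<le> norm (\<gamma> t - \<phi> u) + norm (\<gamma> t - \<phi> u - ?L (w - u))"
          using norm_triangle_ineq4[of "\<gamma> t - \<phi> u" "\<gamma> t - \<phi> u - ?L (w - u)"] by simp
        also have "\<dots> \<le> norm (\<gamma> t - \<phi> u) + (m/2) * norm (w - u)"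
        proof -
          have "d \<le> m / 2" unfolding d_def by (rule min.cobounded1)
          then have "d * norm (w - u) \<le> (m/2) * norm (w - u)" by (rule mult_right_mono) simp
          then show ?thesis using ap by linarith
        qed
        finally have "m/2 * norm (w - u) \<le> norm (\<gamma> t - \<phi> u)" by simp
        moreover have "norm (\<gamma> t - \<phi> u) \<le> (norm v + 1) * \<bar>t\<bar>"
        proof -
          have "norm ((\<gamma> t - \<phi> u) /\<^sub>R t) \<le> norm v + 1"
            using elim(2) norm_triangle_sub[of "(\<gamma> t - \<phi> u) /\<^sub>R t" v] by (simp add: dist_norm)
          then have "norm (\<gamma> t - \<phi> u) / \<bar>t\<bar> \<le> norm v + 1"
            unfolding norm_scaleR by (simp add: divide_inverse mult.commute)
          then show ?thesis using t0 by (simp add: pos_divide_le_eq)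
        qed
        ultimately have wu: "norm (w - u) \<le> 2 / m * ((norm v + 1) * \<bar>t\<bar>)"
          using m by (simp add: field_simps)
        have "?L (w - u) \<bullet> ?N = 0" using range_frame_map[OF N0] by auto
        then have "(\<gamma> t - \<phi> u) \<bullet> ?N = (\<gamma> t - \<phi> u - ?L (w - u)) \<bullet> ?N" by (simp add: inner_diff_left)
        then have "\<bar>(\<gamma> t - \<phi> u) \<bullet> ?N\<bar> \<le> (d * norm (w - u)) * norm ?N"
          using Cauchy_Schwarz_ineq2[of "\<gamma> t - \<phi> u - ?L (w - u)" ?N] mult_right_mono[OF ap, of "norm ?N"] by simp
        also have "\<dots> \<le> (e * m / (4 * (norm v + 1) * norm ?N) * (2 / m * ((norm v + 1) * \<bar>t\<bar>))) * norm ?N"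
          using wu d e m by (intro mult_right_mono mult_mono) (auto simp: d_def)
        also have "\<dots> = e / 2 * \<bar>t\<bar>"
        proof -
          have cancel: "(e * m / (4 * q * n) * (2 / m * (q * T))) * n = e / 2 * T" if "q \<noteq> 0" "n \<noteq> 0" for q n T :: real
            using that m(1) by (simp add: field_simps)
          have "norm v + 1 \<noteq> 0" by (metis add_nonneg_pos less_irrefl norm_ge_zero zero_less_one)
          moreover have "norm ?N \<noteq> 0" using N0 by simp
          ultimately show ?thesis by (rule cancel)
        qed
        finally have "\<bar>(\<gamma> t - \<phi> u) \<bullet> ?N\<bar> / \<bar>t\<bar> \<le> e / 2" using t0 by (simp add: pos_divide_le_eq)
        moreover have "((\<gamma> t - \<phi> u) /\<^sub>R t) \<bullet> ?N = ((\<gamma> t - \<phi> u) \<bullet> ?N) / t"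
          unfolding inner_scaleR_left by (simp only: divide_inverse mult.commute)
        ultimately show ?case by (simp only: abs_divide)
      qed
      moreover have "((\<lambda>t. \<bar>((\<gamma> t - \<phi> u) /\<^sub>R t) \<bullet> ?N\<bar>) \<longlongrightarrow> \<bar>v \<bullet> ?N\<bar>) (at 0)"
        by (intro tendsto_intros quot)
      ultimately have "\<bar>v \<bullet> ?N\<bar> \<le> e/2"
        by (intro tendsto_upperbound[of _ _ "at 0"]) auto
      then show ?thesis using e by simp
    qed
    have "\<bar>v \<bullet> ?N\<bar> \<le> 0"
    proof (rule field_le_epsilon)
      show "\<bar>v \<bullet> ?N\<bar> \<le> 0 + e" if "0 < e" for e using small[OF that] by simp
    qed
    then show "v \<in> {z. z \<bullet> ?N = 0}" by simp
  qed
  ultimately show ?thesis using range_frame_map[OF N0] eq by auto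
qed

lemma plane_projection_patch:
  assumes "openin (top_of_set M) (\<phi> ` U)" and "u \<in> U"
  shows "plane_projection (tangent_space M (\<phi> u)) = normal_projection (unit_normal u)"
  unfolding tangent_space_patch[OF assms] by (rule plane_projection_hyperplane[OF norm_unit_normal[OF assms(2)]])

end

text \<open>The second derivatives of \<open>\<phi>\<close> enter as the differentials of \<open>a\<close> and \<open>b\<close>.\<close>

locale C2_patch = C1_patch +
  fixes da db :: "real^2 \<Rightarrow> real^2 \<Rightarrow> real^3"
  assumes deriv_a: "\<And>u. u \<in> U \<Longrightarrow> (a has_derivative da u) (at u)"
    and deriv_b: "\<And>u. u \<in> U \<Longrightarrow> (b has_derivative db u) (at u)"
    and cont_da: "\<And>v. continuous_on U (\<lambda>u. da u v)"
    and cont_db: "\<And>v. continuous_on U (\<lambda>u. db u v)"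
    and mixed: "\<And>u. u \<in> U \<Longrightarrow> da u (axis 2 1) = db u (axis 1 1)"

lemma frame_map_of_linear:
  assumes "linear f" shows "f = frame_map (f (axis 1 1)) (f (axis 2 1))"
proof
  fix x :: "real^2"
  have "x = x$1 *\<^sub>R axis 1 1 + x$2 *\<^sub>R axis 2 1" by (simp add: vec_eq_iff forall_2 axis_def)
  then have "f x = f (x$1 *\<^sub>R axis 1 1 + x$2 *\<^sub>R axis 2 1)" by simp
  also have "\<dots> = frame_map (f (axis 1 1)) (f (axis 2 1)) x"
    using assms by (simp add: frame_map_def linear_add linear_scale)
  finally show "f x = frame_map (f (axis 1 1)) (f (axis 2 1)) x" .
qed

lemma cross_neq_0_of_inj:
  assumes inj: "inj (frame_map a b)" shows "cross3 a b \<noteq> 0"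
proof
  assume "cross3 a b = 0"
  then have "collinear {0, a, b}" by (simp add: cross_eq_0)
  then consider "a = 0" | "b = 0" | c where "b = c *\<^sub>R a" by (auto simp: collinear_lemma)
  then have "\<exists>x. x \<noteq> 0 \<and> frame_map a b x = 0"
  proof cases
    case 1
    then show ?thesis by (intro exI[of _ "vector [1, 0]"]) (auto simp: frame_map_def vec_eq_iff forall_2)
  next
    case 2
    then show ?thesis by (intro exI[of _ "vector [0, 1]"]) (auto simp: frame_map_def vec_eq_iff forall_2)
  next
    case 3 then show ?thesis by (intro exI[of _ "vector [c, -1]"]) (auto simp: frame_map_def vec_eq_iff forall_2)
  qed
  then show False using inj linear_injective_0[OF linear_frame_map] by blast
qed

lemma C2_patch_of_local_parametrization:
  assumes "local_parametrization M U \<phi>"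
  shows "\<exists>\<psi> a b da db. C2_patch U \<phi> \<psi> a b da db"
proof -
  obtain f' f'' where
    f': "\<And>x. x \<in> U \<Longrightarrow> (\<phi> has_derivative blinfun_apply (f' x)) (at x)" and
    f'': "\<And>x. x \<in> U \<Longrightarrow> (f' has_derivative blinfun_apply (f'' x)) (at x)" and
    cont: "continuous_on U f''" and U: "open U"
    using assms unfolding local_parametrization_def C2_on_def by blast
  have inj: "\<And>u. u \<in> U \<Longrightarrow> inj (frechet_derivative \<phi> (at u))"
    using assms unfolding local_parametrization_def by blast
  obtain \<psi> where \<psi>: "homeomorphism U (\<phi> ` U) \<phi> \<psi>"
    using assms unfolding local_parametrization_def by blast
  have lin: "linear (blinfun_apply (f' u))" for u by (rule bounded_linear.linear[OF blinfun.bounded_linear_right])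
  have fr: "frechet_derivative \<phi> (at u) = frame_map (f' u (axis 1 1)) (f' u (axis 2 1))" if "u \<in> U" for u
    using frechet_derivative_at[OF f'[OF that]] frame_map_of_linear[OF lin[of u]] by simp
  have cont': "continuous_on U f'"
    using f'' by (intro continuous_at_imp_continuous_on) (auto intro: has_derivative_continuous)
  have d: "((\<lambda>u. f' u e) has_derivative (\<lambda>v. f'' u v e)) (at u)" if "u \<in> U" for u e
    using bounded_linear.has_derivative[OF blinfun.bounded_linear_left f''[OF that]] .
  have "C2_patch U \<phi> \<psi> (\<lambda>u. f' u (axis 1 1)) (\<lambda>u. f' u (axis 2 1)) (\<lambda>u v. f'' u v (axis 1 1)) (\<lambda>u v. f'' u v (axis 2 1))"
  proof
    show "(\<phi> has_derivative frame_map (f' u (axis 1 1)) (f' u (axis 2 1))) (at u)" if "u \<in> U" for u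
      using f'[OF that] frame_map_of_linear[OF lin[of u]] by simp
    show "cross3 (f' u (axis 1 1)) (f' u (axis 2 1)) \<noteq> 0" if "u \<in> U" for u
      using inj[OF that] fr[OF that] by (intro cross_neq_0_of_inj) simp
    show "f'' u (axis 2 1) (axis 1 1) = f'' u (axis 1 1) (axis 2 1)" if "u \<in> U" for u
      by (rule second_derivative_symmetric[OF U that f' f''[OF that]])
  qed (use U \<psi> in \<open>auto intro!: d continuous_intros cont cont'\<close>)
  then show ?thesis by blast
qed


definition surface_measure :: "(real^3) set \<Rightarrow> (real^3) measure" where
  "surface_measure M = density hausdorff2 (indicator M)"

lemma sets_surface_measure [simp, measurable_cong]: "sets (surface_measure M) = sets borel"
  by (simp add: surface_measure_def)

lemma space_surface_measure [simp]: "space (surface_measure M) = UNIV"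
  by (simp add: surface_measure_def)

lemma measurable_surface_measure [simp]: "borel_measurable (surface_measure M) = borel_measurable borel"
  by (rule measurable_cong_sets) simp_all

lemma emeasure_surface_measure:
  assumes "M \<in> sets borel" "A \<in> sets borel"
  shows "emeasure (surface_measure M) A = emeasure hausdorff2 (M \<inter> A)"
  unfolding surface_measure_def using assms by (subst emeasure_restricted) auto

text \<open>On a patch the tangent plane is the orthogonal complement of the continuous unit normal.\<close>

lemma continuous_on_tangent_plane:
  assumes M: "C2_surface M"
  shows "continuous_on M (\<lambda>x. plane_projection (tangent_space M x))"
    and "\<And>x. x \<in> M \<Longrightarrow> plane_projection (tangent_space M x) \<in> planes"
proof -
  have *: "plane_projection (tangent_space M p) \<in> planes \<and>
      (\<exists>S. openin (top_of_set M) S \<and> p \<in> S \<and> continuous_on S (\<lambda>x. plane_projection (tangent_space M x)))" if p: "p \<in> M" for p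
  proof -
    obtain U \<phi> where par: "local_parametrization M U \<phi>" and "p \<in> \<phi> ` U"
      using M p unfolding C2_surface_def by blast
    then obtain \<psi> a b da db where "C2_patch U \<phi> \<psi> a b da db" using C2_patch_of_local_parametrization by blast
    then interpret C2_patch U \<phi> \<psi> a b da db .
    have op: "openin (top_of_set M) (\<phi> ` U)" using par by (simp add: local_parametrization_def)
    obtain u where u: "u \<in> U" "p = \<phi> u" using \<open>p \<in> \<phi> ` U\<close> by auto
    have "plane_projection (tangent_space M p) \<in> planes"
      unfolding u(2) plane_projection_patch[OF op u(1)] planes_eq using norm_unit_normal[OF u(1)] by auto
    moreover have "continuous_on (\<phi> ` U) (\<lambda>x. plane_projection (tangent_space M x))"
    proof (rule continuous_on_eq[of _ "\<lambda>x. normal_projection (unit_normal (\<psi> x))"])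
      show "continuous_on (\<phi> ` U) (\<lambda>x. normal_projection (unit_normal (\<psi> x)))"
        by (rule continuous_on_compose2[OF continuous_normal_projection[of UNIV]],
            rule continuous_on_compose2[OF cont_unit_normal cont_psi]) auto
      show "normal_projection (unit_normal (\<psi> x)) = plane_projection (tangent_space M x)" if "x \<in> \<phi> ` U" for x
        using that plane_projection_patch[OF op] by auto
    qed
    ultimately show ?thesis using op \<open>p \<in> \<phi> ` U\<close> by blast
  qed
  show "\<And>x. x \<in> M \<Longrightarrow> plane_projection (tangent_space M x) \<in> planes" using * by blast
  show "continuous_on M (\<lambda>x. plane_projection (tangent_space M x))"
    unfolding continuous_on_eq_continuous_within
  proof
    fix p assume "p \<in> M"
    then obtain S where S: "openin (top_of_set M) S" "p \<in> S" "continuous_on S (\<lambda>x. plane_projection (tangent_space M x))"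
      using * by blast
    obtain W where W: "open W" "S = M \<inter> W" using S(1) by (auto simp: openin_open)
    have "at p within S = at p within M"
      by (rule at_within_nhd[of p W]) (use W S(2) in auto)
    moreover have "continuous (at p within S) (\<lambda>x. plane_projection (tangent_space M x))"
      using S(2,3) by (simp add: continuous_on_eq_continuous_within)
    ultimately show "continuous (at p within M) (\<lambda>x. plane_projection (tangent_space M x))"
      by simp
  qed
qed

text \<open>The image measure that defines the induced varifold carries information only because the map
  is measurable.\<close>

lemma measurable_tangent_lift:
  assumes M: "C2_surface M"
  shows "(\<lambda>x. (x, plane_projection (tangent_space M x))) \<in> measurable (restrict_space hausdorff2 M) (restrict_space borel grassmann_bundle)"
proof (rule measurable_restrict_space2)
  show "(\<lambda>x. (x, plane_projection (tangent_space M x))) \<in> space (restrict_space hausdorff2 M) \<rightarrow> grassmann_bundle"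
    using continuous_on_tangent_plane(2)[OF M] by (auto simp: grassmann_bundle_def space_restrict_space)
  have "(\<lambda>x. (x, plane_projection (tangent_space M x))) \<in> borel_measurable (restrict_space borel M)"
    by (intro borel_measurable_continuous_on_restrict continuous_intros continuous_on_tangent_plane M)
  moreover have "sets (restrict_space borel M) = sets (restrict_space hausdorff2 M)"
    by (rule sets_restrict_space_cong) simp
  ultimately show "(\<lambda>x. (x, plane_projection (tangent_space M x))) \<in> borel_measurable (restrict_space hausdorff2 M)"
    using measurable_cong_sets by blast
qed

lemma fst_measurable_bundle: "fst \<in> borel_measurable (restrict_space borel grassmann_bundle)"
  by (intro measurable_restrict_space1 borel_measurable_continuous_onI continuous_intros)

lemma mass_measure_induced_varifold:
  assumes M: "C2_surface M" "compact M"
  shows "mass_measure (induced_varifold M) = surface_measure M"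
proof -
  have Mb: "M \<in> sets borel" using M(2) by (rule borel_compact)
  have "mass_measure (induced_varifold M) = distr (restrict_space hausdorff2 M) borel (\<lambda>x. x)"
    unfolding mass_measure_def induced_varifold_def
    using fst_measurable_bundle measurable_tangent_lift[OF M(1)] by (subst distr_distr) (auto simp: comp_def)
  also have "\<dots> = surface_measure M"
  proof (rule measure_eqI)
    fix A assume "A \<in> sets (distr (restrict_space hausdorff2 M) borel (\<lambda>x. x))"
    then have A: "A \<in> sets borel" by simp
    have m: "(\<lambda>x. x) \<in> measurable (restrict_space hausdorff2 M) borel"
      by (intro measurable_restrict_space1) (simp add: measurable_def)
    show "emeasure (distr (restrict_space hausdorff2 M) borel (\<lambda>x. x)) A = emeasure (surface_measure M) A"
      using A Mb m
      by (subst emeasure_distr) (auto simp: emeasure_surface_measure space_restrict_space Int_commute emeasure_restrict_space)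
  qed simp
  finally show ?thesis .
qed

lemma integral_induced_varifold:
  fixes f :: "_ \<Rightarrow> real"
  assumes M: "C2_surface M" "compact M" and f: "f \<in> borel_measurable borel"
  shows "(\<integral>z. f z \<partial>induced_varifold M) = (\<integral>x. indicator M x * f (x, plane_projection (tangent_space M x)) \<partial>hausdorff2)"
proof -
  have Mb: "M \<in> sets borel" using M(2) by (rule borel_compact)
  have "f \<in> borel_measurable (restrict_space borel grassmann_bundle)" using f by (rule measurable_restrict_space1)
  then have "(\<integral>z. f z \<partial>induced_varifold M) = (\<integral>x. f (x, plane_projection (tangent_space M x)) \<partial>restrict_space hausdorff2 M)"
    unfolding induced_varifold_def using measurable_tangent_lift[OF M(1)] by (subst integral_distr) auto
  then show ?thesis using Mb by (subst (asm) integral_restrict_space) auto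
qed


section \<open>Test functions\<close>

lemma compact_continuous_bound:
  fixes f :: "'a::topological_space \<Rightarrow> 'b::real_normed_vector"
  assumes "compact S" "continuous_on S f"
  shows "\<exists>C\<ge>0. \<forall>x\<in>S. norm (f x) \<le> C"
proof -
  have "bounded (f ` S)" using assms by (intro compact_imp_bounded compact_continuous_image)
  then show ?thesis unfolding bounded_pos by (auto intro: less_imp_le)
qed

lemma derivative_zero_outside_support:
  fixes F :: "'a::euclidean_space \<Rightarrow> 'b::real_normed_vector"
  assumes "compact K" "\<And>x. x \<notin> K \<Longrightarrow> F x = 0" "x \<notin> K" and F': "(F has_derivative F') (at x)"
  shows "F' = (\<lambda>h. 0)"
proof -
  have "(F has_derivative (\<lambda>h. 0)) (at x)"
    by (rule has_derivative_transform_within_open[of "\<lambda>x. 0" _ _ _ "- K"])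
      (use assms in \<open>auto simp: compact_imp_closed open_Compl\<close>)
  then show ?thesis using F' has_derivative_unique by blast
qed

text \<open>The derivative is represented by a gradient field, so that its continuity is continuity of a
  map between Euclidean spaces.\<close>

definition C1_test :: "'a::euclidean_space set \<Rightarrow> ('a \<Rightarrow> real) \<Rightarrow> bool" where
  "C1_test W g \<longleftrightarrow>
     (\<exists>G. (\<forall>x. (g has_derivative (\<lambda>h. h \<bullet> G x)) (at x)) \<and> continuous_on UNIV G) \<and>
     (\<exists>K. compact K \<and> K \<subseteq> W \<and> (\<forall>x. x \<notin> K \<longrightarrow> g x = 0))"

lemma C1_test_mono: "C1_test W g \<Longrightarrow> W \<subseteq> W' \<Longrightarrow> C1_test W' g"
  unfolding C1_test_def by blast

lemma C1_test_continuous: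
  assumes "C1_test W g" shows "continuous_on UNIV g"
proof -
  obtain G where "\<And>x. (g has_derivative (\<lambda>h. h \<bullet> G x)) (at x)"
    using assms unfolding C1_test_def by blast
  then show ?thesis by (intro continuous_at_imp_continuous_on ballI) (rule has_derivative_continuous)
qed

lemma C1_test_add:
  assumes "C1_test W f" "C1_test W g" shows "C1_test W (\<lambda>x. f x + g x)"
proof -
  obtain F K where F: "\<And>x. (f has_derivative (\<lambda>h. h \<bullet> F x)) (at x)" "continuous_on UNIV F" "compact K" "K \<subseteq> W" "\<And>x. x \<notin> K \<Longrightarrow> f x = 0"
    using assms(1) unfolding C1_test_def by blast
  obtain G L where G: "\<And>x. (g has_derivative (\<lambda>h. h \<bullet> G x)) (at x)" "continuous_on UNIV G" "compact L" "L \<subseteq> W" "\<And>x. x \<notin> L \<Longrightarrow> g x = 0"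
    using assms(2) unfolding C1_test_def by blast
  show ?thesis unfolding C1_test_def
  proof (intro conjI exI[of _ "\<lambda>x. F x + G x"] exI[of _ "K \<union> L"] allI)
    show "((\<lambda>x. f x + g x) has_derivative (\<lambda>h. h \<bullet> (F x + G x))) (at x)" for x
      using has_derivative_add[OF F(1)[of x] G(1)[of x]] by (simp add: inner_add_right)
  qed (use F G in \<open>auto intro!: continuous_on_add\<close>)
qed

lemma C1_test_cmult:
  assumes "C1_test W f" shows "C1_test W (\<lambda>x. c * f x)"
proof -
  obtain F K where F: "\<And>x. (f has_derivative (\<lambda>h. h \<bullet> F x)) (at x)" "continuous_on UNIV F" "compact K" "K \<subseteq> W" "\<And>x. x \<notin> K \<Longrightarrow> f x = 0"
    using assms(1) unfolding C1_test_def by blast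
  show ?thesis unfolding C1_test_def
  proof (intro conjI exI[of _ "\<lambda>x. c *\<^sub>R F x"] exI[of _ K] allI)
    show "((\<lambda>x. c * f x) has_derivative (\<lambda>h. h \<bullet> (c *\<^sub>R F x))) (at x)" for x
      using has_derivative_mult_right[OF F(1)[of x], of c] by simp
  qed (use F in \<open>auto intro!: continuous_intros\<close>)
qed

lemma DERIV_positive_part_square:
  "((\<lambda>t. (max 0 t)\<^sup>2) has_real_derivative 2 * max 0 t) (at t)"
proof (cases "t = 0")
  case True
  have "(\<lambda>h::real. max 0 h) \<midarrow>0\<rightarrow> max 0 0" by (intro tendsto_intros)
  then have "(\<lambda>h::real. ((max 0 (0 + h))\<^sup>2 - (max 0 0)\<^sup>2) / h) \<midarrow>0\<rightarrow> 0"
    by (rule Lim_transform_eventually[THEN tendsto_eq_rhs])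
      (auto simp: eventually_at_filter max_def power2_eq_square)
  then show ?thesis using True by (simp add: DERIV_def)
next
  case False
  show ?thesis
  proof (cases "t > 0")
    case True
    have "((\<lambda>t. t\<^sup>2) has_real_derivative 2 * t) (at t)" by (auto intro!: derivative_eq_intros)
    then have "((\<lambda>t. (max 0 t)\<^sup>2) has_real_derivative 2 * t) (at t)"
      by (rule has_field_derivative_transform_within_open[of _ _ _ "{0<..}"]) (use True in \<open>auto simp: max_def\<close>)
    then show ?thesis using True by simp
  next
    case neg: False
    have "((\<lambda>t::real. 0) has_real_derivative 0) (at t)" by simp
    then have "((\<lambda>t. (max 0 t)\<^sup>2) has_real_derivative 0) (at t)"
      by (rule has_field_derivative_transform_within_open[of _ _ _ "{..<0}"]) (use False neg in \<open>auto simp: max_def\<close>)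
    then show ?thesis using False neg by simp
  qed
qed

text \<open>The square of the positive part makes the function \<open>C\<^sup>1\<close>; it is positive exactly on the ball.\<close>

definition bump :: "'a::euclidean_space \<Rightarrow> real \<Rightarrow> 'a \<Rightarrow> real" where
  "bump c r x = (max 0 (r\<^sup>2 - (x - c) \<bullet> (x - c)))\<^sup>2"

lemma bump_nonneg: "0 \<le> bump c r x" by (simp add: bump_def)

lemma inner_diff_self: "(x - c) \<bullet> (x - c) = (dist c x)\<^sup>2"
  by (simp add: dot_square_norm dist_norm norm_minus_commute)

lemma bump_pos:
  assumes "x \<in> ball c r" shows "0 < bump c r x"
proof -
  have "(dist c x)\<^sup>2 < r\<^sup>2" using assms by (intro power_strict_mono) auto
  then show ?thesis by (simp add: bump_def inner_diff_self)
qed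

lemma bump_zero: "0 \<le> r \<Longrightarrow> x \<notin> cball c r \<Longrightarrow> bump c r x = 0"
  using power_mono[of r "dist c x" 2] by (auto simp: bump_def inner_diff_self)

definition bump_grad :: "'a::euclidean_space \<Rightarrow> real \<Rightarrow> 'a \<Rightarrow> 'a" where
  "bump_grad c r x = (- 4 * max 0 (r\<^sup>2 - (x - c) \<bullet> (x - c))) *\<^sub>R (x - c)"

lemma bump_has_derivative: "(bump c r has_derivative (\<lambda>h. h \<bullet> bump_grad c r x)) (at x)"
proof -
  have "((\<lambda>x. r\<^sup>2 - (x - c) \<bullet> (x - c)) has_derivative (\<lambda>h. - 2 * ((x - c) \<bullet> h))) (at x)"
    by (auto intro!: derivative_eq_intros simp: inner_commute)
  moreover have "((\<lambda>t. (max 0 t)\<^sup>2) has_derivative (*) (2 * max 0 (r\<^sup>2 - (x - c) \<bullet> (x - c)))) (at (r\<^sup>2 - (x - c) \<bullet> (x - c)))"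
    using DERIV_positive_part_square unfolding has_field_derivative_def .
  ultimately have "((\<lambda>x. (max 0 (r\<^sup>2 - (x - c) \<bullet> (x - c)))\<^sup>2) has_derivative
     (\<lambda>h. 2 * max 0 (r\<^sup>2 - (x - c) \<bullet> (x - c)) * (- 2 * ((x - c) \<bullet> h)))) (at x)"
    by (rule has_derivative_compose)
  moreover have "(\<lambda>h. 2 * max 0 (r\<^sup>2 - (x - c) \<bullet> (x - c)) * (- 2 * ((x - c) \<bullet> h))) = (\<lambda>h. h \<bullet> bump_grad c r x)"
    by (auto simp: bump_grad_def inner_commute)
  ultimately show ?thesis unfolding bump_def[abs_def] by simp
qed

lemma continuous_bump_grad: "continuous_on UNIV (bump_grad c r)"
  unfolding bump_grad_def[abs_def] by (intro continuous_intros)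

text \<open>An open set is a countable union of balls \<open>B i\<close>; the approximating functions are
  \<open>n S n / (1 + n S n)\<close>, where \<open>S n\<close> is the sum of the bumps on the first \<open>n\<close> balls.\<close>

lemma open_indicator_limit_of_tests:
  fixes S :: "'a::euclidean_space set"
  assumes S: "open S"
  shows "\<exists>g :: nat \<Rightarrow> 'a \<Rightarrow> real. (\<forall>n. C1_test S (g n)) \<and> (\<forall>n x. 0 \<le> g n x \<and> g n x \<le> 1) \<and>
    (\<forall>x. (\<lambda>n. g n x) \<longlonglongrightarrow> indicator S x)"
proof (cases "S = {}")
  case True
  then show ?thesis
    by (intro exI[of _ "\<lambda>n x. 0"]) (auto simp: C1_test_def intro!: exI[of _ "\<lambda>x. 0"] exI[of _ "{}"])
next
  case False
  define \<F> where "\<F> = {ball c r | c r. 0 < r \<and> cball c r \<subseteq> S}"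
  have "\<Union>\<F> = S"
  proof
    show "S \<subseteq> \<Union>\<F>"
    proof
      fix x assume "x \<in> S"
      then obtain r where "r > 0" "cball x r \<subseteq> S" using S open_contains_cball by blast
      then have "ball x r \<in> \<F>" "x \<in> ball x r" by (auto simp: \<F>_def)
      then show "x \<in> \<Union>\<F>" by blast
    qed
  qed (auto simp: \<F>_def)
  moreover obtain \<B> where \<B>: "\<B> \<subseteq> \<F>" "countable \<B>" "\<Union>\<B> = \<Union>\<F>"
    using Lindelof[of \<F>] unfolding \<F>_def by blast
  ultimately have UB: "\<Union>\<B> = S" by simp
  then have "\<B> \<noteq> {}" using False by auto
  then have "range (from_nat_into \<B>) = \<B>" using \<B>(2) by (rule range_from_nat_into)
  moreover have "\<forall>i. \<exists>c r. from_nat_into \<B> i = ball c r \<and> 0 < r \<and> cball c r \<subseteq> S"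
    using from_nat_into[OF \<open>\<B> \<noteq> {}\<close>] \<B>(1) unfolding \<F>_def by blast
  then obtain c r where cr: "\<And>i. from_nat_into \<B> i = ball (c i) (r i)" "\<And>i. 0 < r i" "\<And>i. cball (c i) (r i) \<subseteq> S"
    by metis
  ultimately have cover: "(\<Union>i. ball (c i) (r i)) = S" using UB by auto
  define T where "T n x = (\<Sum>i<n. bump (c i) (r i) x)" for n x
  define G where "G n x = (\<Sum>i<n. bump_grad (c i) (r i) x)" for n x
  have T0: "0 \<le> T n x" for n x by (simp add: T_def sum_nonneg bump_nonneg)
  have pos: "0 < 1 + real n * T n x" for n x using T0[of n x] by (simp add: add_pos_nonneg)
  have contT: "continuous_on UNIV (T n)" for n
    unfolding T_def bump_def by (intro continuous_intros)
  define g where "g n x = real n * T n x / (1 + real n * T n x)" for n x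
  have test: "C1_test S (g n)" for n
    unfolding C1_test_def
  proof (intro conjI exI[of _ "\<lambda>x. (real n / (1 + real n * T n x)\<^sup>2) *\<^sub>R G n x"] exI[of _ "\<Union>i<n. cball (c i) (r i)"] allI impI)
    fix x
    have dT: "(T n has_derivative (\<lambda>h. h \<bullet> G n x)) (at x)"
      unfolding T_def G_def inner_sum_right by (intro has_derivative_sum bump_has_derivative)
    show "(g n has_derivative (\<lambda>h. h \<bullet> (real n / (1 + real n * T n x)\<^sup>2) *\<^sub>R G n x)) (at x)"
      unfolding g_def
      by (rule derivative_eq_intros dT refl | use pos[of n x] in \<open>force simp: power2_eq_square field_simps\<close>)+
  next
    show "continuous_on UNIV (\<lambda>x. (real n / (1 + real n * T n x)\<^sup>2) *\<^sub>R G n x)"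
      unfolding G_def using pos
      by (intro continuous_intros contT continuous_on_subset[OF continuous_bump_grad]) (auto simp: less_le)
    show "compact (\<Union>i<n. cball (c i) (r i))" by (intro compact_UN) auto
    show "(\<Union>i<n. cball (c i) (r i)) \<subseteq> S" using cr(3) by blast
    show "g n x = 0" if "x \<notin> (\<Union>i<n. cball (c i) (r i))" for x
    proof -
      have "T n x = 0" unfolding T_def using that cr(2) by (intro sum.neutral) (auto intro!: bump_zero less_imp_le)
      then show ?thesis by (simp add: g_def)
    qed
  qed
  have bounds: "0 \<le> g n x \<and> g n x \<le> 1" for n x
    using T0[of n x] pos[of n x] by (auto simp: g_def divide_le_eq_1)
  have lim: "(\<lambda>n. g n x) \<longlonglongrightarrow> indicator S x" for x
  proof (cases "x \<in> S")
    case True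
    then obtain i where i: "x \<in> ball (c i) (r i)" using cover by blast
    define q where "q = bump (c i) (r i) x"
    have q: "q > 0" unfolding q_def using i by (rule bump_pos)
    have low: "1 - 1 / (real n * q) \<le> g n x" if n: "i < n" for n
    proof -
      have "q \<le> T n x" unfolding T_def q_def
        using n by (intro member_le_sum) (auto simp: bump_nonneg)
      then have nq: "real n * q \<le> real n * T n x" by (intro mult_left_mono) auto
      have nq0: "0 < real n * q" using n q by simp
      have "g n x = 1 - 1 / (1 + real n * T n x)" using pos[of n x] by (simp add: g_def field_simps)
      moreover have "1 / (1 + real n * T n x) \<le> 1 / (real n * q)"
        using nq nq0 by (intro divide_left_mono) auto
      ultimately show ?thesis by simp
    qed
    have "(\<lambda>n. g n x) \<longlonglongrightarrow> 1"
    proof (rule tendsto_sandwich[of "\<lambda>n. 1 - 1 / (real n * q)" _ _ "\<lambda>n. 1"])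
      have "(\<lambda>n. 1 - (1 / real n) * (1 / q)) \<longlonglongrightarrow> 1 - 0 * (1 / q)"
        by (intro tendsto_intros lim_1_over_n)
      then show "(\<lambda>n. 1 - 1 / (real n * q)) \<longlonglongrightarrow> 1" by simp
      show "\<forall>\<^sub>F n in sequentially. 1 - 1 / (real n * q) \<le> g n x"
        using eventually_gt_at_top[of i] by eventually_elim (rule low)
    qed (use bounds in auto)
    then show ?thesis using True by simp
  next
    case False
    have "g n x = 0" for n
      using test[of n] False unfolding C1_test_def by blast
    then show ?thesis using False by simp
  qed
  show ?thesis using test bounds lim by blast
qed

text \<open>The indicator of a small open set is a limit of test functions; so the positive and negative
  parts of \<open>f\<close> have the same integral over every small open set, and are equal almost everywhere.\<close>

lemma AE_zero_of_orthogonal_to_tests: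
  fixes m :: "'a::euclidean_space measure" and f :: "'a \<Rightarrow> real"
  assumes sets_m: "sets m = sets borel"
    and f: "f \<in> borel_measurable borel" and W: "open W"
    and int: "\<And>K. compact K \<Longrightarrow> K \<subseteq> W \<Longrightarrow> integrable m (\<lambda>x. indicator K x * f x)"
    and orth: "\<And>g. C1_test W g \<Longrightarrow> (\<integral>x. g x * f x \<partial>m) = 0"
  shows "AE x in m. x \<in> W \<longrightarrow> f x = 0"
proof -
  have space_m: "space m = UNIV" using sets_eq_imp_space_eq[OF sets_m] by simp
  have ball: "AE x in m. x \<in> ball c r \<longrightarrow> f x = 0" if cr: "cball c r \<subseteq> W" for c r
  proof -
    let ?C = "cball c r" and ?B = "ball c r"
    have intC: "integrable m (\<lambda>x. indicator ?C x * f x)" by (rule int[OF compact_cball cr])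
    have zero: "(\<integral>x. indicator (S \<inter> ?B) x * f x \<partial>m) = 0" if S: "open S" for S
    proof -
      obtain g :: "nat \<Rightarrow> 'a \<Rightarrow> real" where g: "\<And>n. C1_test (S \<inter> ?B) (g n)" "\<And>n x. 0 \<le> g n x \<and> g n x \<le> 1"
        "\<And>x. (\<lambda>n. g n x) \<longlonglongrightarrow> indicator (S \<inter> ?B) x"
        using open_indicator_limit_of_tests[OF open_Int[OF S open_ball[of c r]]] by blast
      have gm [measurable]: "g n \<in> borel_measurable borel" for n
        using C1_test_continuous[OF g(1)] by (rule borel_measurable_continuous_onI)
      have Sm [measurable]: "S \<in> sets borel" using S by simp
      have "(\<lambda>n. \<integral>x. g n x * f x \<partial>m) \<longlonglongrightarrow> (\<integral>x. indicator (S \<inter> ?B) x * f x \<partial>m)"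
      proof (rule integral_dominated_convergence[where w = "\<lambda>x. norm (indicator ?C x * f x)"])
        show "integrable m (\<lambda>x. norm (indicator ?C x * f x))" using intC by (rule integrable_norm)
        show "AE x in m. (\<lambda>n. g n x * f x) \<longlonglongrightarrow> indicator (S \<inter> ?B) x * f x"
          by (intro AE_I2 tendsto_intros g(3))
        show "AE x in m. norm (g n x * f x) \<le> norm (indicator ?C x * f x)" for n
        proof (rule AE_I2)
          fix x
          show "norm (g n x * f x) \<le> norm (indicator ?C x * f x)"
          proof (cases "x \<in> ?C")
            case True
            then show ?thesis using g(2)[of n x] by (simp add: abs_mult mult_left_le_one_le)
          next
            case False
            then have "g n x = 0" using g(1)[of n] unfolding C1_test_def by force
            then show ?thesis by simp
          qed
        qed
        have fm: "f \<in> borel_measurable m" using f by (simp add: measurable_cong_sets[OF sets_m refl])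
        have "S \<inter> ?B \<in> sets m" using S by (simp add: sets_m)
        then show "(\<lambda>x. indicator (S \<inter> ?B) x * f x) \<in> borel_measurable m"
          by (intro borel_measurable_times borel_measurable_indicator fm)
        show "(\<lambda>x. g n x * f x) \<in> borel_measurable m" for n
          using gm[of n] by (intro borel_measurable_times fm) (simp add: measurable_cong_sets[OF sets_m refl])
      qed
      moreover have "(\<integral>x. g n x * f x \<partial>m) = 0" for n
        by (rule orth, rule C1_test_mono[OF g(1)]) (use cr ball_subset_cball in blast)
      ultimately show ?thesis by (simp add: LIMSEQ_const_iff)
    qed
    define f1 where "f1 x = indicator ?B x * f x" for x
    have f1m: "f1 \<in> borel_measurable borel"
      unfolding f1_def by (intro borel_measurable_times borel_measurable_indicator f) auto
    have f1m' [measurable]: "f1 \<in> borel_measurable m"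
      using f1m by (simp add: measurable_cong_sets[OF sets_m refl])
    have intf1: "integrable m f1"
      by (rule Bochner_Integration.integrable_bound[OF intC]) (auto simp: f1_def indicator_def)
    define pp where "pp x = ennreal (f1 x)" for x
    define np where "np x = ennreal (- f1 x)" for x
    have [measurable]: "pp \<in> borel_measurable m" "np \<in> borel_measurable m"
      unfolding pp_def np_def by measurable
    have finp: "integral\<^sup>N m pp \<noteq> \<infinity>" "integral\<^sup>N m np \<noteq> \<infinity>"
      using intf1 unfolding pp_def np_def by (auto simp: real_integrable_def)
    have eqS: "(\<integral>\<^sup>+x. pp x * indicator S x \<partial>m) = (\<integral>\<^sup>+x. np x * indicator S x \<partial>m)" if S: "open S" for S
    proof -
      have Sm [measurable]: "S \<in> sets m" using S sets_m by simp
      let ?h = "\<lambda>x. indicator S x * f1 x"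
      have ih: "integrable m ?h"
        by (rule Bochner_Integration.integrable_bound[OF intf1]) (auto simp: indicator_def)
      have eq: "(\<integral>\<^sup>+x. ennreal (?h x) \<partial>m) = (\<integral>\<^sup>+x. pp x * indicator S x \<partial>m)"
        "(\<integral>\<^sup>+x. ennreal (- ?h x) \<partial>m) = (\<integral>\<^sup>+x. np x * indicator S x \<partial>m)"
        unfolding pp_def np_def by (auto intro!: nn_integral_cong simp: indicator_def)
      have "(\<integral>x. ?h x \<partial>m) = (\<integral>x. indicator (S \<inter> ?B) x * f x \<partial>m)"
        by (intro Bochner_Integration.integral_cong) (auto simp: f1_def indicator_def)
      also have "\<dots> = 0" by (rule zero[OF S])
      finally have "enn2real (\<integral>\<^sup>+x. ennreal (?h x) \<partial>m) = enn2real (\<integral>\<^sup>+x. ennreal (- ?h x) \<partial>m)"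
        unfolding real_lebesgue_integral_def[OF ih] by simp
      moreover have "(\<integral>\<^sup>+x. ennreal (?h x) \<partial>m) \<noteq> \<infinity>" "(\<integral>\<^sup>+x. ennreal (- ?h x) \<partial>m) \<noteq> \<infinity>"
        using ih by (auto simp: real_integrable_def)
      ultimately show ?thesis unfolding eq infinity_ennreal_def by (metis ennreal_enn2real less_top)
    qed
    have "density m pp = density m np"
    proof (rule measure_eqI_generator_eq[where E = "Collect open" and \<Omega> = UNIV and A = "\<lambda>_. UNIV"])
      show "Int_stable (Collect (open :: 'a set \<Rightarrow> bool))" by (auto simp: Int_stable_def)
      show "emeasure (density m pp) X = emeasure (density m np) X" if "X \<in> Collect open" for X
        using that eqS[of X] sets_m by (simp add: emeasure_density)
      show "sets (density m pp) = sigma_sets UNIV (Collect open)" "sets (density m np) = sigma_sets UNIV (Collect open)"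
        using sets_m by (simp_all add: borel_def)
      show "emeasure (density m pp) UNIV \<noteq> \<infinity>"
        using finp(1) space_m sets_m by (simp add: emeasure_density)
    qed auto
    then have "AE x in m. pp x = np x"
      using finp(1) by (subst (asm) finite_density_unique) auto
    then show ?thesis
    proof eventually_elim
      case (elim x)
      then have "f1 x = 0" unfolding pp_def np_def
        by (cases "f1 x" "0 :: real" rule: linorder_cases) (simp_all add: ennreal_neg less_imp_le)
      then show ?case by (auto simp: f1_def indicator_def)
    qed
  qed
  define \<F> where "\<F> = {ball c r | c r. cball c r \<subseteq> W}"
  obtain \<B> where \<B>: "\<B> \<subseteq> \<F>" "countable \<B>" "\<Union>\<B> = \<Union>\<F>"
    using Lindelof[of \<F>] unfolding \<F>_def by blast
  have "AE x in m. \<forall>B\<in>\<B>. x \<in> B \<longrightarrow> f x = 0"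
    unfolding AE_ball_countable[OF \<B>(2)]
  proof
    fix B assume "B \<in> \<B>"
    then obtain c r where "B = ball c r" "cball c r \<subseteq> W" using \<B>(1) unfolding \<F>_def by blast
    then show "AE x in m. x \<in> B \<longrightarrow> f x = 0" using ball by simp
  qed
  then show ?thesis
  proof eventually_elim
    case (elim x)
    show ?case
    proof
      assume "x \<in> W"
      then obtain r where "r > 0" "cball x r \<subseteq> W" using W open_contains_cball by blast
      then have "ball x r \<in> \<F>" "x \<in> ball x r" by (auto simp: \<F>_def)
      then have "x \<in> \<Union>\<B>" using \<B>(3) by blast
      then show "f x = 0" using elim by blast
    qed
  qed
qed

text \<open>Translation invariance of Lebesgue measure, applied to difference quotients.\<close>

lemma integral_directional_derivative_zero:
  fixes F :: "'a::euclidean_space \<Rightarrow> real"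
  assumes S: "compact S" and supp: "\<And>x. x \<notin> S \<Longrightarrow> F x = 0"
    and F': "\<And>x. (F has_derivative F' x) (at x)" and cont: "continuous_on UNIV (\<lambda>x. F' x v)"
  shows "(\<integral>x. F' x v \<partial>lborel) = 0"
proof -
  have contF: "continuous_on UNIV F"
    using F' by (auto intro!: continuous_at_imp_continuous_on has_derivative_continuous)
  have intF: "integrable lborel F"
  proof -
    have "integrable lborel (\<lambda>x. indicator S x *\<^sub>R F x)"
      using S contF by (intro borel_integrable_compact) (auto intro: continuous_on_subset)
    also have "(\<lambda>x. indicator S x *\<^sub>R F x) = F"
    proof
      show "indicator S x *\<^sub>R F x = F x" for x by (cases "x \<in> S") (simp_all add: supp)
    qed
    finally show ?thesis .
  qed
  have F'0: "F' x v = 0" if "x \<notin> S" for x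
    using derivative_zero_outside_support[OF S supp that F'] by simp
  obtain B where "0 \<le> B" "\<forall>x\<in>S. norm (F' x v) \<le> B"
    using compact_continuous_bound[OF S continuous_on_subset[OF cont]] by blast
  then have B: "\<bar>F' x v\<bar> \<le> B" "0 \<le> B" for x using F'0[of x] by (cases "x \<in> S"; simp)+
  define T where "T = (\<lambda>(t, x). x - t *\<^sub>R v) ` ({0..1} \<times> S)"
  have T: "compact T"
    unfolding T_def using S by (intro compact_continuous_image compact_Times) (auto intro!: continuous_intros simp: split_beta)
  define q where "q n x = (F (x + (1 / real (Suc n)) *\<^sub>R v) - F x) * real (Suc n)" for n x
  have intFt: "integrable lborel (\<lambda>x. F (x + t *\<^sub>R v)) \<and> (\<integral>x. F (x + t *\<^sub>R v) \<partial>lborel) = (\<integral>x. F x \<partial>lborel)" for t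
  proof -
    have Fm: "F \<in> borel_measurable borel" using contF by (rule borel_measurable_continuous_onI)
    have "integrable (distr lborel borel ((+) (t *\<^sub>R v))) F" "(\<integral>x. F x \<partial>distr lborel borel ((+) (t *\<^sub>R v))) = (\<integral>x. F x \<partial>lborel)"
      using intF by (simp_all add: lborel_distr_plus)
    then show ?thesis using Fm
      by (subst (asm) integrable_distr_eq, simp, simp, subst (asm) integral_distr) (auto simp: add.commute)
  qed
  have q0: "(\<integral>x. q n x \<partial>lborel) = 0" for n
    unfolding q_def using intFt[of "1 / real (Suc n)"] intF by simp
  have qbound: "\<bar>q n x\<bar> \<le> indicator T x * B" for n x
  proof (cases "x \<in> T")
    case True
    let ?t = "1 / real (Suc n)"
    have "norm (F (x + ?t *\<^sub>R v) - F (x + 0 *\<^sub>R v)) \<le> B * norm (?t - 0)"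
    proof (rule differentiable_bound[where S = "{0..?t}" and f = "\<lambda>s. F (x + s *\<^sub>R v)" and f' = "\<lambda>s h. F' (x + s *\<^sub>R v) (h *\<^sub>R v)"])
      fix s :: real
      show "((\<lambda>s. F (x + s *\<^sub>R v)) has_derivative (\<lambda>h. F' (x + s *\<^sub>R v) (h *\<^sub>R v))) (at s within {0..?t})"
        by (rule has_derivative_at_withinI,
            rule has_derivative_compose[of "\<lambda>s. x + s *\<^sub>R v" _ s UNIV F, OF _ F']) (auto intro!: derivative_eq_intros)
      show "onorm (\<lambda>h. F' (x + s *\<^sub>R v) (h *\<^sub>R v)) \<le> B"
      proof (rule onorm_bound[OF B(2)])
        fix h :: real
        have "linear (F' (x + s *\<^sub>R v))" using F' has_derivative_linear by blast
        then have "F' (x + s *\<^sub>R v) (h *\<^sub>R v) = h * F' (x + s *\<^sub>R v) v" by (simp add: linear_scale)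
        then show "norm (F' (x + s *\<^sub>R v) (h *\<^sub>R v)) \<le> B * norm h"
          using mult_right_mono[OF B(1)[of "x + s *\<^sub>R v"], of "\<bar>h\<bar>"] by (simp add: abs_mult mult.commute)
      qed
    qed auto
    then have "\<bar>F (x + ?t *\<^sub>R v) - F x\<bar> * real (Suc n) \<le> B" by (simp add: field_simps)
    then show ?thesis using True by (simp add: q_def abs_mult)
  next
    case False
    have "x + t *\<^sub>R v \<notin> S" if "0 \<le> t" "t \<le> 1" for t
    proof
      assume "x + t *\<^sub>R v \<in> S"
      then have "(t, x + t *\<^sub>R v) \<in> {0..1} \<times> S" using that by simp
      then have "(\<lambda>(t, x). x - t *\<^sub>R v) (t, x + t *\<^sub>R v) \<in> T" unfolding T_def by (rule imageI)
      then show False using False by simp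
    qed
    from this[of 0] this[of "1 / real (Suc n)"] have "q n x = 0" by (simp add: q_def supp)
    then show ?thesis using B by simp
  qed
  have qlim: "(\<lambda>n. q n x) \<longlonglongrightarrow> F' x v" for x
  proof -
    have "((\<lambda>s. F (x + s *\<^sub>R v)) has_derivative (\<lambda>h. F' x (h *\<^sub>R v))) (at 0)"
      by (rule has_derivative_compose[of "\<lambda>s. x + s *\<^sub>R v" _ 0 UNIV F]) (use F'[of x] in \<open>auto intro!: derivative_eq_intros\<close>)
    moreover have "(\<lambda>h. F' x (h *\<^sub>R v)) = (*) (F' x v)"
      using has_derivative_linear[OF F'[of x]] by (auto simp: linear_scale)
    ultimately have "((\<lambda>s. F (x + s *\<^sub>R v)) has_real_derivative F' x v) (at 0)"
      by (simp add: has_field_derivative_def)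
    then have "(\<lambda>h. (F (x + h *\<^sub>R v) - F x) / h) \<midarrow>0\<rightarrow> F' x v" by (simp add: DERIV_def)
    then have "(\<lambda>n. (F (x + (1 / real (Suc n)) *\<^sub>R v) - F x) / (1 / real (Suc n))) \<longlonglongrightarrow> F' x v"
    proof (rule filterlim_compose)
      show "filterlim (\<lambda>n. 1 / real (Suc n)) (at 0) sequentially"
        unfolding filterlim_at using LIMSEQ_inverse_real_of_nat by (simp add: inverse_eq_divide)
    qed
    then show ?thesis by (simp add: q_def)
  qed
  have "(\<lambda>n. \<integral>x. q n x \<partial>lborel) \<longlonglongrightarrow> (\<integral>x. F' x v \<partial>lborel)"
  proof (rule integral_dominated_convergence[where w = "\<lambda>x. indicator T x * B"])
    show "(\<lambda>x. F' x v) \<in> borel_measurable lborel" using borel_measurable_continuous_onI[OF cont] by simp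
    show "q n \<in> borel_measurable lborel" for n
      unfolding q_def using contF by (auto intro!: borel_measurable_continuous_onI continuous_intros continuous_on_compose2[OF contF])
    show "integrable lborel (\<lambda>x. indicator T x * B)"
      using borel_integrable_compact[OF T, of "\<lambda>_. B"] by simp
  qed (use qlim qbound in auto)
  then show ?thesis unfolding q0 by (simp add: LIMSEQ_const_iff)
qed


section \<open>The mean curvature vector is normal\<close>

lemma bounded_bilinear_cross3: "bounded_bilinear cross3"
  using bilinear_cross by (simp add: bilinear_conv_bounded_bilinear)

lemmas has_derivative_cross3 = bounded_bilinear.FDERIV[OF bounded_bilinear_cross3]

context C1_patch
begin

text \<open>The field \<open>X \<circ> \<phi>\<close> has compact support in \<open>U\<close>, so the derivative of its product with
  a field on \<open>U\<close> has integral zero.\<close>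

lemma integral_by_parts:
  fixes X :: "real^3 \<Rightarrow> real^3" and X' :: "real^3 \<Rightarrow> (real^3) \<Rightarrow>\<^sub>L (real^3)"
  assumes X: "\<And>x. (X has_derivative blinfun_apply (X' x)) (at x)" and contX': "continuous_on UNIV X'"
    and K: "compact K" "\<And>x. x \<notin> K \<Longrightarrow> X x = 0" "compact (K \<inter> \<phi> ` U)"
    and P: "\<And>u. u \<in> U \<Longrightarrow> (P has_derivative dP u) (at u)" and contdP: "continuous_on U (\<lambda>u. dP u v)"
  shows "integrable lborel (\<lambda>u. indicator U u * (X' (\<phi> u) (frame_map (a u) (b u) v) \<bullet> P u))"
    and "integrable lborel (\<lambda>u. indicator U u * (X (\<phi> u) \<bullet> dP u v))"
    and "(\<integral>u. indicator U u * (X' (\<phi> u) (frame_map (a u) (b u) v) \<bullet> P u) \<partial>lborel)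
      = - (\<integral>u. indicator U u * (X (\<phi> u) \<bullet> dP u v) \<partial>lborel)"
proof -
  define C where "C = \<psi> ` (K \<inter> \<phi> ` U)"
  have C: "compact C" unfolding C_def
    using K(3) by (intro compact_continuous_image continuous_on_subset[OF cont_psi]) auto
  have CU: "C \<subseteq> U" unfolding C_def by auto
  have notK: "\<phi> u \<notin> K" if "u \<in> U" "u \<notin> C" for u
    using that psi_phi[OF that(1)] unfolding C_def by (metis IntI imageI)
  have contX: "continuous_on UNIV X"
    using X by (intro continuous_at_imp_continuous_on ballI) (rule has_derivative_continuous)
  have X'0: "X' x = 0" if "x \<notin> K" for x
    by (intro blinfun_eqI) (simp add: derivative_zero_outside_support[OF K(1,2) that X])
  let ?f = "\<lambda>u. X' (\<phi> u) (frame_map (a u) (b u) v) \<bullet> P u"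
  let ?g = "\<lambda>u. X (\<phi> u) \<bullet> dP u v"
  have contP: "continuous_on U P"
    using P by (intro continuous_at_imp_continuous_on ballI) (rule has_derivative_continuous)
  have contXphi: "continuous_on U (\<lambda>u. X (\<phi> u))"
    by (rule continuous_on_compose2[OF contX cont_phi]) simp
  have contX'phi: "continuous_on U (\<lambda>u. X' (\<phi> u))"
    by (rule continuous_on_compose2[OF contX' cont_phi]) simp
  have contf: "continuous_on U ?f"
    unfolding frame_map_def by (intro continuous_intros contX'phi contP cont_a cont_b)
  have contg: "continuous_on U ?g" by (intro continuous_intros contXphi contdP)
  have ind: "(\<lambda>u. indicator U u * h u) = (\<lambda>u. indicator C u *\<^sub>R h u)" if "\<And>u. u \<in> U \<Longrightarrow> u \<notin> C \<Longrightarrow> h u = 0" for h :: "real^2 \<Rightarrow> real"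
    using that CU by (auto simp: indicator_def fun_eq_iff)
  have f0: "?f u = 0" if "u \<in> U" "u \<notin> C" for u using X'0[OF notK[OF that]] by simp
  have g0: "?g u = 0" if "u \<in> U" "u \<notin> C" for u using K(2)[OF notK[OF that]] by simp
  show intf: "integrable lborel (\<lambda>u. indicator U u * ?f u)"
    using borel_integrable_compact[OF C continuous_on_subset[OF contf CU]] ind[of ?f] f0 by simp
  show intg: "integrable lborel (\<lambda>u. indicator U u * ?g u)"
    using borel_integrable_compact[OF C continuous_on_subset[OF contg CU]] ind[of ?g] g0 by simp
  define F where "F u = indicator U u * (X (\<phi> u) \<bullet> P u)" for u
  define F' where "F' u h = indicator U u * (X (\<phi> u) \<bullet> dP u h + X' (\<phi> u) (frame_map (a u) (b u) h) \<bullet> P u)" for u h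
  have F0: "F u = 0" if "u \<notin> C" for u
    using that K(2)[OF notK] by (cases "u \<in> U") (auto simp: F_def)
  have derF: "(F has_derivative F' u) (at u)" for u
  proof (cases "u \<in> U")
    case True
    have "((\<lambda>u. X (\<phi> u)) has_derivative (\<lambda>h. X' (\<phi> u) (frame_map (a u) (b u) h))) (at u)"
      by (rule has_derivative_compose[OF deriv[OF True] X])
    then have "((\<lambda>u. X (\<phi> u) \<bullet> P u) has_derivative (\<lambda>h. X (\<phi> u) \<bullet> dP u h + X' (\<phi> u) (frame_map (a u) (b u) h) \<bullet> P u)) (at u)"
      using P[OF True] by (rule has_derivative_inner)
    then have "(F has_derivative (\<lambda>h. X (\<phi> u) \<bullet> dP u h + X' (\<phi> u) (frame_map (a u) (b u) h) \<bullet> P u)) (at u)"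
      by (rule has_derivative_transform_within_open[OF _ open_U True]) (simp add: F_def)
    then show ?thesis using True by (simp add: F'_def[abs_def])
  next
    case False
    have "(F has_derivative (\<lambda>h. 0)) (at u)"
      by (rule has_derivative_transform_within_open[of "\<lambda>x. 0" _ _ _ "- C"])
        (use C CU False F0 in \<open>auto simp: compact_imp_closed open_Compl\<close>)
    then show ?thesis using False by (simp add: F'_def[abs_def])
  qed
  have "continuous_on (U \<union> - C) (\<lambda>u. F' u v)"
  proof (rule continuous_on_open_Un[OF open_U])
    show "open (- C)" using C by (simp add: compact_imp_closed open_Compl)
    show "continuous_on U (\<lambda>u. F' u v)"
      by (rule continuous_on_eq[of _ "\<lambda>u. ?g u + ?f u"]) (auto simp: F'_def intro!: continuous_on_add contf contg)
    show "continuous_on (- C) (\<lambda>u. F' u v)"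
    proof (rule continuous_on_eq[of _ "\<lambda>u. 0"])
      show "0 = F' u v" if "u \<in> - C" for u
        using that f0[of u] g0[of u] by (cases "u \<in> U") (auto simp: F'_def)
    qed simp
  qed
  moreover have "U \<union> - C = UNIV" using CU by auto
  ultimately have "(\<integral>u. F' u v \<partial>lborel) = 0"
    using integral_directional_derivative_zero[OF C F0 derF, of v] by simp
  moreover have "(\<integral>u. F' u v \<partial>lborel) = (\<integral>u. indicator U u * ?g u + indicator U u * ?f u \<partial>lborel)"
    unfolding F'_def by (simp add: distrib_left)
  moreover have "\<dots> = (\<integral>u. indicator U u * ?g u \<partial>lborel) + (\<integral>u. indicator U u * ?f u \<partial>lborel)"
    by (rule Bochner_Integration.integral_add[OF intg intf])
  ultimately show "(\<integral>u. indicator U u * ?f u \<partial>lborel) = - (\<integral>u. indicator U u * ?g u \<partial>lborel)" by simp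
qed

end

definition plane_divergence :: "(real^3 \<Rightarrow> real^3) \<Rightarrow> (real^3) \<times> (real^3^3) \<Rightarrow> real" where
  "plane_divergence X = (\<lambda>(x, P). trace (P ** matrix (frechet_derivative X (at x))))"

lemma first_variation_eq: "first_variation V X = (\<integral>z. plane_divergence X z \<partial>V)"
  by (simp add: first_variation_def plane_divergence_def)

lemma
  fixes X' :: "real^3 \<Rightarrow> (real^3) \<Rightarrow>\<^sub>L (real^3)"
  assumes X: "\<And>x. (X has_derivative blinfun_apply (X' x)) (at x)"
  shows plane_divergence_eq: "plane_divergence X (x, P) = trace (P ** matrix (blinfun_apply (X' x)))"
    and continuous_plane_divergence: "continuous_on UNIV X' \<Longrightarrow> continuous_on S (plane_divergence X)"
    and plane_divergence_outside_support:
      "compact K \<Longrightarrow> (\<And>x. x \<notin> K \<Longrightarrow> X x = 0) \<Longrightarrow> x \<notin> K \<Longrightarrow> plane_divergence X (x, P) = 0"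
proof -
  have fr: "frechet_derivative X (at x) = blinfun_apply (X' x)" for x
    using frechet_derivative_at[OF X] by simp
  show eq: "plane_divergence X (x, P) = trace (P ** matrix (blinfun_apply (X' x)))" for x P
    by (simp add: plane_divergence_def fr)
  have sum: "plane_divergence X = (\<lambda>z. \<Sum>i\<in>UNIV. \<Sum>j\<in>UNIV. (snd z)$i$j * (X' (fst z) (axis i 1))$j)"
    by (auto simp: eq trace_def matrix_matrix_mult_def matrix_def intro!: ext)
  show "continuous_on S (plane_divergence X)" if "continuous_on UNIV X'"
    unfolding sum by (intro continuous_intros continuous_on_compose2[OF that continuous_on_fst]) auto
  show "plane_divergence X (x, P) = 0" if "compact K" "\<And>x. x \<notin> K \<Longrightarrow> X x = 0" "x \<notin> K"
    by (simp add: sum derivative_zero_outside_support[OF that X])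
qed

context C2_patch
begin

text \<open>The differentials of \<open>N = cross3 a b\<close> and of the unit normal \<open>n = N / \<bar>N\<bar>\<close>; the latter is the part of
  \<open>dN / \<bar>N\<bar>\<close> orthogonal to \<open>n\<close>.\<close>

definition dcross :: "real^2 \<Rightarrow> real^2 \<Rightarrow> real^3" where
  "dcross u v = cross3 (a u) (db u v) + cross3 (da u v) (b u)"

definition dnormal :: "real^2 \<Rightarrow> real^2 \<Rightarrow> real^3" where
  "dnormal u v = (1 / jac u) *\<^sub>R dcross u v - ((unit_normal u \<bullet> dcross u v) / jac u) *\<^sub>R unit_normal u"

lemma deriv_cross: "u \<in> U \<Longrightarrow> ((\<lambda>u. cross3 (a u) (b u)) has_derivative dcross u) (at u)"
  unfolding dcross_def[abs_def] by (intro has_derivative_cross3 deriv_a deriv_b)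

lemma deriv_unit_normal:
  assumes u: "u \<in> U"
  shows "(unit_normal has_derivative dnormal u) (at u)"
proof -
  let ?N = "\<lambda>u. cross3 (a u) (b u)"
  have J: "jac u > 0" by (rule jac_pos[OF u])
  have nu: "sgn (?N u) = unit_normal u" by (simp add: sgn_div_norm unit_normal_def jac_def inverse_eq_divide)
  have "(jac has_derivative (\<lambda>h. dcross u h \<bullet> unit_normal u)) (at u)"
    unfolding jac_def[abs_def] nu[symmetric]
    by (rule has_derivative_compose[OF deriv_cross[OF u] has_derivative_norm[OF immersed[OF u]]])
  then have "((\<lambda>u. inverse (jac u)) has_derivative (\<lambda>h. - (inverse (jac u) * (dcross u h \<bullet> unit_normal u) * inverse (jac u)))) (at u)"
    using J by (intro Deriv.has_derivative_inverse) auto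
  from has_derivative_scaleR[OF this deriv_cross[OF u]]
  have "((\<lambda>u. inverse (jac u) *\<^sub>R ?N u) has_derivative
     (\<lambda>h. inverse (jac u) *\<^sub>R dcross u h + (- (inverse (jac u) * (dcross u h \<bullet> unit_normal u) * inverse (jac u))) *\<^sub>R ?N u)) (at u)" .
  moreover have "(\<lambda>u. inverse (jac u) *\<^sub>R ?N u) = unit_normal"
    by (auto simp: unit_normal_def inverse_eq_divide)
  moreover have "inverse (jac u) *\<^sub>R dcross u h + (- (inverse (jac u) * (dcross u h \<bullet> unit_normal u) * inverse (jac u))) *\<^sub>R ?N u = dnormal u h" for h
    by (simp add: dnormal_def unit_normal_def divide_inverse inner_commute mult_ac)
  ultimately show ?thesis by simp
qed

lemma normal_dnormal: "u \<in> U \<Longrightarrow> unit_normal u \<bullet> dnormal u v = 0"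
  using norm_unit_normal[of u] by (simp add: dnormal_def inner_diff_right norm_eq_1)

lemma cont_dnormal: "continuous_on U (\<lambda>u. dnormal u v)"
proof -
  have "continuous_on U (\<lambda>u. dcross u v)"
    unfolding dcross_def by (intro continuous_intros continuous_on_cross cont_a cont_b cont_da cont_db)
  then show ?thesis
    unfolding dnormal_def using jac_pos
    by (intro continuous_intros cont_jac cont_unit_normal) force+
qed

text \<open>The mean curvature vector times the area density. It is a multiple of the normal, because
  the derivatives of the unit normal are tangential.\<close>

definition curv :: "real^2 \<Rightarrow> real^3" where
  "curv u = cross3 (b u) (dnormal u (axis 1 1)) + cross3 (dnormal u (axis 2 1)) (a u)"

lemma cont_curv: "continuous_on U curv"
  unfolding curv_def[abs_def] by (intro continuous_intros continuous_on_cross cont_a cont_b cont_dnormal)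

lemma normal_projection_curv:
  assumes u: "u \<in> U"
  shows "normal_projection (unit_normal u) *v curv u = 0"
proof -
  let ?n = "unit_normal u"
  have n: "?n \<bullet> a u = 0" "?n \<bullet> b u = 0" by (simp_all add: unit_normal_def dot_cross_self)
  have "cross3 ?n (curv u) = 0"
    unfolding curv_def cross_add_right Lagrange by (simp add: n normal_dnormal[OF u])
  then have "cross3 ?n (cross3 ?n (curv u)) = 0" by simp
  moreover have "?n \<bullet> ?n = 1" using norm_unit_normal[OF u] by (simp add: norm_eq_1)
  ultimately have "(?n \<bullet> curv u) *\<^sub>R ?n - curv u = 0" unfolding Lagrange by simp
  then show ?thesis by (simp add: normal_projection_mult inner_commute)
qed

text \<open>Where \<open>X\<close> does not vanish the surface is the patch. By the area formula the first variation is the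
  integral over \<open>U\<close> of the tangential divergence times the area density, which is
  \<open>\<partial>\<^sub>1(X \<circ> \<phi>) \<bullet> cross3 b n + \<partial>\<^sub>2(X \<circ> \<phi>) \<bullet> cross3 n a\<close>. After integration by parts the second derivatives of
  \<open>\<phi>\<close> occur only in \<open>cross3 (\<partial>\<^sub>1 b) n + cross3 n (\<partial>\<^sub>2 a)\<close>, and this is zero because the mixed partial
  derivatives agree.\<close>

lemma first_variation_patch:
  fixes X :: "real^3 \<Rightarrow> real^3" and X' :: "real^3 \<Rightarrow> (real^3) \<Rightarrow>\<^sub>L (real^3)"
  assumes M: "compact M" "C2_surface M" "openin (top_of_set M) (\<phi> ` U)"
    and X: "\<And>x. (X has_derivative blinfun_apply (X' x)) (at x)" and contX': "continuous_on UNIV X'"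
    and K: "compact K" "\<And>x. x \<notin> K \<Longrightarrow> X x = 0" "K \<inter> M \<subseteq> \<phi> ` U"
  shows "first_variation (induced_varifold M) X = - planar_factor * (\<integral>u. indicator U u * (X (\<phi> u) \<bullet> curv u) \<partial>lborel)"
proof -
  have UM: "\<phi> ` U \<subseteq> M" using M(3) openin_imp_subset by blast
  then have "K \<inter> \<phi> ` U = K \<inter> M" using K(3) by auto
  then have KU: "compact (K \<inter> \<phi> ` U)" using K(1) M(1) by (simp add: compact_Int)
  have fm: "plane_divergence X \<in> borel_measurable borel"
    by (rule borel_measurable_continuous_onI[OF continuous_plane_divergence[OF X contX']])
  let ?T = "\<lambda>x. plane_projection (tangent_space M x)"
  define h where "h x = plane_divergence X (x, ?T x)" for x
  let ?f1 = "\<lambda>u. X' (\<phi> u) (frame_map (a u) (b u) (axis 1 1)) \<bullet> cross3 (b u) (unit_normal u)"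
  let ?f2 = "\<lambda>u. X' (\<phi> u) (frame_map (a u) (b u) (axis 2 1)) \<bullet> cross3 (unit_normal u) (a u)"
  have axes: "frame_map (a u) (b u) (axis 1 1) = a u" "frame_map (a u) (b u) (axis 2 1) = b u" for u
    by (simp_all add: frame_map_def axis_def)
  have jh: "jac u * h (\<phi> u) = ?f1 u + ?f2 u" if u: "u \<in> U" for u
  proof -
    have lin: "linear (blinfun_apply (X' (\<phi> u)))" by (rule bounded_linear.linear[OF blinfun.bounded_linear_right])
    have "jac u * h (\<phi> u) = jac u * trace (normal_projection (unit_normal u) ** matrix (blinfun_apply (X' (\<phi> u))))"
      by (simp add: h_def plane_divergence_eq[OF X] plane_projection_patch[OF M(3) u])
    also have "\<dots> = ?f1 u + ?f2 u"
      unfolding axes jac_def unit_normal_def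
      using trace_normal_projection_frame[OF immersed[OF u], of "matrix (blinfun_apply (X' (\<phi> u)))"]
      by (simp add: matrix_vector_mul(2)[OF lin, THEN fun_cong])
    finally show ?thesis .
  qed
  have "first_variation (induced_varifold M) X = (\<integral>x. indicator M x * h x \<partial>hausdorff2)"
    unfolding h_def first_variation_eq by (rule integral_induced_varifold[OF M(2,1) fm])
  also have "\<dots> = (\<integral>x. indicator (\<phi> ` U) x * h x \<partial>hausdorff2)"
  proof (rule Bochner_Integration.integral_cong[OF refl])
    fix x
    have "h x = 0" if "x \<in> M" "x \<notin> \<phi> ` U"
      unfolding h_def
      by (rule plane_divergence_outside_support[OF X K(1,2)]) (use that K(3) in auto)
    then show "indicator M x * h x = indicator (\<phi> ` U) x * h x" using UM by (auto simp: indicator_def)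
  qed
  also have "\<dots> = planar_factor * (\<integral>u. indicator U u * (jac u * h (\<phi> u)) \<partial>lborel)"
  proof (rule integral_patch)
    have contX'phi: "continuous_on U (\<lambda>u. X' (\<phi> u))"
      by (rule continuous_on_compose2[OF contX' cont_phi]) simp
    have "(\<lambda>u. indicator U u *\<^sub>R ((?f1 u + ?f2 u) / jac u)) \<in> borel_measurable borel"
      using open_U jac_pos unfolding axes
      by (intro borel_measurable_continuous_on_indicator continuous_intros contX'phi continuous_on_cross cont_a cont_b cont_unit_normal cont_jac) force+
    moreover have "indicator U u *\<^sub>R ((?f1 u + ?f2 u) / jac u) = indicator U u * h (\<phi> u)" for u
    proof (cases "u \<in> U")
      case True
      then show ?thesis using jh[OF True, symmetric] jac_pos[OF True] by simp
    qed simp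
    ultimately show "(\<lambda>u. indicator U u * h (\<phi> u)) \<in> borel_measurable borel" by simp
  qed
  also have "(\<integral>u. indicator U u * (jac u * h (\<phi> u)) \<partial>lborel) = (\<integral>u. indicator U u * ?f1 u + indicator U u * ?f2 u \<partial>lborel)"
  proof (rule Bochner_Integration.integral_cong[OF refl])
    show "indicator U u * (jac u * h (\<phi> u)) = indicator U u * ?f1 u + indicator U u * ?f2 u" for u
      using jh[of u] by (cases "u \<in> U") auto
  qed
  also have "\<dots> = - (\<integral>u. indicator U u * (X (\<phi> u) \<bullet> curv u) \<partial>lborel)"
  proof -
    define dP where "dP u h = cross3 (b u) (dnormal u h) + cross3 (db u h) (unit_normal u)" for u h
    define dQ where "dQ u h = cross3 (unit_normal u) (da u h) + cross3 (dnormal u h) (a u)" for u h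
    have P: "((\<lambda>u. cross3 (b u) (unit_normal u)) has_derivative dP u) (at u)" if "u \<in> U" for u
      unfolding dP_def[abs_def] by (intro has_derivative_cross3 deriv_b deriv_unit_normal that)
    have Q: "((\<lambda>u. cross3 (unit_normal u) (a u)) has_derivative dQ u) (at u)" if "u \<in> U" for u
      unfolding dQ_def[abs_def] by (intro has_derivative_cross3 deriv_a deriv_unit_normal that)
    have contP: "continuous_on U (\<lambda>u. dP u v)" and contQ: "continuous_on U (\<lambda>u. dQ u v)" for v
      unfolding dP_def dQ_def
      by (intro continuous_intros continuous_on_cross cont_a cont_b cont_da cont_db cont_dnormal cont_unit_normal)+
    note ibp1 = integral_by_parts[OF X contX' K(1,2) KU P contP, of "axis 1 1"]
    note ibp2 = integral_by_parts[OF X contX' K(1,2) KU Q contQ, of "axis 2 1"]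
    have "(\<integral>u. indicator U u * ?f1 u + indicator U u * ?f2 u \<partial>lborel)
       = (\<integral>u. indicator U u * ?f1 u \<partial>lborel) + (\<integral>u. indicator U u * ?f2 u \<partial>lborel)"
      by (rule Bochner_Integration.integral_add[OF ibp1(1) ibp2(1)])
    also have "\<dots> = - ((\<integral>u. indicator U u * (X (\<phi> u) \<bullet> dP u (axis 1 1)) \<partial>lborel) + (\<integral>u. indicator U u * (X (\<phi> u) \<bullet> dQ u (axis 2 1)) \<partial>lborel))"
      using ibp1(3) ibp2(3) by linarith
    also have "\<dots> = - (\<integral>u. indicator U u * (X (\<phi> u) \<bullet> dP u (axis 1 1)) + indicator U u * (X (\<phi> u) \<bullet> dQ u (axis 2 1)) \<partial>lborel)"
      using Bochner_Integration.integral_add[OF ibp1(2) ibp2(2)] by simp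
    also have "\<dots> = - (\<integral>u. indicator U u * (X (\<phi> u) \<bullet> curv u) \<partial>lborel)"
    proof -
      have "indicator U u * (X (\<phi> u) \<bullet> dP u (axis 1 1)) + indicator U u * (X (\<phi> u) \<bullet> dQ u (axis 2 1)) = indicator U u * (X (\<phi> u) \<bullet> curv u)" for u
      proof (cases "u \<in> U")
        case True
        have "cross3 (unit_normal u) (da u (axis 2 1)) = - cross3 (db u (axis 1 1)) (unit_normal u)"
          unfolding mixed[OF True] by (rule cross_skew)
        then have "dP u (axis 1 1) + dQ u (axis 2 1) = curv u" by (simp add: dP_def dQ_def curv_def)
        then show ?thesis using True by (simp add: inner_add_right[symmetric])
      qed simp
      then show ?thesis by simp
    qed
    finally show ?thesis .
  qed
  finally show ?thesis by simp
qed

end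

lemma C1_test_times_vector:
  fixes e :: "real^3"
  assumes "C1_test W g"
  obtains X' K where "\<And>x. ((\<lambda>x. g x *\<^sub>R e) has_derivative blinfun_apply (X' x)) (at x)" "continuous_on UNIV X'"
    "compact K" "K \<subseteq> W" "\<And>x. x \<notin> K \<Longrightarrow> g x = 0"
proof -
  obtain G K where G: "\<And>x. (g has_derivative (\<lambda>h. h \<bullet> G x)) (at x)" "continuous_on UNIV G"
    and K: "compact K" "K \<subseteq> W" "\<And>x. x \<notin> K \<Longrightarrow> g x = 0"
    using assms unfolding C1_test_def by blast
  define X' where "X' x = Blinfun (\<lambda>h. (h \<bullet> G x) *\<^sub>R e)" for x
  have app: "blinfun_apply (X' x) = (\<lambda>h. (h \<bullet> G x) *\<^sub>R e)" for x
    unfolding X'_def by (rule bounded_linear_Blinfun_apply) (intro bounded_linear_intros)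
  show ?thesis
  proof (rule that[of X' K])
    show "((\<lambda>x. g x *\<^sub>R e) has_derivative blinfun_apply (X' x)) (at x)" for x
      unfolding app by (rule has_derivative_scaleR_left[OF G(1)])
    show "continuous_on UNIV X'"
      by (rule continuous_on_blinfun_componentwise) (auto simp: app intro!: continuous_intros G(2))
  qed (use K in auto)
qed

lemma C1_compactly_supported_test:
  fixes e :: "real^3"
  assumes "C1_test W g" shows "C1_compactly_supported (\<lambda>x. g x *\<^sub>R e)"
proof -
  obtain X' K where "\<And>x. ((\<lambda>x. g x *\<^sub>R e) has_derivative blinfun_apply (X' x)) (at x)" "continuous_on UNIV X'"
    "compact K" "\<And>x. x \<notin> K \<Longrightarrow> g x = 0"
    using C1_test_times_vector[OF assms] by metis
  then show ?thesis unfolding C1_compactly_supported_def by (metis scaleR_zero_left)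
qed

lemma integral_surface_measure:
  fixes f :: "real^3 \<Rightarrow> real"
  assumes "M \<in> sets borel" "f \<in> borel_measurable borel"
  shows "(\<integral>x. f x \<partial>surface_measure M) = (\<integral>x. indicator M x * f x \<partial>hausdorff2)"
proof -
  have "surface_measure M = density hausdorff2 (\<lambda>x. ennreal (indicator M x))"
    unfolding surface_measure_def by (simp add: ennreal_indicator)
  then show ?thesis using assms by (simp add: integral_density)
qed

lemma finite_surface_measure:
  assumes "M \<in> sets borel" "emeasure hausdorff2 M < \<infinity>"
  shows "finite_measure (surface_measure M)"
  by (rule finite_measureI) (use assms in \<open>simp add: emeasure_surface_measure\<close>)

lemma AE_surface_measure_in:
  assumes "M \<in> sets borel" shows "AE x in surface_measure M. x \<in> M"
  unfolding surface_measure_def using assms by (subst AE_density) (auto simp: indicator_def)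

lemma integrable_inner_of_squares:
  fixes f g :: "'a \<Rightarrow> 'b::{real_inner, second_countable_topology}"
  assumes "integrable m (\<lambda>x. (norm (f x))\<^sup>2)" "integrable m (\<lambda>x. (norm (g x))\<^sup>2)"
    and "(\<lambda>x. f x \<bullet> g x) \<in> borel_measurable m"
  shows "integrable m (\<lambda>x. f x \<bullet> g x)"
proof (rule Bochner_Integration.integrable_bound[OF Bochner_Integration.integrable_add[OF assms(1,2)] assms(3)])
  show "AE x in m. norm (f x \<bullet> g x) \<le> norm ((norm (f x))\<^sup>2 + (norm (g x))\<^sup>2)"
  proof (rule AE_I2)
    fix x
    have "\<bar>f x \<bullet> g x\<bar> \<le> norm (f x) * norm (g x)" by (rule Cauchy_Schwarz_ineq2)
    moreover have "0 \<le> norm (f x) * norm (g x)" by simp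
    ultimately show "norm (f x \<bullet> g x) \<le> norm ((norm (f x))\<^sup>2 + (norm (g x))\<^sup>2)"
      using sum_squares_bound[of "norm (f x)" "norm (g x)"] by simp
  qed
qed

lemma integrable_continuous_compact_support:
  fixes f :: "'a::euclidean_space \<Rightarrow> real"
  assumes sets: "sets m = sets borel" and f: "continuous_on UNIV f"
    and K: "compact K" "\<And>x. x \<notin> K \<Longrightarrow> f x = 0" "emeasure m K < \<infinity>"
  shows "integrable m f"
proof -
  obtain B where B: "0 \<le> B" "\<forall>x\<in>K. norm (f x) \<le> B"
    using compact_continuous_bound[OF K(1) continuous_on_subset[OF f]] by blast
  have "integrable m (\<lambda>x. B * indicator K x)"
    using K sets by (intro integrable_mult_right integrable_real_indicator) (auto simp: borel_compact)
  then show ?thesis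
  proof (rule Bochner_Integration.integrable_bound)
    show "f \<in> borel_measurable m"
      using borel_measurable_continuous_onI[OF f] by (simp add: measurable_cong_sets[OF sets refl])
    show "AE x in m. norm (f x) \<le> norm (B * indicator K x)"
    proof (rule AE_I2)
      show "norm (f x) \<le> norm (B * indicator K x)" for x using B K(2) by (cases "x \<in> K") auto
    qed
  qed
qed

lemma integrable_mult_bounded_on:
  fixes f g :: "'a \<Rightarrow> real"
  assumes "integrable m (\<lambda>x. indicator K x * f x)" "(\<lambda>x. g x * f x) \<in> borel_measurable m"
    and "\<And>x. x \<notin> K \<Longrightarrow> g x = 0" "\<And>x. \<bar>g x\<bar> \<le> B"
  shows "integrable m (\<lambda>x. g x * f x)"
proof (rule Bochner_Integration.integrable_bound[of _ "\<lambda>x. B * (indicator K x * f x)"])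
  show "integrable m (\<lambda>x. B * (indicator K x * f x))" using assms(1) by simp
  show "AE x in m. norm (g x * f x) \<le> norm (B * (indicator K x * f x))"
  proof (rule AE_I2)
    fix x
    have "\<bar>g x\<bar> \<le> \<bar>B\<bar>" using assms(4)[of x] by linarith
    then show "norm (g x * f x) \<le> norm (B * (indicator K x * f x))"
      using assms(3)[of x] by (cases "x \<in> K") (auto simp: abs_mult mult_right_mono)
  qed
qed (rule assms(2))

context C2_patch
begin

text \<open>In the patch the generalised mean curvature is the classical one, because both represent
  the first variation on fields supported near the patch.\<close>

lemma mean_curvature_normal_patch:
  assumes M: "compact M" "C2_surface M" "openin (top_of_set M) (\<phi> ` U)"
    and fin: "emeasure hausdorff2 M < \<infinity>"
    and H: "generalised_mean_curvature (induced_varifold M) H"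
  shows "AE x in surface_measure M. x \<in> \<phi> ` U \<longrightarrow> plane_projection (tangent_space M x) *v H x = 0"
proof -
  have Mb: "M \<in> sets borel" using M(1) by (rule borel_compact)
  interpret finite_measure "surface_measure M" using finite_surface_measure[OF Mb fin] .
  obtain W where W: "open W" "\<phi> ` U = M \<inter> W" using M(3) by (auto simp: openin_open)
  have mass: "mass_measure (induced_varifold M) = surface_measure M"
    by (rule mass_measure_induced_varifold[OF M(2,1)])
  have Hm: "H \<in> borel_measurable borel"
    and Hint: "\<And>K. compact K \<Longrightarrow> set_integrable (surface_measure M) K H"
    and Hfv: "\<And>X. C1_compactly_supported X \<Longrightarrow> first_variation (induced_varifold M) X = - (\<integral>x. H x \<bullet> X x \<partial>surface_measure M)"
    using H unfolding generalised_mean_curvature_def mass by auto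
  define Hc where "Hc y = indicator (\<phi> ` U) y *\<^sub>R ((1 / jac (\<psi> y)) *\<^sub>R curv (\<psi> y))" for y
  have cont: "continuous_on (\<phi> ` U) (\<lambda>y. (1 / jac (\<psi> y)) *\<^sub>R curv (\<psi> y))"
  proof -
    have j: "continuous_on (\<phi> ` U) (\<lambda>y. jac (\<psi> y))" by (rule continuous_on_compose2[OF cont_jac cont_psi]) auto
    have c: "continuous_on (\<phi> ` U) (\<lambda>y. curv (\<psi> y))" by (rule continuous_on_compose2[OF cont_curv cont_psi]) auto
    have "jac (\<psi> y) \<noteq> 0" if "y \<in> \<phi> ` U" for y using that jac_pos by force
    then show ?thesis by (intro continuous_intros j c) auto
  qed
  have Hcm: "Hc \<in> borel_measurable borel"
    unfolding Hc_def using cont sets_image by (intro borel_measurable_continuous_on_indicator) auto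
  have AEi: "AE x in surface_measure M. x \<in> W \<longrightarrow> (H x - Hc x) \<bullet> axis i 1 = 0" for i :: 3
  proof (rule AE_zero_of_orthogonal_to_tests[OF sets_surface_measure _ W(1)])
    let ?e = "axis i 1 :: real^3"
    show fm: "(\<lambda>x. (H x - Hc x) \<bullet> ?e) \<in> borel_measurable borel"
      using Hm Hcm by measurable
    have intH: "integrable (surface_measure M) (\<lambda>x. indicator K x * (H x \<bullet> ?e))" if "compact K" for K
    proof -
      have "integrable (surface_measure M) (\<lambda>x. (indicator K x *\<^sub>R H x) \<bullet> ?e)"
        using Hint[OF that] unfolding set_integrable_def by (rule integrable_inner_left)
      then show ?thesis by simp
    qed
    have intHc: "integrable (surface_measure M) (\<lambda>x. indicator K x * (Hc x \<bullet> ?e))" if K: "compact K" "K \<subseteq> W" for K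
    proof -
      have KM: "K \<inter> M \<subseteq> \<phi> ` U" using K W by auto
      have "continuous_on (K \<inter> M) Hc"
        by (rule continuous_on_eq[OF continuous_on_subset[OF cont KM]]) (use KM in \<open>auto simp: Hc_def\<close>)
      then obtain B where B: "0 \<le> B" "\<forall>x\<in>K \<inter> M. norm (Hc x) \<le> B"
        using compact_continuous_bound[OF compact_Int[OF K(1) M(1)]] by blast
      show ?thesis
      proof (rule integrable_const_bound[of _ B])
        show "AE x in surface_measure M. norm (indicator K x * (Hc x \<bullet> ?e)) \<le> B"
        proof (rule AE_I2)
          fix x
          show "norm (indicator K x * (Hc x \<bullet> ?e)) \<le> B"
          proof (cases "x \<in> K \<inter> M")
            case True
            have "\<bar>Hc x \<bullet> ?e\<bar> \<le> norm (Hc x) * norm ?e" by (rule Cauchy_Schwarz_ineq2)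
            then show ?thesis using True B(2)[rule_format, OF True] by simp
          next
            case False
            then have "indicator K x * (Hc x \<bullet> ?e) = 0" using W(2) by (auto simp: Hc_def indicator_def)
            then show ?thesis by (simp only: norm_zero B(1))
          qed
        qed
        have "K \<in> sets borel" using K(1) by (rule borel_compact)
        then show "(\<lambda>x. indicator K x * (Hc x \<bullet> ?e)) \<in> borel_measurable (surface_measure M)"
          using Hcm by simp
      qed
    qed
    show "integrable (surface_measure M) (\<lambda>x. indicator K x * ((H x - Hc x) \<bullet> ?e))" if "compact K" "K \<subseteq> W" for K
      using Bochner_Integration.integrable_diff[OF intH[OF that(1)] intHc[OF that]]
      by (simp add: inner_diff_left right_diff_distrib)
    fix g assume g: "C1_test W g"
    obtain X' K where X: "\<And>x. ((\<lambda>x. g x *\<^sub>R ?e) has_derivative blinfun_apply (X' x)) (at x)" "continuous_on UNIV X'"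
      and K: "compact K" "K \<subseteq> W" "\<And>x. x \<notin> K \<Longrightarrow> g x = 0"
      using C1_test_times_vector[OF g] by blast
    have gm: "g \<in> borel_measurable borel" using C1_test_continuous[OF g] by (rule borel_measurable_continuous_onI)
    obtain B where "0 \<le> B" "\<forall>x\<in>K. norm (g x) \<le> B"
      using compact_continuous_bound[OF K(1) continuous_on_subset[OF C1_test_continuous[OF g]]] by blast
    then have B: "\<bar>g x\<bar> \<le> B" for x using K(3)[of x] by (cases "x \<in> K") auto
    have mH: "(\<lambda>x. g x * (H x \<bullet> ?e)) \<in> borel_measurable borel" using gm Hm by measurable
    have mHc: "(\<lambda>x. g x * (Hc x \<bullet> ?e)) \<in> borel_measurable borel" using gm Hcm by measurable
    have igH: "integrable (surface_measure M) (\<lambda>x. g x * (H x \<bullet> ?e))"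
      by (rule integrable_mult_bounded_on[OF intH[OF K(1)] _ K(3) B])
        (use mH in simp_all)
    have igHc: "integrable (surface_measure M) (\<lambda>x. g x * (Hc x \<bullet> ?e))"
      by (rule integrable_mult_bounded_on[OF intHc[OF K(1,2)] _ K(3) B])
        (use mHc in simp_all)
    have "(\<integral>x. g x * (H x \<bullet> ?e) \<partial>surface_measure M) = - first_variation (induced_varifold M) (\<lambda>x. g x *\<^sub>R ?e)"
      using Hfv[OF C1_compactly_supported_test[OF g]] by simp
    also have "\<dots> = planar_factor * (\<integral>u. indicator U u * ((g (\<phi> u) *\<^sub>R ?e) \<bullet> curv u) \<partial>lborel)"
      by (subst first_variation_patch[OF M X K(1)]) (use K W in auto)
    also have "\<dots> = planar_factor * (\<integral>u. indicator U u * (jac u * (g (\<phi> u) * (Hc (\<phi> u) \<bullet> ?e))) \<partial>lborel)"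
    proof -
      have "indicator U u * ((g (\<phi> u) *\<^sub>R ?e) \<bullet> curv u) = indicator U u * (jac u * (g (\<phi> u) * (Hc (\<phi> u) \<bullet> ?e)))" for u
        using jac_pos[of u] by (cases "u \<in> U") (auto simp: Hc_def inner_commute)
      then show ?thesis
        by (intro arg_cong[where f = "\<lambda>h. planar_factor * integral\<^sup>L lborel h"] ext)
    qed
    also have "\<dots> = (\<integral>x. indicator (\<phi> ` U) x * (g x * (Hc x \<bullet> ?e)) \<partial>hausdorff2)"
      by (rule integral_patch[symmetric]) (rule phi_indicator_measurable[OF mHc])
    also have "\<dots> = (\<integral>x. indicator M x * (g x * (Hc x \<bullet> ?e)) \<partial>hausdorff2)"
      by (rule Bochner_Integration.integral_cong) (use W(2) in \<open>auto simp: Hc_def indicator_def\<close>)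
    also have "\<dots> = (\<integral>x. g x * (Hc x \<bullet> ?e) \<partial>surface_measure M)"
      by (rule integral_surface_measure[OF Mb mHc, symmetric])
    finally show "(\<integral>x. g x * ((H x - Hc x) \<bullet> ?e) \<partial>surface_measure M) = 0"
      using Bochner_Integration.integral_diff[OF igH igHc] by (simp add: inner_diff_left right_diff_distrib)
  qed
  have "AE x in surface_measure M. \<forall>i. x \<in> W \<longrightarrow> (H x - Hc x) \<bullet> axis i 1 = 0"
    unfolding AE_all_countable using AEi by blast
  then show ?thesis
  proof eventually_elim
    case (elim x)
    show ?case
    proof
      assume x: "x \<in> \<phi> ` U"
      then obtain u where u: "u \<in> U" "x = \<phi> u" by auto
      have "H x = Hc x" using elim x W(2) by (simp add: vec_eq_iff inner_axis)
      also have "\<dots> = (1 / jac u) *\<^sub>R curv u" using u by (simp add: Hc_def)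
      finally show "plane_projection (tangent_space M x) *v H x = 0"
        unfolding u(2) plane_projection_patch[OF M(3) u(1)]
        using normal_projection_curv[OF u(1)] by (simp add: matrix_vector_mult_scaleR)
    qed
  qed
qed

end

text \<open>A generalised mean curvature is only given through its pairing with test fields. That it is
  normal to the surface is what makes the monotonicity argument work with square integrable
  curvature.\<close>

theorem mean_curvature_normal:
  assumes M: "compact M" "C2_surface M" and fin: "emeasure hausdorff2 M < \<infinity>"
    and H: "generalised_mean_curvature (induced_varifold M) H"
  shows "AE x in surface_measure M. plane_projection (tangent_space M x) *v H x = 0"
proof -
  let ?good = "\<lambda>S. AE x in surface_measure M. x \<in> S \<longrightarrow> plane_projection (tangent_space M x) *v H x = 0"
  define \<F> where "\<F> = {S. openin (top_of_set M) S \<and> ?good S}"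
  have "M \<subseteq> \<Union>\<F>"
  proof
    fix p assume "p \<in> M"
    then obtain U \<phi> where par: "local_parametrization M U \<phi>" and p: "p \<in> \<phi> ` U"
      using M(2) unfolding C2_surface_def by blast
    then obtain \<psi> a b da db where "C2_patch U \<phi> \<psi> a b da db" using C2_patch_of_local_parametrization by blast
    then interpret C2_patch U \<phi> \<psi> a b da db .
    have "openin (top_of_set M) (\<phi> ` U)" using par by (simp add: local_parametrization_def)
    then have "\<phi> ` U \<in> \<F>" unfolding \<F>_def using mean_curvature_normal_patch[OF M _ fin H] by blast
    then show "p \<in> \<Union>\<F>" using p by blast
  qed
  moreover obtain \<B> where \<B>: "\<B> \<subseteq> \<F>" "countable \<B>" "\<Union>\<B> = \<Union>\<F>"
    using Lindelof_openin[of \<F> M] unfolding \<F>_def by blast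
  ultimately have cover: "M \<subseteq> \<Union>\<B>" by simp
  have "AE x in surface_measure M. \<forall>S\<in>\<B>. x \<in> S \<longrightarrow> plane_projection (tangent_space M x) *v H x = 0"
    unfolding AE_ball_countable[OF \<B>(2)] using \<B>(1) unfolding \<F>_def by blast
  moreover have "AE x in surface_measure M. x \<in> M"
    using M(1) by (intro AE_surface_measure_in borel_compact)
  ultimately show ?thesis
  proof eventually_elim
    case (elim x)
    then show ?case using cover by blast
  qed
qed


section \<open>Monotonicity and the energy of small balls\<close>

lemma surface_lower_density:
  assumes M: "C2_surface M" "p \<in> M"
  shows "\<exists>s0>0. \<forall>s. 0 < s \<and> s < s0 \<longrightarrow>
    ennreal (planar_factor / 9 * s\<^sup>2) \<le> hausdorff2_outer (M \<inter> cball p s)"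
proof -
  obtain U \<phi> where par: "local_parametrization M U \<phi>" and "p \<in> \<phi> ` U"
    using M unfolding C2_surface_def by blast
  then obtain \<psi> a b da db where "C2_patch U \<phi> \<psi> a b da db" using C2_patch_of_local_parametrization by blast
  then interpret C2_patch U \<phi> \<psi> a b da db .
  have "\<phi> ` U \<subseteq> M" using par openin_imp_subset unfolding local_parametrization_def by blast
  then have "hausdorff2_outer (\<phi> ` U \<inter> cball p s) \<le> hausdorff2_outer (M \<inter> cball p s)" for s
    by (intro hausdorff2_outer_mono) auto
  moreover obtain u where u: "u \<in> U" "p = \<phi> u" using \<open>p \<in> \<phi> ` U\<close> by auto
  moreover obtain s0 where "s0 > 0" "\<forall>s. 0 < s \<and> s < s0 \<longrightarrow> ennreal (planar_factor / 9 * s\<^sup>2) \<le> hausdorff2_outer (\<phi> ` U \<inter> cball (\<phi> u) s)"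
    using patch_lower_density[OF u(1)] by blast
  ultimately show ?thesis by (intro exI[of _ s0]) (auto intro: order_trans)
qed

text \<open>The divergence of the test field of the monotonicity argument along the plane orthogonal
  to \<open>n\<close>, where \<open>y\<close> is the position relative to the centre, \<open>m\<close> is the cutoff and
  \<open>k = 1 / (\<bar>y\<bar>\<^sup>2 + s\<^sup>2)\<close>. The term with \<open>(y \<bullet> n)\<^sup>2\<close> absorbs the one with the curvature, since the
  curvature vector \<open>h\<close> is parallel to \<open>n\<close>.\<close>

lemma monotonicity_pointwise:
  fixes y n h :: "'a::real_inner" and m k s :: real
  assumes n: "norm n = 1" and h: "h = (h \<bullet> n) *\<^sub>R n" and m: "0 \<le> m"
    and k: "k * (y \<bullet> y + s\<^sup>2) = 1" "0 \<le> k"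
  shows "2 * m\<^sup>2 * k\<^sup>2 * s\<^sup>2 \<le> (2 * m\<^sup>2 * k - (4 * m * k + 2 * m\<^sup>2 * k\<^sup>2) * (y \<bullet> y - (n \<bullet> y)\<^sup>2))
     + m\<^sup>2 * k * (h \<bullet> y) + 4 * m + m\<^sup>2 * (norm h)\<^sup>2 / 8"
proof -
  define t where "t = y \<bullet> y"
  define \<tau> where "\<tau> = n \<bullet> y"
  have k1: "k = k\<^sup>2 * (t + s\<^sup>2)" using k(1) by (simp add: t_def power2_eq_square mult.assoc)
  have "m\<^sup>2 * k = m\<^sup>2 * (k\<^sup>2 * (t + s\<^sup>2))" using k1 by simp
  then have expand: "2 * m\<^sup>2 * k - (4 * m * k + 2 * m\<^sup>2 * k\<^sup>2) * (t - \<tau>\<^sup>2)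
     = 2 * m\<^sup>2 * k\<^sup>2 * s\<^sup>2 + 2 * m\<^sup>2 * k\<^sup>2 * \<tau>\<^sup>2 - 4 * m * (k * (t - \<tau>\<^sup>2))"
    by (simp add: algebra_simps)
  have kt: "k * (t - \<tau>\<^sup>2) \<le> 1"
  proof -
    have "k * (t - \<tau>\<^sup>2) \<le> k * (t + s\<^sup>2)" using k(2) by (intro mult_left_mono) (auto intro: order_trans[of _ 0])
    then show ?thesis using k(1) by (simp add: t_def)
  qed
  have "4 * m * (k * (t - \<tau>\<^sup>2)) \<le> 4 * m * 1" using m by (intro mult_left_mono kt) simp
  moreover have "- (m\<^sup>2 * k * (h \<bullet> y)) \<le> m\<^sup>2 * ((norm h)\<^sup>2 / 8 + 2 * (k * \<tau>)\<^sup>2)"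
  proof -
    have hy: "h \<bullet> y = (h \<bullet> n) * \<tau>" by (subst h) (simp add: \<tau>_def)
    have "\<bar>h \<bullet> n\<bar> \<le> norm h" using Cauchy_Schwarz_ineq2[of h n] n by simp
    then have "(h \<bullet> n)\<^sup>2 \<le> (norm h)\<^sup>2" using abs_le_square_iff[of "h \<bullet> n" "norm h"] by simp
    moreover have "- ((h \<bullet> n) * (k * \<tau>)) \<le> (h \<bullet> n)\<^sup>2 / 8 + 2 * (k * \<tau>)\<^sup>2"
    proof -
      have "0 \<le> ((h \<bullet> n) / 2 + 2 * (k * \<tau>))\<^sup>2 / 2" by simp
      then show ?thesis by (simp add: power2_eq_square algebra_simps)
    qed
    ultimately have "- (k * (h \<bullet> y)) \<le> (norm h)\<^sup>2 / 8 + 2 * (k * \<tau>)\<^sup>2"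
      unfolding hy by (simp add: mult_ac)
    from mult_left_mono[OF this, of "m\<^sup>2"] show ?thesis by (simp add: mult.assoc)
  qed
  ultimately show ?thesis
    unfolding t_def[symmetric] \<tau>_def[symmetric] expand
    by (simp add: power_mult_distrib algebra_simps)
qed

text \<open>The test field is \<open>m\<^sup>2 k (x - p)\<close> with the cutoff \<open>m = max 0 (\<rho>\<^sup>2 - \<bar>x - p\<bar>\<^sup>2)\<close> and
  \<open>k = 1 / (\<bar>x - p\<bar>\<^sup>2 + s\<^sup>2)\<close>. The sum of its tangential divergence and of its pairing with the curvature
  has integral zero, and on \<open>cball p s\<close> the divergence is at least of order \<open>\<rho>\<^sup>4 / s\<^sup>2\<close>; so the area
  ratio at scale \<open>s\<close> is controlled by what happens at scale \<open>\<rho>\<close>, uniformly in \<open>s\<close>.\<close>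

theorem density_energy_bound:
  assumes M: "compact M" "C2_surface M" and fin: "emeasure hausdorff2 M < \<infinity>"
    and H: "generalised_mean_curvature (induced_varifold M) H"
    and HL2: "integrable (surface_measure M) (\<lambda>x. (norm (H x))\<^sup>2)"
    and s: "0 < s" "s \<le> \<rho> / 2"
  shows "9 / 32 * (measure (surface_measure M) (cball p s) / s\<^sup>2)
    \<le> 4 / \<rho>\<^sup>2 * measure (surface_measure M) (ball p \<rho>)
      + (\<integral>x. indicator (ball p \<rho>) x * (norm (H x))\<^sup>2 \<partial>surface_measure M) / 8"
proof -
  let ?\<mu> = "surface_measure M"
  have Mb: "M \<in> sets borel" using M(1) by (rule borel_compact)
  interpret finite_measure ?\<mu> using finite_surface_measure[OF Mb fin] .
  have \<rho>: "\<rho> > 0" using s by simp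
  have mass: "mass_measure (induced_varifold M) = ?\<mu>" by (rule mass_measure_induced_varifold[OF M(2,1)])
  have Hm: "H \<in> borel_measurable borel"
    and Hint: "\<And>K. compact K \<Longrightarrow> set_integrable ?\<mu> K H"
    and Hfv: "\<And>X. C1_compactly_supported X \<Longrightarrow> first_variation (induced_varifold M) X = - (\<integral>x. H x \<bullet> X x \<partial>?\<mu>)"
    using H unfolding generalised_mean_curvature_def mass by auto
  define m where "m x = max 0 (\<rho>\<^sup>2 - (x - p) \<bullet> (x - p))" for x :: "real^3"
  define k where "k x = 1 / ((x - p) \<bullet> (x - p) + s\<^sup>2)" for x :: "real^3"
  have den: "0 < (x - p) \<bullet> (x - p) + s\<^sup>2" for x :: "real^3" using s by (simp add: add_nonneg_pos)
  have k0: "0 \<le> k x" "k x * ((x - p) \<bullet> (x - p) + s\<^sup>2) = 1" for x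
    using den[of x] by (auto simp: k_def)
  have m0: "0 \<le> m x" for x by (simp add: m_def)
  have m_out: "m x = 0" if "x \<notin> ball p \<rho>" for x
    using that \<rho> power_mono[of \<rho> "dist p x" 2] by (auto simp: m_def inner_diff_self)
  have m_le: "m x \<le> \<rho>\<^sup>2" for x using \<rho> by (simp add: m_def)
  have contm: "continuous_on S m" for S unfolding m_def by (intro continuous_intros)
  have contk: "continuous_on S k" for S unfolding k_def using den by (intro continuous_intros) (auto simp: less_le)
  define X where "X x = ((m x)\<^sup>2 * k x) *\<^sub>R (x - p)" for x
  define G where "G x = (- (4 * m x * k x + 2 * (m x)\<^sup>2 * (k x)\<^sup>2)) *\<^sub>R (x - p)" for x
  define X' where "X' x = Blinfun (\<lambda>h. ((m x)\<^sup>2 * k x) *\<^sub>R h + (h \<bullet> G x) *\<^sub>R (x - p))" for x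
  have app: "blinfun_apply (X' x) = (\<lambda>h. ((m x)\<^sup>2 * k x) *\<^sub>R h + (h \<bullet> G x) *\<^sub>R (x - p))" for x
    unfolding X'_def by (rule bounded_linear_Blinfun_apply) (intro bounded_linear_intros)
  have derX: "(X has_derivative blinfun_apply (X' x)) (at x)" for x
  proof -
    have dm: "((\<lambda>x. (m x)\<^sup>2) has_derivative (\<lambda>h. h \<bullet> bump_grad p \<rho> x)) (at x)"
      using bump_has_derivative[of p \<rho> x] by (simp add: bump_def[abs_def] m_def)
    have dk: "(k has_derivative (\<lambda>h. - (2 * ((x - p) \<bullet> h)) * (k x)\<^sup>2)) (at x)"
      unfolding k_def
      by (rule derivative_eq_intros refl | use den[of x] in \<open>force simp: power2_eq_square inner_commute divide_simps\<close>)+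
    have "((\<lambda>x. (m x)\<^sup>2 * k x) has_derivative (\<lambda>h. (m x)\<^sup>2 * (- (2 * ((x - p) \<bullet> h)) * (k x)\<^sup>2) + (h \<bullet> bump_grad p \<rho> x) * k x)) (at x)"
      by (rule has_derivative_mult[OF dm dk])
    moreover have "(m x)\<^sup>2 * (- (2 * ((x - p) \<bullet> h)) * (k x)\<^sup>2) + (h \<bullet> bump_grad p \<rho> x) * k x = h \<bullet> G x" for h
    proof -
      have bg: "bump_grad p \<rho> x = (- 4 * m x) *\<^sub>R (x - p)" by (simp add: bump_grad_def m_def)
      have comm: "(x - p) \<bullet> h = h \<bullet> (x - p)" by (rule inner_commute)
      define w where "w = h \<bullet> (x - p)"
      show ?thesis unfolding G_def bg comm inner_scaleR_right w_def[symmetric] by (simp add: algebra_simps)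
    qed
    ultimately have "((\<lambda>x. (m x)\<^sup>2 * k x) has_derivative (\<lambda>h. h \<bullet> G x)) (at x)" by simp
    moreover have "((\<lambda>x. x - p) has_derivative (\<lambda>h. h)) (at x)" by (auto intro!: derivative_eq_intros)
    ultimately show ?thesis unfolding X_def[abs_def] app by (rule has_derivative_scaleR)
  qed
  have contG: "continuous_on S G" for S unfolding G_def by (intro continuous_intros contm contk)
  have contX': "continuous_on UNIV X'"
    by (rule continuous_on_blinfun_componentwise) (auto simp: app intro!: continuous_intros contm contk contG)
  have contX: "continuous_on S X" for S unfolding X_def by (intro continuous_intros contm contk)
  have X_out: "X x = 0" if "x \<notin> cball p \<rho>" for x
  proof -
    have "x \<notin> ball p \<rho>" using that by auto
    then show ?thesis by (simp add: X_def m_out)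
  qed
  have "C1_compactly_supported X"
    unfolding C1_compactly_supported_def using derX contX' X_out by (intro conjI exI[of _ X'] exI[of _ "cball p \<rho>"]) auto
  then have fv: "first_variation (induced_varifold M) X = - (\<integral>x. H x \<bullet> X x \<partial>?\<mu>)" by (rule Hfv)
  let ?f = "plane_divergence X"
  have contf: "continuous_on S ?f" for S by (rule continuous_plane_divergence[OF derX contX'])
  let ?T = "\<lambda>x. plane_projection (tangent_space M x)"
  define D where "D x = indicator M x *\<^sub>R ?f (x, ?T x)" for x
  have contfT: "continuous_on M (\<lambda>x. ?f (x, ?T x))"
    by (rule continuous_on_compose2[OF contf[of UNIV]]) (intro continuous_intros continuous_on_tangent_plane(1)[OF M(2)], simp)
  have Dm: "D \<in> borel_measurable borel"
    unfolding D_def using Mb contfT by (intro borel_measurable_continuous_on_indicator)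
  have intD: "integrable ?\<mu> D"
  proof -
    obtain C where C: "0 \<le> C" "\<forall>x\<in>M. norm (?f (x, ?T x)) \<le> C"
      using compact_continuous_bound[OF M(1) contfT] by blast
    have "norm (D x) \<le> C" for x using C by (cases "x \<in> M") (auto simp: D_def)
    then show ?thesis
      using Dm by (intro integrable_const_bound[of _ C]) simp_all
  qed
  have fvD: "first_variation (induced_varifold M) X = (\<integral>x. D x \<partial>?\<mu>)"
  proof -
    have "first_variation (induced_varifold M) X = (\<integral>x. indicator M x * ?f (x, ?T x) \<partial>hausdorff2)"
      unfolding first_variation_eq
      by (rule integral_induced_varifold[OF M(2,1)]) (rule borel_measurable_continuous_onI[OF contf])
    also have "\<dots> = (\<integral>x. indicator M x * D x \<partial>hausdorff2)"
      by (rule Bochner_Integration.integral_cong) (auto simp: D_def indicator_def)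
    also have "\<dots> = (\<integral>x. D x \<partial>?\<mu>)" by (rule integral_surface_measure[OF Mb Dm, symmetric])
    finally show ?thesis .
  qed
  have HXm: "(\<lambda>x. H x \<bullet> X x) \<in> borel_measurable borel"
    using Hm borel_measurable_continuous_onI[OF contX] by measurable
  have "continuous_on UNIV (\<lambda>x. (norm (X x))\<^sup>2)" by (intro continuous_intros contX)
  then have "integrable ?\<mu> (\<lambda>x. (norm (X x))\<^sup>2)"
    by (rule integrable_continuous_compact_support[OF sets_surface_measure _ compact_cball])
      (use X_out in \<open>auto simp: emeasure_eq_measure\<close>)
  then have intHX: "integrable ?\<mu> (\<lambda>x. H x \<bullet> X x)"
    using HXm by (intro integrable_inner_of_squares[OF HL2]) simp_all
  let ?B = "ball p \<rho>"
  define E where "E x = 4 * \<rho>\<^sup>2 * indicator ?B x + (\<rho>\<^sup>2)\<^sup>2 * (indicator ?B x * (norm (H x))\<^sup>2) / 8" for x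
  have intB: "integrable ?\<mu> (\<lambda>x. indicator ?B x * (norm (H x))\<^sup>2)"
    by (rule Bochner_Integration.integrable_bound[OF HL2])
      (use Hm in \<open>auto simp: indicator_def\<close>)
  have intI: "integrable ?\<mu> (\<lambda>x. indicator S x :: real)" if "S \<in> sets borel" for S
    using that by (intro integrable_real_indicator) (auto simp: emeasure_eq_measure)
  have intE: "integrable ?\<mu> E"
    unfolding E_def using intB intI[of ?B] by simp
  have pw: "AE x in ?\<mu>. 9 / 32 * (\<rho>\<^sup>2)\<^sup>2 / s\<^sup>2 * indicator (cball p s) x \<le> D x + H x \<bullet> X x + E x"
    using mean_curvature_normal[OF M fin H] AE_surface_measure_in[OF Mb]
  proof eventually_elim
    case (elim x)
    have "?T x \<in> planes" using continuous_on_tangent_plane(2)[OF M(2)] elim(2) .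
    then obtain n where n: "norm n = 1" "?T x = normal_projection n" by (auto simp: planes_eq)
    have h: "H x = (H x \<bullet> n) *\<^sub>R n" using elim(1) unfolding n(2) normal_projection_mult by simp
    define y where "y = x - p"
    have Deq: "D x = 2 * (m x)\<^sup>2 * k x - (4 * m x * k x + 2 * (m x)\<^sup>2 * (k x)\<^sup>2) * (y \<bullet> y - (n \<bullet> y)\<^sup>2)"
    proof -
      let ?A = "matrix (blinfun_apply (X' x))"
      have lin: "linear (blinfun_apply (X' x))" by (rule bounded_linear.linear[OF blinfun.bounded_linear_right])
      have An: "?A *v n = ((m x)\<^sup>2 * k x) *\<^sub>R n + (n \<bullet> G x) *\<^sub>R y"
        using matrix_vector_mul(2)[OF lin, THEN fun_cong, of n] by (simp add: app y_def)
      have "(axis i 1 :: real^3)$i = 1" for i by (simp add: axis_def)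
      then have tr: "trace ?A = 3 * ((m x)\<^sup>2 * k x) + G x \<bullet> y"
        by (simp add: trace_def matrix_def app y_def inner_vec_def[of "G x"] sum_3 inner_axis')
      have nn: "n \<bullet> n = 1" using n(1) by (simp add: norm_eq_1)
      have "D x = trace (normal_projection n ** ?A)" using elim(2) n(2) by (simp add: D_def plane_divergence_eq[OF derX])
      also have "\<dots> = 2 * ((m x)\<^sup>2 * k x) + G x \<bullet> y - (n \<bullet> G x) * (n \<bullet> y)"
        unfolding trace_normal_projection An tr by (simp add: inner_add_right nn)
      also have "\<dots> = 2 * (m x)\<^sup>2 * k x - (4 * m x * k x + 2 * (m x)\<^sup>2 * (k x)\<^sup>2) * (y \<bullet> y - (n \<bullet> y)\<^sup>2)"
        unfolding G_def y_def[symmetric] by (simp add: power2_eq_square algebra_simps)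
      finally show ?thesis .
    qed
    have HX: "H x \<bullet> X x = (m x)\<^sup>2 * k x * (H x \<bullet> y)" by (simp add: X_def y_def)
    have main: "2 * (m x)\<^sup>2 * (k x)\<^sup>2 * s\<^sup>2 \<le> D x + H x \<bullet> X x + 4 * m x + (m x)\<^sup>2 * (norm (H x))\<^sup>2 / 8"
      unfolding Deq HX by (rule monotonicity_pointwise[OF n(1) h m0]) (use k0[of x] in \<open>simp_all add: y_def\<close>)
    have up: "4 * m x + (m x)\<^sup>2 * (norm (H x))\<^sup>2 / 8 \<le> E x"
    proof (cases "x \<in> ?B")
      case True
      have "(m x)\<^sup>2 \<le> (\<rho>\<^sup>2)\<^sup>2" using m_le m0 by (intro power_mono)
      then have "(m x)\<^sup>2 * (norm (H x))\<^sup>2 \<le> (\<rho>\<^sup>2)\<^sup>2 * (norm (H x))\<^sup>2" by (intro mult_right_mono) auto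
      then show ?thesis using True m_le[of x] by (simp add: E_def)
    next
      case False
      then show ?thesis by (simp add: E_def m_out)
    qed
    have low: "9 / 32 * (\<rho>\<^sup>2)\<^sup>2 / s\<^sup>2 * indicator (cball p s) x \<le> 2 * (m x)\<^sup>2 * (k x)\<^sup>2 * s\<^sup>2"
    proof (cases "x \<in> cball p s")
      case True
      then have ys: "y \<bullet> y \<le> s\<^sup>2" unfolding y_def inner_diff_self by (simp add: power_mono)
      have "s\<^sup>2 \<le> (\<rho> / 2)\<^sup>2" using s by (intro power_mono) auto
      then have "s\<^sup>2 \<le> \<rho>\<^sup>2 / 4" by (simp add: power_divide)
      moreover have "\<rho>\<^sup>2 - y \<bullet> y \<le> m x" by (simp add: m_def y_def)
      ultimately have m1: "3 / 4 * \<rho>\<^sup>2 \<le> m x" using ys by linarith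
      have k1: "1 / (2 * s\<^sup>2) \<le> k x"
        unfolding k_def y_def[symmetric] using ys den[of x] s by (intro divide_left_mono) (auto simp: y_def)
      have "9 / 32 * (\<rho>\<^sup>2)\<^sup>2 / s\<^sup>2 = 2 * (3 / 4 * \<rho>\<^sup>2)\<^sup>2 * (1 / (2 * s\<^sup>2))\<^sup>2 * s\<^sup>2"
        using s by (simp add: field_simps power2_eq_square)
      also have "\<dots> \<le> 2 * (m x)\<^sup>2 * (k x)\<^sup>2 * s\<^sup>2"
        using m1 k1 m0 k0 s by (intro mult_mono power_mono) auto
      finally show ?thesis using True by simp
    qed simp
    show ?case using main up low by linarith
  qed
  have "(\<integral>x. 9 / 32 * (\<rho>\<^sup>2)\<^sup>2 / s\<^sup>2 * indicator (cball p s) x \<partial>?\<mu>) \<le> (\<integral>x. D x + H x \<bullet> X x + E x \<partial>?\<mu>)"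
    using pw intD intHX intE intI[of "cball p s"] by (intro integral_mono_AE) auto
  also have "\<dots> = (\<integral>x. D x \<partial>?\<mu>) + (\<integral>x. H x \<bullet> X x \<partial>?\<mu>) + (\<integral>x. E x \<partial>?\<mu>)"
    using intD intHX intE by simp
  also have "\<dots> = (\<integral>x. E x \<partial>?\<mu>)" using fv fvD by simp
  also have "\<dots> = 4 * \<rho>\<^sup>2 * measure ?\<mu> ?B + (\<rho>\<^sup>2)\<^sup>2 * (\<integral>x. indicator ?B x * (norm (H x))\<^sup>2 \<partial>?\<mu>) / 8"
    unfolding E_def using intB intI[of ?B] by simp
  finally have "9 / 32 * (\<rho>\<^sup>2)\<^sup>2 / s\<^sup>2 * measure ?\<mu> (cball p s)
     \<le> 4 * \<rho>\<^sup>2 * measure ?\<mu> ?B + (\<rho>\<^sup>2)\<^sup>2 * (\<integral>x. indicator ?B x * (norm (H x))\<^sup>2 \<partial>?\<mu>) / 8"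
    by simp
  from divide_right_mono[OF this, of "(\<rho>\<^sup>2)\<^sup>2"] show ?thesis
    using \<rho> by (simp add: add_divide_distrib power2_eq_square)
qed

text \<open>Letting \<open>s\<close> tend to zero: a ball around a point of the surface with little area carries
  a definite amount of Willmore energy.\<close>

corollary energy_lower_bound:
  assumes M: "compact M" "C2_surface M" and fin: "emeasure hausdorff2 M < \<infinity>"
    and H: "generalised_mean_curvature (induced_varifold M) H"
    and HL2: "integrable (surface_measure M) (\<lambda>x. (norm (H x))\<^sup>2)"
    and p: "p \<in> M" and \<rho>: "0 < \<rho>"
  shows "planar_factor / 32 \<le> 4 / \<rho>\<^sup>2 * measure (surface_measure M) (ball p \<rho>)
      + (\<integral>x. indicator (ball p \<rho>) x * (norm (H x))\<^sup>2 \<partial>surface_measure M) / 8"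
proof -
  have Mb: "M \<in> sets borel" using M(1) by (rule borel_compact)
  interpret finite_measure "surface_measure M" using finite_surface_measure[OF Mb fin] .
  obtain s0 where s0: "s0 > 0" "\<And>s. 0 < s \<Longrightarrow> s < s0 \<Longrightarrow> ennreal (planar_factor / 9 * s\<^sup>2) \<le> hausdorff2_outer (M \<inter> cball p s)"
    using surface_lower_density[OF M(2) p] by blast
  define s where "s = min (s0 / 2) (\<rho> / 2)"
  have s: "0 < s" "s < s0" "s \<le> \<rho> / 2" using s0 \<rho> by (auto simp: s_def)
  have "ennreal (planar_factor / 9 * s\<^sup>2) \<le> emeasure (surface_measure M) (cball p s)"
    using s0(2)[OF s(1,2)] Mb by (simp add: emeasure_surface_measure emeasure_hausdorff2)
  then have "planar_factor / 9 * s\<^sup>2 \<le> measure (surface_measure M) (cball p s)"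
    by (simp add: emeasure_eq_measure)
  then have "planar_factor / 32 \<le> 9 / 32 * (measure (surface_measure M) (cball p s) / s\<^sup>2)"
    using s by (simp add: field_simps)
  also have "\<dots> \<le> 4 / \<rho>\<^sup>2 * measure (surface_measure M) (ball p \<rho>)
      + (\<integral>x. indicator (ball p \<rho>) x * (norm (H x))\<^sup>2 \<partial>surface_measure M) / 8"
    by (rule density_energy_bound[OF M fin H HL2 s(1,3)])
  finally show ?thesis .
qed


section \<open>Density of test functions in \<open>L\<^sup>2\<close>\<close>

definition L2_approximable :: "'a::euclidean_space set \<Rightarrow> 'a measure \<Rightarrow> ('a \<Rightarrow> real) \<Rightarrow> bool" where
  "L2_approximable W m f \<longleftrightarrow> (\<forall>e>0. \<exists>g. C1_test W g \<and> (\<integral>\<^sup>+x. ennreal ((f x - g x)\<^sup>2) \<partial>m) < ennreal e)"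

lemma ennreal_square_add_le: "ennreal ((a + b)\<^sup>2) \<le> 2 * ennreal (a\<^sup>2) + 2 * ennreal (b\<^sup>2)" for a b :: real
proof -
  have "(a + b)\<^sup>2 \<le> 2 * a\<^sup>2 + 2 * b\<^sup>2"
    using sum_squares_bound[of a b] by (simp add: power2_sum)
  then have "ennreal ((a + b)\<^sup>2) \<le> ennreal (2 * a\<^sup>2 + 2 * b\<^sup>2)" by (rule ennreal_leI)
  also have "\<dots> = 2 * ennreal (a\<^sup>2) + 2 * ennreal (b\<^sup>2)"
    by (simp add: ennreal_plus ennreal_mult)
  finally show ?thesis .
qed

lemma L2_distance_triangle:
  fixes f g h :: "'a \<Rightarrow> real"
  assumes [measurable]: "f \<in> borel_measurable m" "g \<in> borel_measurable m" "h \<in> borel_measurable m"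
  shows "(\<integral>\<^sup>+x. ennreal ((f x - h x)\<^sup>2) \<partial>m)
    \<le> 2 * (\<integral>\<^sup>+x. ennreal ((f x - g x)\<^sup>2) \<partial>m) + 2 * (\<integral>\<^sup>+x. ennreal ((g x - h x)\<^sup>2) \<partial>m)"
proof -
  have "(\<integral>\<^sup>+x. ennreal ((f x - h x)\<^sup>2) \<partial>m)
    \<le> (\<integral>\<^sup>+x. 2 * ennreal ((f x - g x)\<^sup>2) + 2 * ennreal ((g x - h x)\<^sup>2) \<partial>m)"
    using ennreal_square_add_le[of "f x - g x" "g x - h x" for x] by (intro nn_integral_mono) simp
  also have "\<dots> = 2 * (\<integral>\<^sup>+x. ennreal ((f x - g x)\<^sup>2) \<partial>m) + 2 * (\<integral>\<^sup>+x. ennreal ((g x - h x)\<^sup>2) \<partial>m)"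
    by (subst nn_integral_add) (auto simp: nn_integral_cmult)
  finally show ?thesis .
qed

lemma add_two_quarters_less:
  assumes "0 < e" "x < ennreal (e / 4)" "y < ennreal (e / 4)"
  shows "2 * x + 2 * y < ennreal e"
proof -
  have "2 * x + 2 * y < 2 * ennreal (e / 4) + 2 * ennreal (e / 4)"
    using assms by (intro add_strict_mono ennreal_mult_strict_left_mono) auto
  also have "\<dots> = ennreal 4 * ennreal (e / 4)" by (simp add: distrib_right[symmetric])
  also have "\<dots> = ennreal (4 * (e / 4))" by (rule ennreal_mult[symmetric]) (use assms in auto)
  finally show ?thesis by simp
qed

context
  fixes m :: "'a::euclidean_space measure" and W :: "'a set"
  assumes sets_m [measurable_cong]: "sets m = sets borel" and W: "open W"
    and finite_compact: "\<And>K. compact K \<Longrightarrow> emeasure m K < \<infinity>"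
begin

lemma borel_measurable_C1_test: "C1_test V g \<Longrightarrow> g \<in> borel_measurable m"
  using borel_measurable_continuous_onI[OF C1_test_continuous] by (simp add: measurable_cong_sets[OF sets_m refl])

lemma L2_approximable_limit:
  assumes f: "f \<in> borel_measurable m"
    and lim: "\<And>e. 0 < e \<Longrightarrow> \<exists>f'. f' \<in> borel_measurable m \<and> L2_approximable W m f' \<and> (\<integral>\<^sup>+x. ennreal ((f x - f' x)\<^sup>2) \<partial>m) < ennreal e"
  shows "L2_approximable W m f"
  unfolding L2_approximable_def
proof (intro allI impI)
  fix e :: real assume e: "0 < e"
  then have e4: "0 < e / 4" by simp
  obtain f' where f': "f' \<in> borel_measurable m" "L2_approximable W m f'" "(\<integral>\<^sup>+x. ennreal ((f x - f' x)\<^sup>2) \<partial>m) < ennreal (e / 4)"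
    using lim[OF e4] by blast
  obtain g where g: "C1_test W g" "(\<integral>\<^sup>+x. ennreal ((f' x - g x)\<^sup>2) \<partial>m) < ennreal (e / 4)"
    using f'(2) e4 unfolding L2_approximable_def by blast
  have "(\<integral>\<^sup>+x. ennreal ((f x - g x)\<^sup>2) \<partial>m)
    \<le> 2 * (\<integral>\<^sup>+x. ennreal ((f x - f' x)\<^sup>2) \<partial>m) + 2 * (\<integral>\<^sup>+x. ennreal ((f' x - g x)\<^sup>2) \<partial>m)"
    by (rule L2_distance_triangle[OF f f'(1) borel_measurable_C1_test[OF g(1)]])
  also have "\<dots> < ennreal e" by (rule add_two_quarters_less[OF e f'(3) g(2)])
  finally show "\<exists>g. C1_test W g \<and> (\<integral>\<^sup>+x. ennreal ((f x - g x)\<^sup>2) \<partial>m) < ennreal e" using g(1) by blast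
qed

lemma L2_approximable_zero: "L2_approximable W m (\<lambda>x. 0)"
  unfolding L2_approximable_def
proof (intro allI impI exI[of _ "\<lambda>x. 0"] conjI)
  show "C1_test W (\<lambda>x. 0)"
    unfolding C1_test_def by (intro conjI exI[of _ "\<lambda>x. 0"] exI[of _ "{}"]) auto
qed simp

lemma L2_approximable_add:
  assumes f: "L2_approximable W m f" "f \<in> borel_measurable m" and g: "L2_approximable W m g" "g \<in> borel_measurable m"
  shows "L2_approximable W m (\<lambda>x. f x + g x)"
  unfolding L2_approximable_def
proof (intro allI impI)
  fix e :: real assume e: "0 < e"
  then have e4: "0 < e / 4" by simp
  obtain f' where f': "C1_test W f'" "(\<integral>\<^sup>+x. ennreal ((f x - f' x)\<^sup>2) \<partial>m) < ennreal (e / 4)"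
    using f(1) e4 unfolding L2_approximable_def by blast
  obtain g' where g': "C1_test W g'" "(\<integral>\<^sup>+x. ennreal ((g x - g' x)\<^sup>2) \<partial>m) < ennreal (e / 4)"
    using g(1) e4 unfolding L2_approximable_def by blast
  note [measurable] = f(2) g(2) borel_measurable_C1_test[OF f'(1)] borel_measurable_C1_test[OF g'(1)]
  have "(\<integral>\<^sup>+x. ennreal ((f x + g x - (f' x + g' x))\<^sup>2) \<partial>m)
    \<le> (\<integral>\<^sup>+x. 2 * ennreal ((f x - f' x)\<^sup>2) + 2 * ennreal ((g x - g' x)\<^sup>2) \<partial>m)"
  proof (rule nn_integral_mono)
    fix x
    have eq: "f x + g x - (f' x + g' x) = (f x - f' x) + (g x - g' x)" by simp
    show "ennreal ((f x + g x - (f' x + g' x))\<^sup>2) \<le> 2 * ennreal ((f x - f' x)\<^sup>2) + 2 * ennreal ((g x - g' x)\<^sup>2)"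
      unfolding eq by (rule ennreal_square_add_le)
  qed
  also have "\<dots> = 2 * (\<integral>\<^sup>+x. ennreal ((f x - f' x)\<^sup>2) \<partial>m) + 2 * (\<integral>\<^sup>+x. ennreal ((g x - g' x)\<^sup>2) \<partial>m)"
    by (subst nn_integral_add) (auto simp: nn_integral_cmult)
  also have "\<dots> < ennreal e" by (rule add_two_quarters_less[OF e f'(2) g'(2)])
  finally show "\<exists>h. C1_test W h \<and> (\<integral>\<^sup>+x. ennreal ((f x + g x - h x)\<^sup>2) \<partial>m) < ennreal e"
    using C1_test_add[OF f'(1) g'(1)] by blast
qed

lemma L2_approximable_cmult:
  assumes f: "L2_approximable W m f" "f \<in> borel_measurable m"
  shows "L2_approximable W m (\<lambda>x. c * f x)"
  unfolding L2_approximable_def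
proof (intro allI impI)
  fix e :: real assume e: "0 < e"
  have pos: "0 < c\<^sup>2 + 1" by (simp add: add_nonneg_pos)
  then have e': "0 < e / (c\<^sup>2 + 1)" using e by simp
  obtain g where g: "C1_test W g" "(\<integral>\<^sup>+x. ennreal ((f x - g x)\<^sup>2) \<partial>m) < ennreal (e / (c\<^sup>2 + 1))"
    using f(1) e' unfolding L2_approximable_def by blast
  note [measurable] = f(2) borel_measurable_C1_test[OF g(1)]
  have "(\<integral>\<^sup>+x. ennreal ((c * f x - c * g x)\<^sup>2) \<partial>m) \<le> (\<integral>\<^sup>+x. ennreal (c\<^sup>2 + 1) * ennreal ((f x - g x)\<^sup>2) \<partial>m)"
  proof (rule nn_integral_mono)
    fix x
    have "(c * f x - c * g x)\<^sup>2 = c\<^sup>2 * (f x - g x)\<^sup>2" by (simp add: right_diff_distrib[symmetric] power_mult_distrib)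
    also have "\<dots> \<le> (c\<^sup>2 + 1) * (f x - g x)\<^sup>2" by (intro mult_right_mono) auto
    finally show "ennreal ((c * f x - c * g x)\<^sup>2) \<le> ennreal (c\<^sup>2 + 1) * ennreal ((f x - g x)\<^sup>2)"
      using pos by (subst ennreal_mult[symmetric]) (auto intro: ennreal_leI)
  qed
  also have "\<dots> = ennreal (c\<^sup>2 + 1) * (\<integral>\<^sup>+x. ennreal ((f x - g x)\<^sup>2) \<partial>m)" by (rule nn_integral_cmult) measurable
  also have "\<dots> < ennreal (c\<^sup>2 + 1) * ennreal (e / (c\<^sup>2 + 1))"
  proof (rule ennreal_mult_strict_left_mono[OF g(2)])
    show "0 < ennreal (c\<^sup>2 + 1)" using pos by (simp only: ennreal_less_zero_iff)
  qed (simp only: ennreal_less_top)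
  also have "\<dots> = ennreal e" using pos e by (subst ennreal_mult[symmetric]) auto
  finally show "\<exists>h. C1_test W h \<and> (\<integral>\<^sup>+x. ennreal ((c * f x - h x)\<^sup>2) \<partial>m) < ennreal e"
    by (intro exI[of _ "\<lambda>x. c * g x"] conjI C1_test_cmult[OF g(1)])
qed

lemma L2_approximable_sum:
  assumes "finite I" "\<And>i. i \<in> I \<Longrightarrow> L2_approximable W m (f i)" "\<And>i. i \<in> I \<Longrightarrow> f i \<in> borel_measurable m"
  shows "L2_approximable W m (\<lambda>x. \<Sum>i\<in>I. f i x)"
  using assms
proof (induction I rule: finite_induct)
  case empty show ?case using L2_approximable_zero by simp
next
  case (insert i I)
  have "L2_approximable W m (\<lambda>x. f i x + (\<Sum>i\<in>I. f i x))"
    by (rule L2_approximable_add) (use insert in auto)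
  then show ?case using insert.hyps by simp
qed

text \<open>By outer regularity \<open>A\<close> may be replaced by an open set, and the indicator of an open set is a
  bounded limit of test functions.\<close>

lemma L2_approximable_indicator:
  assumes A: "A \<in> sets borel" "A \<subseteq> W" "bounded A"
  shows "L2_approximable W m (indicator A)"
proof (rule L2_approximable_limit)
  show "indicator A \<in> borel_measurable m" using A(1) sets_m by simp
  fix e :: real assume e: "0 < e"
  obtain r where r: "A \<subseteq> ball 0 r" using A(3) bounded_subset_ballD[of A 0] by auto
  have finball: "emeasure m (ball 0 r) < \<infinity>"
  proof -
    have "emeasure m (ball 0 r) \<le> emeasure m (cball 0 r)" using sets_m by (intro emeasure_mono) auto
    then show ?thesis using finite_compact[of "cball 0 r"] by (auto intro: le_less_trans)
  qed
  define N where "N = density m (indicator (ball 0 r))"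
  have N: "emeasure N B = emeasure m (ball 0 r \<inter> B)" if "B \<in> sets borel" for B
    unfolding N_def using that sets_m by (subst emeasure_restricted) auto
  have Nspace: "space N = UNIV" using sets_eq_imp_space_eq[OF sets_m] by (simp add: N_def)
  have "emeasure N A = (INF U\<in>{U. A \<subseteq> U \<and> open U}. emeasure N U)"
  proof (rule outer_regular)
    show "sets N = sets borel" using sets_m by (simp add: N_def)
    show "emeasure N (space N) \<noteq> \<infinity>" using finball N[of UNIV] Nspace by simp
  qed (rule A(1))
  moreover have "emeasure N A < emeasure N A + ennreal e"
  proof -
    have "emeasure N A \<le> emeasure m (ball 0 r)"
      unfolding N[OF A(1)] by (rule emeasure_mono) (use sets_m in auto)
    then have "emeasure N A < \<infinity>" using finball by (rule le_less_trans)
    then show ?thesis using e by (simp add: less_top)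
  qed
  ultimately have "\<exists>U\<in>{U. A \<subseteq> U \<and> open U}. emeasure N U < emeasure N A + ennreal e"
    by (simp add: INF_less_iff)
  then obtain U where U: "A \<subseteq> U" "open U" "emeasure N U < emeasure N A + ennreal e" by blast
  define S where "S = U \<inter> W \<inter> ball 0 r"
  have S: "open S" "A \<subseteq> S" "S \<subseteq> W" using U W A(2) r by (auto simp: S_def)
  have Sm: "S \<in> sets m" "A \<in> sets m" using S(1) A(1) sets_m by auto
  have finS: "emeasure m S < \<infinity>"
    by (rule le_less_trans[OF emeasure_mono finball]) (auto simp: S_def sets_m)
  have NU: "emeasure N U = emeasure m (ball 0 r \<inter> U)" using U(2) by (intro N) simp
  have "emeasure m S \<le> emeasure N U"
    unfolding NU by (rule emeasure_mono) (use U(2) in \<open>auto simp: S_def sets_m\<close>)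
  also have "\<dots> < emeasure m A + ennreal e" using U(3) N[OF A(1)] r by (simp add: Int_absorb1)
  finally have "emeasure m S < emeasure m A + ennreal e" .
  moreover have "emeasure m S = emeasure m A + emeasure m (S - A)"
  proof -
    have "A \<union> (S - A) = S" using S(2) by auto
    then show ?thesis using plus_emeasure[of A m "S - A"] Sm by simp
  qed
  ultimately have small: "emeasure m (S - A) < ennreal e"
    by (simp add: add_less_cancel_left)
  have "(\<integral>\<^sup>+x. ennreal ((indicator A x - indicator S x)\<^sup>2) \<partial>m) = (\<integral>\<^sup>+x. indicator (S - A) x \<partial>m)"
    using S(2) by (intro nn_integral_cong) (auto simp: indicator_def)
  also have "\<dots> < ennreal e" using small Sm by simp
  finally have close: "(\<integral>\<^sup>+x. ennreal ((indicator A x - indicator S x)\<^sup>2) \<partial>m) < ennreal e" .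
  obtain g :: "nat \<Rightarrow> 'a \<Rightarrow> real" where g: "\<And>n. C1_test S (g n)" "\<And>n x. 0 \<le> g n x \<and> g n x \<le> 1"
    "\<And>x. (\<lambda>n. g n x) \<longlonglongrightarrow> indicator S x"
    using open_indicator_limit_of_tests[OF S(1)] by blast
  have lim: "(\<lambda>n. \<integral>\<^sup>+x. ennreal ((indicator S x - g n x)\<^sup>2) \<partial>m) \<longlonglongrightarrow> (\<integral>\<^sup>+x. 0 \<partial>m)"
  proof (rule nn_integral_dominated_convergence[where w = "indicator S"])
    show "(\<lambda>x. ennreal ((indicator S x - g n x)\<^sup>2)) \<in> borel_measurable m" for n
      using borel_measurable_C1_test[OF g(1)[of n]] Sm by measurable
    show "AE x in m. ennreal ((indicator S x - g n x)\<^sup>2) \<le> indicator S x" for n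
    proof (rule AE_I2)
      fix x
      show "ennreal ((indicator S x - g n x)\<^sup>2) \<le> indicator S x"
      proof (cases "x \<in> S")
        case True
        have "(1 - g n x)\<^sup>2 \<le> 1\<^sup>2" using g(2)[of n x] by (intro power_mono) auto
        then show ?thesis using True by simp
      next
        case False
        then have "g n x = 0" using g(1)[of n] unfolding C1_test_def by blast
        then show ?thesis using False by simp
      qed
    qed
    show "(\<integral>\<^sup>+x. indicator S x \<partial>m) < \<infinity>" using finS Sm by simp
    show "AE x in m. (\<lambda>n. ennreal ((indicator S x - g n x)\<^sup>2)) \<longlonglongrightarrow> 0"
    proof (rule AE_I2)
      fix x
      have "(\<lambda>n. (indicator S x - g n x)\<^sup>2) \<longlonglongrightarrow> (indicator S x - indicator S x)\<^sup>2"
        by (intro tendsto_intros g(3))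
      from tendsto_ennrealI[OF this]
      show "(\<lambda>n. ennreal ((indicator S x - g n x)\<^sup>2)) \<longlonglongrightarrow> 0" by simp
    qed
  qed (use Sm in auto)
  have "L2_approximable W m (indicator S)"
    unfolding L2_approximable_def
  proof (intro allI impI)
    fix d :: real assume d: "0 < d"
    have "\<forall>\<^sub>F n in sequentially. (\<integral>\<^sup>+x. ennreal ((indicator S x - g n x)\<^sup>2) \<partial>m) < ennreal d"
      using lim d by (intro order_tendstoD(2)[of _ 0]) auto
    then obtain n where "(\<integral>\<^sup>+x. ennreal ((indicator S x - g n x)\<^sup>2) \<partial>m) < ennreal d"
      by (auto simp: eventually_sequentially)
    then show "\<exists>g. C1_test W g \<and> (\<integral>\<^sup>+x. ennreal ((indicator S x - g x)\<^sup>2) \<partial>m) < ennreal d"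
      using C1_test_mono[OF g(1) S(3)] by blast
  qed
  then show "\<exists>f'. f' \<in> borel_measurable m \<and> L2_approximable W m f' \<and> (\<integral>\<^sup>+x. ennreal ((indicator A x - f' x)\<^sup>2) \<partial>m) < ennreal e"
    using close Sm by (intro exI[of _ "indicator S"]) auto
qed

text \<open>Simple functions that approximate \<open>f\<close> and are dominated by \<open>2 \<bar>f\<bar>\<close>, cut off outside a large ball
  and outside \<open>W\<close>, converge to \<open>f\<close> in \<open>L\<^sup>2\<close> by dominated convergence.\<close>

lemma tests_dense_in_L2:
  assumes f: "f \<in> borel_measurable m" "(\<integral>\<^sup>+x. ennreal ((f x)\<^sup>2) \<partial>m) < \<infinity>" and null: "emeasure m (- W) = 0"
  shows "L2_approximable W m f"
proof (rule L2_approximable_limit[OF f(1)])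
  fix e :: real assume e: "0 < e"
  have space_m: "space m = UNIV" using sets_eq_imp_space_eq[OF sets_m] by simp
  obtain F where F: "\<And>i. simple_function m (F i)" "\<And>x. (\<lambda>i. F i x) \<longlonglongrightarrow> f x" "\<And>i x. norm (F i x) \<le> 2 * norm (f x)"
    using borel_measurable_implies_sequence_metric[OF f(1), of 0] space_m by (auto simp: dist_norm)
  define B where "B i = W \<inter> ball (0::'a) (real i)" for i
  have Bm: "B i \<in> sets m" for i using W sets_m by (simp add: B_def)
  define F' where "F' i x = indicator (B i) x * F i x" for i x
  have Fm: "F i \<in> borel_measurable m" for i using F(1) by (rule borel_measurable_simple_function)
  have F'm: "F' i \<in> borel_measurable m" for i unfolding F'_def using Fm Bm by measurable
  have approx: "L2_approximable W m (F' i)" for i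
  proof -
    have eq: "F' i = (\<lambda>x. \<Sum>y\<in>range (F i). y * indicator (F i -` {y} \<inter> B i) x)"
    proof
      fix x
      have "F i x = (\<Sum>y\<in>F i ` space m. indicator (F i -` {y} \<inter> space m) x *\<^sub>R y)"
        by (rule simple_function_indicator_representation_banach[OF F(1)]) (simp add: space_m)
      then have Fx: "F i x = (\<Sum>y\<in>range (F i). indicator (F i -` {y}) x *\<^sub>R y)"
        unfolding space_m Int_UNIV_right .
      have "F' i x = indicator (B i) x * (\<Sum>y\<in>range (F i). indicator (F i -` {y}) x *\<^sub>R y)"
        unfolding F'_def Fx[symmetric] by (rule refl)
      also have "\<dots> = (\<Sum>y\<in>range (F i). indicator (B i) x * (indicator (F i -` {y}) x *\<^sub>R y))"
        by (rule sum_distrib_left)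
      also have "\<dots> = (\<Sum>y\<in>range (F i). y * indicator (F i -` {y} \<inter> B i) x)"
        by (intro sum.cong) (auto simp: indicator_def)
      finally show "F' i x = (\<Sum>y\<in>range (F i). y * indicator (F i -` {y} \<inter> B i) x)" .
    qed
    have fin: "finite (range (F i))" using simple_functionD(1)[OF F(1)[of i]] by (simp add: space_m)
    have meas: "F i -` {y} \<inter> B i \<in> sets borel" for y
      using simple_functionD(2)[OF F(1)[of i], of "{y}"] Bm[of i] by (auto simp: space_m sets_m)
    show ?thesis unfolding eq
    proof (rule L2_approximable_sum[OF fin])
      fix y
      have "bounded (F i -` {y} \<inter> B i)" by (rule bounded_subset[OF bounded_ball[of 0 "real i"]]) (auto simp: B_def)
      then have "L2_approximable W m (indicator (F i -` {y} \<inter> B i))"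
        by (intro L2_approximable_indicator[OF meas]) (auto simp: B_def)
      then show "L2_approximable W m (\<lambda>x. y * indicator (F i -` {y} \<inter> B i) x)"
        by (rule L2_approximable_cmult) (use meas sets_m in simp)
      show "(\<lambda>x. y * indicator (F i -` {y} \<inter> B i) x) \<in> borel_measurable m"
        using meas[of y] sets_m by simp
    qed
  qed
  have "(\<lambda>i. \<integral>\<^sup>+x. ennreal ((f x - F' i x)\<^sup>2) \<partial>m) \<longlonglongrightarrow> (\<integral>\<^sup>+x. 0 \<partial>m)"
  proof (rule nn_integral_dominated_convergence[where w = "\<lambda>x. 9 * ennreal ((f x)\<^sup>2)"])
    show "(\<lambda>x. ennreal ((f x - F' i x)\<^sup>2)) \<in> borel_measurable m" for i using f(1) F'm by measurable
    show "(\<integral>\<^sup>+x. 9 * ennreal ((f x)\<^sup>2) \<partial>m) < \<infinity>"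
      using f by (simp add: nn_integral_cmult ennreal_mult_less_top)
    show "AE x in m. ennreal ((f x - F' i x)\<^sup>2) \<le> 9 * ennreal ((f x)\<^sup>2)" for i
    proof (rule AE_I2)
      fix x
      have "\<bar>F' i x\<bar> \<le> 2 * \<bar>f x\<bar>" using F(3)[of i x] by (auto simp: F'_def indicator_def)
      then have "\<bar>f x - F' i x\<bar> \<le> \<bar>3 * f x\<bar>" by linarith
      then have "(f x - F' i x)\<^sup>2 \<le> (3 * f x)\<^sup>2" by (rule abs_le_square_iff[THEN iffD1])
      then have "ennreal ((f x - F' i x)\<^sup>2) \<le> ennreal (9 * (f x)\<^sup>2)" by (intro ennreal_leI) (simp add: power_mult_distrib)
      then show "ennreal ((f x - F' i x)\<^sup>2) \<le> 9 * ennreal ((f x)\<^sup>2)" by (simp add: ennreal_mult)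
    qed
    have "AE x in m. x \<in> W"
      using null W sets_m by (intro AE_I[of _ _ "- W"]) (auto simp: space_m)
    then show "AE x in m. (\<lambda>i. ennreal ((f x - F' i x)\<^sup>2)) \<longlonglongrightarrow> 0"
    proof eventually_elim
      case (elim x)
      obtain i0 :: nat where i0: "norm x < real i0" using reals_Archimedean2 by blast
      have "(\<lambda>i. F' i x) \<longlonglongrightarrow> f x"
      proof (rule Lim_transform_eventually[OF F(2)])
        show "\<forall>\<^sub>F i in sequentially. F i x = F' i x"
          using eventually_ge_at_top[of i0]
        proof eventually_elim
          case (elim i)
          then have "x \<in> B i" using \<open>x \<in> W\<close> i0 by (simp add: B_def)
          then show ?case by (simp add: F'_def)
        qed
      qed
      then have "(\<lambda>i. (f x - F' i x)\<^sup>2) \<longlonglongrightarrow> (f x - f x)\<^sup>2" by (intro tendsto_intros)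
      from tendsto_ennrealI[OF this] show ?case by simp
    qed
  qed (use f(1) in measurable)
  then have "\<forall>\<^sub>F i in sequentially. (\<integral>\<^sup>+x. ennreal ((f x - F' i x)\<^sup>2) \<partial>m) < ennreal e"
    using e by (intro order_tendstoD(2)[of _ 0]) auto
  then obtain i where "(\<integral>\<^sup>+x. ennreal ((f x - F' i x)\<^sup>2) \<partial>m) < ennreal e"
    by (auto simp: eventually_sequentially)
  then show "\<exists>f'. f' \<in> borel_measurable m \<and> L2_approximable W m f' \<and> (\<integral>\<^sup>+x. ennreal ((f x - f' x)\<^sup>2) \<partial>m) < ennreal e"
    using F'm approx by blast
qed

end


section \<open>Limits of surfaces of bounded energy\<close>

lemma closer_than_hausdorff_distance:
  assumes "hausdorff_distance A B < ennreal e"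
  shows "a \<in> A \<Longrightarrow> \<exists>b\<in>B. dist a b < e" and "b \<in> B \<Longrightarrow> \<exists>a\<in>A. dist a b < e"
proof -
  have 1: "(SUP a\<in>A. INF b\<in>B. ennreal (dist a b)) < ennreal e"
    and 2: "(SUP b\<in>B. INF a\<in>A. ennreal (dist a b)) < ennreal e"
    using assms unfolding hausdorff_distance_def by auto
  show "\<exists>b\<in>B. dist a b < e" if "a \<in> A"
  proof -
    have "(INF b\<in>B. ennreal (dist a b)) < ennreal e"
      using that by (intro le_less_trans[OF _ 1] SUP_upper)
    then show ?thesis by (auto simp: INF_less_iff ennreal_less_iff)
  qed
  show "\<exists>a\<in>A. dist a b < e" if "b \<in> B"
  proof -
    have "(INF a\<in>A. ennreal (dist a b)) < ennreal e"
      using that by (intro le_less_trans[OF _ 2] SUP_upper)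
    then show ?thesis by (auto simp: INF_less_iff ennreal_less_iff)
  qed
qed

lemma not_in_spt:
  fixes \<mu> :: "'a::metric_space measure"
  assumes sets: "sets \<mu> = sets borel" and x: "x \<notin> spt \<mu>"
  shows "\<exists>r>0. emeasure \<mu> (ball x r) = 0"
proof -
  obtain U where U: "open U" "x \<in> U" "emeasure \<mu> U = 0" using x by (auto simp: spt_def)
  then obtain r where r: "0 < r" "ball x r \<subseteq> U" using openE by blast
  have "emeasure \<mu> (ball x r) \<le> emeasure \<mu> U" using r U sets by (intro emeasure_mono) auto
  then show ?thesis using r(1) U(3) by auto
qed

lemma emeasure_ball_mono_zero:
  assumes "sets \<mu> = sets borel" "emeasure \<mu> (ball x r) = 0" "s \<le> r"
  shows "emeasure \<mu> (ball x s) = 0"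
proof -
  have "emeasure \<mu> (ball x s) \<le> emeasure \<mu> (ball x r)"
    using assms by (intro emeasure_mono) auto
  then show ?thesis using assms(2) by simp
qed

text \<open>Otherwise open null sets cover the space, and countably many of them suffice.\<close>

lemma spt_nonempty:
  fixes \<mu> :: "'a::{metric_space, second_countable_topology} measure"
  assumes sets: "sets \<mu> = sets borel" and nz: "emeasure \<mu> UNIV \<noteq> 0"
  shows "spt \<mu> \<noteq> {}"
proof
  assume "spt \<mu> = {}"
  define \<F> where "\<F> = {U. open U \<and> emeasure \<mu> U = 0}"
  have "\<Union>\<F> = UNIV" using \<open>spt \<mu> = {}\<close> by (auto simp: \<F>_def spt_def)
  moreover obtain \<B> where \<B>: "\<B> \<subseteq> \<F>" "countable \<B>" "\<Union>\<B> = \<Union>\<F>"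
    using Lindelof[of \<F>] unfolding \<F>_def by blast
  ultimately have cover: "(\<Union>U\<in>\<B>. U) = UNIV" by simp
  have "(\<Union>U\<in>\<B>. U) \<in> null_sets \<mu>"
    using \<B> sets by (intro null_sets_UN') (auto simp: \<F>_def null_sets_def)
  then show False using nz cover by auto
qed

text \<open>Finite energy provides a generalised mean curvature, since without one the energy is infinite.\<close>

lemma willmore_finite:
  assumes "willmore V < \<infinity>"
  shows "generalised_mean_curvature V (SOME H. generalised_mean_curvature V H)"
    and "willmore V = (\<integral>\<^sup>+ x. ennreal ((norm ((SOME H. generalised_mean_curvature V H) x))\<^sup>2) \<partial>mass_measure V)"
proof -
  have ex: "\<exists>H. generalised_mean_curvature V H"
  proof (rule ccontr)
    assume "\<not> ?thesis"
    then have "willmore V = \<infinity>" unfolding willmore_def by (rule if_not_P)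
    then show False using assms by simp
  qed
  then show "generalised_mean_curvature V (SOME H. generalised_mean_curvature V H)" by (rule someI_ex)
  show "willmore V = (\<integral>\<^sup>+ x. ennreal ((norm ((SOME H. generalised_mean_curvature V H) x))\<^sup>2) \<partial>mass_measure V)"
    using ex unfolding willmore_def by (rule if_P)
qed

lemma sets_mass_measure [simp]: "sets (mass_measure V) = sets borel"
  by (simp add: mass_measure_def)

lemma measurable_mass_measure [simp]: "borel_measurable (mass_measure V) = borel_measurable borel"
  by (rule measurable_cong_sets) simp_all

lemma fst_measurable_varifold:
  "sets V = sets (restrict_space borel grassmann_bundle) \<Longrightarrow> fst \<in> borel_measurable V"
  using fst_measurable_bundle measurable_cong_sets by blast

lemma mass_measure_compact_finite:
  assumes V: "varifold V" and K: "compact K"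
  shows "emeasure (mass_measure V) K < \<infinity>"
proof -
  have sets: "sets V = sets (restrict_space borel grassmann_bundle)" using V by (simp add: varifold_def)
  have space: "space V = grassmann_bundle" using sets_eq_imp_space_eq[OF sets] by (simp add: space_restrict_space)
  have "emeasure (mass_measure V) K = emeasure V (fst -` K \<inter> space V)"
    unfolding mass_measure_def using fst_measurable_varifold[OF sets] K by (intro emeasure_distr) (auto simp: borel_compact)
  also have "fst -` K \<inter> space V = K \<times> planes" by (auto simp: space grassmann_bundle_def)
  also have "emeasure V (K \<times> planes) < \<infinity>"
    using V K compact_planes unfolding varifold_def by (auto simp: grassmann_bundle_def intro: compact_Times)
  finally show ?thesis .
qed

lemma varifold_converges_mass:
  fixes g :: "real^3 \<Rightarrow> real"
  assumes conv: "varifold_converges Vs V"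
    and sets: "sets V = sets (restrict_space borel grassmann_bundle)" "\<And>k. sets (Vs k) = sets (restrict_space borel grassmann_bundle)"
    and g: "continuous_on UNIV g" and K: "compact K" "\<And>x. x \<notin> K \<Longrightarrow> g x = 0"
  shows "(\<lambda>k. \<integral>x. g x \<partial>mass_measure (Vs k)) \<longlonglongrightarrow> (\<integral>x. g x \<partial>mass_measure V)"
proof -
  have "(\<lambda>k. \<integral>z. g (fst z) \<partial>Vs k) \<longlonglongrightarrow> (\<integral>z. g (fst z) \<partial>V)"
  proof (rule conv[unfolded varifold_converges_def, rule_format], intro conjI exI[of _ "K \<times> planes"] ballI)
    show "continuous_on grassmann_bundle (\<lambda>z. g (fst z))"
      by (rule continuous_on_compose2[OF g continuous_on_fst]) auto
    show "compact (K \<times> planes)" using K(1) compact_planes by (rule compact_Times)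
    show "K \<times> planes \<subseteq> grassmann_bundle" by (auto simp: grassmann_bundle_def)
    show "g (fst z) = 0" if "z \<in> grassmann_bundle - K \<times> planes" for z
    proof (rule K(2))
      show "fst z \<notin> K" using that by (auto simp: grassmann_bundle_def)
    qed
  qed
  moreover have "(\<integral>x. g x \<partial>mass_measure N) = (\<integral>z. g (fst z) \<partial>N)" if "sets N = sets (restrict_space borel grassmann_bundle)" for N
    unfolding mass_measure_def using fst_measurable_varifold[OF that] borel_measurable_continuous_onI[OF g]
    by (intro integral_distr) auto
  ultimately show ?thesis using sets by simp
qed

lemma varifold_converges_first_variation:
  assumes conv: "varifold_converges Vs V" and X: "C1_compactly_supported X"
  shows "(\<lambda>k. first_variation (Vs k) X) \<longlonglongrightarrow> first_variation V X"
proof -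
  obtain X' K where derX: "\<And>x. (X has_derivative blinfun_apply (X' x)) (at x)" and contX': "continuous_on UNIV X'"
    and K: "compact K" "\<And>x. x \<notin> K \<Longrightarrow> X x = 0"
    using X unfolding C1_compactly_supported_def by blast
  show ?thesis
    unfolding first_variation_eq
  proof (rule conv[unfolded varifold_converges_def, rule_format], intro conjI exI[of _ "K \<times> planes"] ballI)
    show "continuous_on grassmann_bundle (plane_divergence X)"
      by (rule continuous_plane_divergence[OF derX contX'])
    show "compact (K \<times> planes)" using K(1) compact_planes by (rule compact_Times)
    show "K \<times> planes \<subseteq> grassmann_bundle" by (auto simp: grassmann_bundle_def)
    show "plane_divergence X z = 0" if "z \<in> grassmann_bundle - K \<times> planes" for z
    proof -
      have "fst z \<notin> K" using that by (auto simp: grassmann_bundle_def)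
      from plane_divergence_outside_support[OF derX K this, of "snd z"] show ?thesis by simp
    qed
  qed
qed

lemma bump_continuous: "continuous_on S (bump c r)"
  unfolding bump_def[abs_def] by (intro continuous_intros)

locale converging_surfaces =
  fixes M :: "nat \<Rightarrow> (real^3) set" and V :: "((real^3) \<times> (real^3^3)) measure"
  assumes compact_M: "\<And>k. compact (M k)" and C2_M: "\<And>k. C2_surface (M k)"
    and varifold_V: "varifold V"
    and conv: "varifold_converges (\<lambda>k. induced_varifold (M k)) V"
    and bounded: "limsup (\<lambda>k. willmore (induced_varifold (M k)) + emeasure hausdorff2 (M k)) < \<infinity>"
begin

abbreviation \<mu> :: "nat \<Rightarrow> (real^3) measure" where "\<mu> k \<equiv> surface_measure (M k)"
abbreviation \<nu> :: "(real^3) measure" where "\<nu> \<equiv> mass_measure V"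

definition H :: "nat \<Rightarrow> real^3 \<Rightarrow> real^3" where
  "H k = (SOME H. generalised_mean_curvature (induced_varifold (M k)) H)"

definition energy :: "nat \<Rightarrow> (real^3) set \<Rightarrow> real" where
  "energy k A = (\<integral>x. indicator A x * (norm (H k x))\<^sup>2 \<partial>\<mu> k)"

definition finite_energy :: "nat \<Rightarrow> bool" where
  "finite_energy k \<longleftrightarrow> willmore (induced_varifold (M k)) < \<infinity> \<and> emeasure hausdorff2 (M k) < \<infinity>"

lemma M_borel: "M k \<in> sets borel" using compact_M by (rule borel_compact)

lemma mass_k: "mass_measure (induced_varifold (M k)) = \<mu> k"
  by (rule mass_measure_induced_varifold[OF C2_M compact_M])

lemma sets_k: "sets (induced_varifold (M k)) = sets (restrict_space borel grassmann_bundle)"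
  by (simp add: induced_varifold_def)

lemma sets_V: "sets V = sets (restrict_space borel grassmann_bundle)"
  using varifold_V by (simp add: varifold_def)

lemma eventually_bounded:
  "\<exists>C::real. 0 \<le> C \<and> (\<forall>\<^sub>F k in sequentially. finite_energy k \<and> willmore (induced_varifold (M k)) \<le> ennreal C)"
proof -
  obtain n :: nat where "limsup (\<lambda>k. willmore (induced_varifold (M k)) + emeasure hausdorff2 (M k)) < of_nat n"
    using bounded ennreal_Ex_less_of_nat by (auto simp: infinity_ennreal_def)
  then have "\<forall>\<^sub>F k in sequentially. willmore (induced_varifold (M k)) + emeasure hausdorff2 (M k) < of_nat n"
    by (rule Limsup_lessD)
  then have "\<forall>\<^sub>F k in sequentially. finite_energy k \<and> willmore (induced_varifold (M k)) \<le> ennreal (real n)"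
  proof eventually_elim
    case (elim k)
    have lt: "willmore (induced_varifold (M k)) < of_nat n" "emeasure hausdorff2 (M k) < of_nat n"
      using elim by (auto intro: le_less_trans[OF _ elim])
    have "of_nat n < (\<infinity> :: ennreal)" by (simp add: of_nat_less_top)
    then show ?case using lt unfolding finite_energy_def by (auto simp: ennreal_of_nat_eq_real_of_nat intro: less_trans less_imp_le)
  qed
  then show ?thesis by (intro exI[of _ "real n"]) simp
qed

lemma gmc_H: "finite_energy k \<Longrightarrow> generalised_mean_curvature (induced_varifold (M k)) (H k)"
  unfolding finite_energy_def H_def by (rule willmore_finite(1)) simp

lemma H_measurable: "finite_energy k \<Longrightarrow> H k \<in> borel_measurable borel"
  using gmc_H unfolding generalised_mean_curvature_def by blast

lemma H_L2:
  assumes k: "finite_energy k"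
  shows "integrable (\<mu> k) (\<lambda>x. (norm (H k x))\<^sup>2)"
    and "willmore (induced_varifold (M k)) = ennreal (energy k UNIV)"
proof -
  have W: "willmore (induced_varifold (M k)) = (\<integral>\<^sup>+x. ennreal ((norm (H k x))\<^sup>2) \<partial>\<mu> k)" "willmore (induced_varifold (M k)) < \<infinity>"
    using k willmore_finite(2)[of "induced_varifold (M k)"] unfolding finite_energy_def H_def mass_k by auto
  have m: "(\<lambda>x. (norm (H k x))\<^sup>2) \<in> borel_measurable (\<mu> k)"
    using H_measurable[OF k] by simp
  show int: "integrable (\<mu> k) (\<lambda>x. (norm (H k x))\<^sup>2)"
    using m W by (intro integrableI_nonneg) auto
  show "willmore (induced_varifold (M k)) = ennreal (energy k UNIV)"
    unfolding W(1) energy_def using nn_integral_eq_integral[OF int] by simp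
qed

lemma finite_mu: "finite_energy k \<Longrightarrow> finite_measure (\<mu> k)"
  unfolding finite_energy_def by (intro finite_surface_measure M_borel) simp

lemma integrable_energy:
  assumes "finite_energy k" "A \<in> sets borel"
  shows "integrable (\<mu> k) (\<lambda>x. indicator A x * (norm (H k x))\<^sup>2)"
  using H_measurable[OF assms(1)] assms(2)
  by (intro Bochner_Integration.integrable_bound[OF H_L2(1)[OF assms(1)]])
    (auto simp: indicator_def)

lemma energy_nonneg: "0 \<le> energy k A"
  unfolding energy_def by (rule Bochner_Integration.integral_nonneg) simp

lemma energy_mono:
  assumes "finite_energy k" "A \<in> sets borel" "B \<in> sets borel" "A \<subseteq> B"
  shows "energy k A \<le> energy k B"
  unfolding energy_def using assms
  by (intro integral_mono integrable_energy) (auto simp: indicator_def)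

lemma sum_energy_le:
  assumes k: "finite_energy k" and T: "finite T" "\<And>x. x \<in> T \<Longrightarrow> A x \<in> sets borel" "disjoint_family_on A T"
  shows "(\<Sum>x\<in>T. energy k (A x)) \<le> energy k UNIV"
proof -
  have "(\<Sum>x\<in>T. energy k (A x)) = (\<integral>z. (\<Sum>x\<in>T. indicator (A x) z * (norm (H k z))\<^sup>2) \<partial>\<mu> k)"
    unfolding energy_def using k T by (intro Bochner_Integration.integral_sum[symmetric] integrable_energy) auto
  also have "\<dots> \<le> energy k UNIV"
    unfolding energy_def
  proof (intro integral_mono Bochner_Integration.integrable_sum integrable_energy k)
    fix z
    have "(\<Sum>x\<in>T. indicator (A x) z :: real) = indicator (\<Union>x\<in>T. A x) z"
      using T by (intro indicator_UN_disjoint[symmetric]) auto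
    then have "(\<Sum>x\<in>T. indicator (A x) z * (norm (H k z))\<^sup>2) = indicator (\<Union>x\<in>T. A x) z * (norm (H k z))\<^sup>2"
      by (simp add: sum_distrib_right[symmetric])
    also have "\<dots> \<le> indicator UNIV z * (norm (H k z))\<^sup>2" by (auto simp: indicator_def)
    finally show "(\<Sum>x\<in>T. indicator (A x) z * (norm (H k z))\<^sup>2) \<le> indicator UNIV z * (norm (H k z))\<^sup>2" .
  qed (use T in auto)
  finally show ?thesis .
qed

lemma integral_bump_converges:
  assumes "0 \<le> r" shows "(\<lambda>k. \<integral>z. bump x r z \<partial>\<mu> k) \<longlonglongrightarrow> (\<integral>z. bump x r z \<partial>\<nu>)"
  using varifold_converges_mass[OF conv sets_V sets_k bump_continuous compact_cball bump_zero[OF assms]]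
  unfolding mass_k by simp

text \<open>A bump that vanishes outside the null ball is bounded below on the smaller ball.\<close>

lemma area_tends_to_zero:
  assumes null: "emeasure \<nu> (ball x r) = 0" and s: "0 \<le> s" "s < r"
  shows "(\<lambda>k. measure (\<mu> k) (cball x s)) \<longlonglongrightarrow> 0"
proof -
  have "AE z in \<nu>. bump x r z = 0"
  proof (rule AE_I[of _ _ "ball x r"])
    show "{z \<in> space \<nu>. bump x r z \<noteq> 0} \<subseteq> ball x r"
    proof
      fix z assume "z \<in> {z \<in> space \<nu>. bump x r z \<noteq> 0}"
      then have "(dist x z)\<^sup>2 < r\<^sup>2" by (auto simp: bump_def inner_diff_self)
      then show "z \<in> ball x r" using s by (simp add: power2_less_imp_less)
    qed
  qed (use null in auto)
  then have "(\<integral>z. bump x r z \<partial>\<nu>) = (\<integral>z. 0 \<partial>\<nu>)"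
    using borel_measurable_continuous_onI[OF bump_continuous[of UNIV x r]]
    by (intro integral_cong_AE) (auto simp: mass_measure_def)
  then have lim: "(\<lambda>k. \<integral>z. bump x r z \<partial>\<mu> k) \<longlonglongrightarrow> 0" using integral_bump_converges[of r x] s by simp
  define c where "c = (r\<^sup>2 - s\<^sup>2)\<^sup>2"
  have rs: "s\<^sup>2 < r\<^sup>2" using s by (intro power_strict_mono) auto
  then have c: "0 < c" by (simp add: c_def)
  obtain C where C: "\<forall>\<^sub>F k in sequentially. finite_energy k \<and> willmore (induced_varifold (M k)) \<le> ennreal C"
    using eventually_bounded by blast
  have "(\<lambda>k. (1 / c) * (\<integral>z. bump x r z \<partial>\<mu> k)) \<longlonglongrightarrow> (1 / c) * 0" by (intro tendsto_intros lim)
  then have lim': "(\<lambda>k. (1 / c) * (\<integral>z. bump x r z \<partial>\<mu> k)) \<longlonglongrightarrow> 0" by simp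
  show ?thesis
  proof (rule tendsto_sandwich[OF _ _ tendsto_const lim'])
    show "\<forall>\<^sub>F k in sequentially. measure (\<mu> k) (cball x s) \<le> (1 / c) * (\<integral>z. bump x r z \<partial>\<mu> k)"
      using C
    proof eventually_elim
      case (elim k)
      then interpret finite_measure "\<mu> k" by (intro finite_mu) simp
      have "c * measure (\<mu> k) (cball x s) = (\<integral>z. c * indicator (cball x s) z \<partial>\<mu> k)" by simp
      also have "\<dots> \<le> (\<integral>z. bump x r z \<partial>\<mu> k)"
      proof (rule integral_mono)
        show "integrable (\<mu> k) (\<lambda>z. c * indicator (cball x s) z)"
          by (intro integrable_mult_right integrable_real_indicator) (auto simp: emeasure_eq_measure)
        show "integrable (\<mu> k) (bump x r)"
          by (rule integrable_continuous_compact_support[OF sets_surface_measure bump_continuous compact_cball[of x r] bump_zero])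
            (use s in \<open>auto simp: emeasure_eq_measure\<close>)
        show "c * indicator (cball x s) z \<le> bump x r z" for z
        proof (cases "z \<in> cball x s")
          case True
          then have "(dist x z)\<^sup>2 \<le> s\<^sup>2" by (intro power_mono) auto
          then have "c \<le> bump x r z" unfolding c_def bump_def inner_diff_self using rs by (intro power_mono) auto
          then show ?thesis using True by simp
        qed (simp add: bump_nonneg)
      qed
      finally show ?case using c by (simp add: field_simps)
    qed
  qed (simp add: eventually_sequentially)
qed

text \<open>The surfaces come close to \<open>x\<close>, but their area near \<open>x\<close> tends to zero; so in the lower bound of
  \<open>energy_lower_bound\<close> at a point of the surface near \<open>x\<close> only the energy is left.\<close>

lemma energy_concentration:
  assumes r: "strict_mono r" and lim: "(\<lambda>j. hausdorff_distance (M (r j)) K) \<longlonglongrightarrow> 0"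
    and x: "x \<in> K" and \<rho>: "0 < \<rho>" and null: "emeasure \<nu> (ball x \<rho>) = 0"
  shows "\<forall>\<^sub>F j in sequentially. planar_factor / 8 \<le> energy (r j) (ball x \<rho>)"
proof -
  have filt: "filterlim r sequentially sequentially" using r by (rule filterlim_subseq)
  obtain C where C: "\<forall>\<^sub>F k in sequentially. finite_energy k \<and> willmore (induced_varifold (M k)) \<le> ennreal C"
    using eventually_bounded by blast
  have ev1: "\<forall>\<^sub>F j in sequentially. finite_energy (r j)"
    using filterlim_iff[THEN iffD1, OF filt] C by (auto elim: eventually_mono)
  have ev2: "\<forall>\<^sub>F j in sequentially. hausdorff_distance (M (r j)) K < ennreal (\<rho> / 4)"
    using lim \<rho> by (intro order_tendstoD(2)) auto
  have "(\<lambda>k. measure (\<mu> k) (cball x (3 / 4 * \<rho>))) \<longlonglongrightarrow> 0"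
    by (rule area_tends_to_zero[OF null]) (use \<rho> in auto)
  then have "(\<lambda>j. measure (\<mu> (r j)) (cball x (3 / 4 * \<rho>))) \<longlonglongrightarrow> 0" using filt by (rule filterlim_compose)
  \<comment> \<open>This threshold makes the area term at radius \<open>\<rho> / 2\<close> at most half of \<open>planar_factor / 32\<close>.\<close>
  moreover have "0 < \<rho>\<^sup>2 * planar_factor / 1024" using \<rho> planar_factor_pos by simp
  ultimately have ev3: "\<forall>\<^sub>F j in sequentially. measure (\<mu> (r j)) (cball x (3 / 4 * \<rho>)) < \<rho>\<^sup>2 * planar_factor / 1024"
    by (rule order_tendstoD(2))
  show ?thesis using ev1 ev2 ev3
  proof eventually_elim
    case (elim j)
    let ?k = "r j"
    interpret finite_measure "\<mu> ?k" using elim(1) by (rule finite_mu)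
    obtain p where p: "p \<in> M ?k" "dist p x < \<rho> / 4"
      using closer_than_hausdorff_distance(2)[OF elim(2) x] by blast
    have sub1: "ball p (\<rho> / 2) \<subseteq> cball x (3 / 4 * \<rho>)"
    proof
      fix z assume "z \<in> ball p (\<rho> / 2)"
      then show "z \<in> cball x (3 / 4 * \<rho>)" using p(2) dist_triangle[of x z p] by (simp add: dist_commute)
    qed
    have sub2: "ball p (\<rho> / 2) \<subseteq> ball x \<rho>" using sub1 \<rho> by (auto simp: subset_iff)
    have "planar_factor / 32 \<le> 4 / (\<rho> / 2)\<^sup>2 * measure (\<mu> ?k) (ball p (\<rho> / 2)) + energy ?k (ball p (\<rho> / 2)) / 8"
      unfolding energy_def
      by (rule energy_lower_bound[OF compact_M C2_M _ gmc_H[OF elim(1)] H_L2(1)[OF elim(1)] p(1)])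
        (use elim(1) \<rho> in \<open>auto simp: finite_energy_def\<close>)
    also have "\<dots> \<le> 16 / \<rho>\<^sup>2 * (\<rho>\<^sup>2 * planar_factor / 1024) + energy ?k (ball x \<rho>) / 8"
    proof (rule add_mono)
      have "measure (\<mu> ?k) (ball p (\<rho> / 2)) \<le> measure (\<mu> ?k) (cball x (3 / 4 * \<rho>))"
        using sub1 by (intro finite_measure_mono) auto
      then show "4 / (\<rho> / 2)\<^sup>2 * measure (\<mu> ?k) (ball p (\<rho> / 2)) \<le> 16 / \<rho>\<^sup>2 * (\<rho>\<^sup>2 * planar_factor / 1024)"
        using elim(3) by (intro mult_mono) (auto simp: power_divide)
      show "energy ?k (ball p (\<rho> / 2)) / 8 \<le> energy ?k (ball x \<rho>) / 8"
        using energy_mono[OF elim(1) _ _ sub2] by simp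
    qed
    also have "\<dots> = planar_factor / 64 + energy ?k (ball x \<rho>) / 8" using \<rho> by simp
    finally show ?case by simp
  qed
qed

text \<open>A point outside \<open>K\<close> has a ball that the surfaces eventually avoid, so a bump on this ball has
  integral zero in the limit.\<close>

lemma spt_subset_limit:
  assumes r: "strict_mono r" and K: "closed K" and lim: "(\<lambda>j. hausdorff_distance (M (r j)) K) \<longlonglongrightarrow> 0"
  shows "spt \<nu> \<subseteq> K"
proof
  fix x assume x: "x \<in> spt \<nu>"
  show "x \<in> K"
  proof (rule ccontr)
    assume "x \<notin> K"
    then obtain e where e: "0 < e" "ball x e \<subseteq> - K" using K openE[of "- K" x] by auto
    have filt: "filterlim r sequentially sequentially" using r by (rule filterlim_subseq)
    have "\<forall>\<^sub>F j in sequentially. hausdorff_distance (M (r j)) K < ennreal (e / 2)"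
      using lim e by (intro order_tendstoD(2)) auto
    then have ev: "\<forall>\<^sub>F j in sequentially. (\<integral>z. bump x (e / 2) z \<partial>\<mu> (r j)) = 0"
    proof eventually_elim
      case (elim j)
      have "z \<notin> ball x (e / 2)" if z: "z \<in> M (r j)" for z
      proof
        assume "z \<in> ball x (e / 2)"
        moreover obtain b where "b \<in> K" "dist z b < e / 2" using closer_than_hausdorff_distance(1)[OF elim z] by blast
        ultimately have "b \<in> ball x e" using dist_triangle[of x b z] by simp
        then show False using e \<open>b \<in> K\<close> by auto
      qed
      then have zero: "bump x (e / 2) z = 0" if "z \<in> M (r j)" for z
      proof -
        have "(e / 2)\<^sup>2 \<le> (dist x z)\<^sup>2" using \<open>z \<in> M (r j) \<Longrightarrow> z \<notin> ball x (e / 2)\<close> that e by (intro power_mono) auto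
        then show ?thesis by (simp add: bump_def inner_diff_self)
      qed
      have "(\<integral>z. bump x (e / 2) z \<partial>\<mu> (r j)) = (\<integral>z. 0 \<partial>\<mu> (r j))"
      proof (rule integral_cong_AE)
        show "AE z in \<mu> (r j). bump x (e / 2) z = 0"
          using AE_surface_measure_in[OF M_borel[of "r j"]] by eventually_elim (rule zero)
      qed (use borel_measurable_continuous_onI[OF bump_continuous[of UNIV x "e/2"]] in simp_all)
      then show ?case by simp
    qed
    have "(\<lambda>j. \<integral>z. bump x (e / 2) z \<partial>\<mu> (r j)) \<longlonglongrightarrow> (\<integral>z. bump x (e / 2) z \<partial>\<nu>)"
      using integral_bump_converges[of "e / 2" x] e by (intro filterlim_compose[OF _ filt]) simp
    moreover have "(\<lambda>j. \<integral>z. bump x (e / 2) z \<partial>\<mu> (r j)) \<longlonglongrightarrow> 0"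
      by (rule tendsto_eventually[OF ev])
    ultimately have int0: "(\<integral>z. bump x (e / 2) z \<partial>\<nu>) = 0" by (rule LIMSEQ_unique)
    have bm: "bump x (e / 2) \<in> borel_measurable \<nu>"
      using borel_measurable_continuous_onI[OF bump_continuous[of UNIV x "e/2"]] by (simp add: mass_measure_def)
    have "integrable \<nu> (bump x (e / 2))"
      by (rule integrable_continuous_compact_support[OF sets_mass_measure bump_continuous compact_cball[of x "e/2"] bump_zero])
        (use e mass_measure_compact_finite[OF varifold_V compact_cball[of x "e/2"]] in auto)
    then have "AE z in \<nu>. bump x (e / 2) z = 0"
      using int0 by (subst (asm) integral_nonneg_eq_0_iff_AE) (auto simp: bump_nonneg)
    then have "AE z in \<nu>. z \<notin> ball x (e / 2)"
      by eventually_elim (metis bump_pos less_irrefl)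
    then have "emeasure \<nu> (ball x (e / 2)) = 0"
      by (subst (asm) AE_iff_measurable[of "ball x (e/2)"]) (auto simp: mass_measure_def)
    moreover have "0 < emeasure \<nu> (ball x (e / 2))" using x e unfolding spt_def by auto
    ultimately show False by simp
  qed
qed

text \<open>Finitely many points outside the support have disjoint null balls of equal radius, and each of
  these balls carries the energy \<open>planar_factor / 8\<close>; so the energy bound limits their number.\<close>

theorem limit_minus_spt_finite:
  assumes r: "strict_mono r" and lim: "(\<lambda>j. hausdorff_distance (M (r j)) K) \<longlonglongrightarrow> 0"
  shows "finite (K - spt \<nu>)"
proof (rule ccontr)
  assume inf: "infinite (K - spt \<nu>)"
  obtain C where C: "0 \<le> C" "\<forall>\<^sub>F k in sequentially. finite_energy k \<and> willmore (induced_varifold (M k)) \<le> ennreal C"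
    using eventually_bounded by blast
  obtain N :: nat where N: "C / (planar_factor / 8) < real N" using reals_Archimedean2 by blast
  obtain T where T: "T \<subseteq> K - spt \<nu>" "finite T" "card T = N"
    using infinite_arbitrarily_large[OF inf] by blast
  have "\<forall>x\<in>T. \<exists>s>0. emeasure \<nu> (ball x s) = 0"
    using T(1) not_in_spt[OF sets_mass_measure] by blast
  then obtain s where s: "\<And>x. x \<in> T \<Longrightarrow> 0 < s x" "\<And>x. x \<in> T \<Longrightarrow> emeasure \<nu> (ball x (s x)) = 0" by metis
  obtain d where d: "0 < d" "\<And>x y. x \<in> T \<Longrightarrow> y \<in> T \<Longrightarrow> x \<noteq> y \<Longrightarrow> d \<le> dist x y"
  proof -
    define D where "D = insert 1 ((\<lambda>(x, y). dist x y) ` (T \<times> T - Id))"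
    have fin: "finite D" using T(2) by (simp add: D_def)
    have "0 < Min D" using fin by (subst Min_gr_iff) (auto simp: D_def)
    moreover have "Min D \<le> dist x y" if "x \<in> T" "y \<in> T" "x \<noteq> y" for x y
      using fin that by (intro Min_le) (auto simp: D_def)
    ultimately show ?thesis using that by blast
  qed
  define \<rho> where "\<rho> = Min (insert (d / 2) (s ` T))"
  have "0 < \<rho>" unfolding \<rho>_def using T(2) s(1) d(1) by (subst Min_gr_iff) auto
  moreover have "\<rho> \<le> d / 2" unfolding \<rho>_def using T(2) by (intro Min_le) auto
  moreover have "\<rho> \<le> s x" if "x \<in> T" for x unfolding \<rho>_def using T(2) that by (intro Min_le) auto
  ultimately have \<rho>: "0 < \<rho>" "\<rho> \<le> d / 2" "\<And>x. x \<in> T \<Longrightarrow> \<rho> \<le> s x" by blast+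
  have null: "emeasure \<nu> (ball x \<rho>) = 0" if "x \<in> T" for x
    using emeasure_ball_mono_zero[OF sets_mass_measure s(2)[OF that] \<rho>(3)[OF that]] .
  have disj: "disjoint_family_on (\<lambda>x. ball x \<rho>) T"
    unfolding disjoint_family_on_def
  proof (intro ballI impI)
    fix x y assume xy: "x \<in> T" "y \<in> T" "x \<noteq> y"
    show "ball x \<rho> \<inter> ball y \<rho> = {}"
    proof (rule ccontr)
      assume "ball x \<rho> \<inter> ball y \<rho> \<noteq> {}"
      then obtain z where "dist x z < \<rho>" "dist y z < \<rho>" by auto
      then have "dist x y < 2 * \<rho>" using dist_triangle[of x y z] by (simp add: dist_commute)
      then show False using d(2)[OF xy] \<rho>(2) by simp
    qed
  qed
  have filt: "filterlim r sequentially sequentially" using r by (rule filterlim_subseq)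
  have "\<forall>\<^sub>F j in sequentially. \<forall>x\<in>T. planar_factor / 8 \<le> energy (r j) (ball x \<rho>)"
    unfolding eventually_ball_finite_distrib[OF T(2)]
    using T(1) null \<rho>(1) energy_concentration[OF r lim] by blast
  moreover have "\<forall>\<^sub>F j in sequentially. finite_energy (r j) \<and> willmore (induced_varifold (M (r j))) \<le> ennreal C"
    using filterlim_iff[THEN iffD1, OF filt] C(2) by blast
  ultimately have "\<forall>\<^sub>F j in sequentially. False"
  proof eventually_elim
    case (elim j)
    have "real N * (planar_factor / 8) = (\<Sum>x\<in>T. planar_factor / 8)" using T(3) by simp
    also have "\<dots> \<le> (\<Sum>x\<in>T. energy (r j) (ball x \<rho>))" using elim(1) by (intro sum_mono) auto
    also have "\<dots> \<le> energy (r j) UNIV" using elim(2) by (intro sum_energy_le[OF _ T(2) _ disj]) auto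
    also have "\<dots> \<le> C" using elim(2) H_L2(2)[of "r j"] C(1) by (auto simp: ennreal_le_iff)
    finally show False using N planar_factor_pos by (simp add: field_simps)
  qed
  then show False by simp
qed

text \<open>An isolated point of the limit of connected sets is the whole limit.\<close>

theorem limit_eq_spt_of_connected:
  assumes r: "strict_mono r" and K: "closed K" and lim: "(\<lambda>j. hausdorff_distance (M (r j)) K) \<longlonglongrightarrow> 0"
    and conn: "\<And>k. connected (M k)" and nz: "emeasure \<nu> UNIV \<noteq> 0"
  shows "K = spt \<nu>"
proof (rule ccontr)
  assume "K \<noteq> spt \<nu>"
  then obtain x where x: "x \<in> K" "x \<notin> spt \<nu>" using spt_subset_limit[OF r K lim] by blast
  obtain s where s: "0 < s" "emeasure \<nu> (ball x s) = 0" using not_in_spt[OF sets_mass_measure x(2)] by blast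
  obtain y where y: "y \<in> spt \<nu>" using spt_nonempty[OF sets_mass_measure nz] by blast
  then have yK: "y \<in> K" using spt_subset_limit[OF r K lim] by blast
  have sub: "ball x s \<inter> spt \<nu> = {}"
  proof (rule ccontr)
    assume "ball x s \<inter> spt \<nu> \<noteq> {}"
    then obtain z where "z \<in> ball x s" "z \<in> spt \<nu>" by blast
    then have "0 < emeasure \<nu> (ball x s)" unfolding spt_def by auto
    then show False using s(2) by simp
  qed
  have "finite (K - spt \<nu>)" by (rule limit_minus_spt_finite[OF r lim])
  then obtain d where d: "0 < d" "\<And>z. z \<in> K - spt \<nu> \<Longrightarrow> z \<noteq> x \<Longrightarrow> d \<le> dist x z"
    using finite_set_avoid[of "K - spt \<nu>" x] by blast
  define t where "t = min s d / 3"
  have t: "0 < t" using s d by (simp add: t_def)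
  have isolated: "z = x" if "z \<in> K" "dist x z < 3 * t" for z
  proof (rule ccontr)
    assume "z \<noteq> x"
    moreover have "z \<notin> spt \<nu>" using sub that by (auto simp: t_def)
    ultimately have "d \<le> dist x z" using that(1) by (intro d(2)) auto
    then show False using that(2) by (simp add: t_def)
  qed
  have yx: "3 * t \<le> dist x y" using isolated[OF yK] x(2) y by fastforce
  have "\<forall>\<^sub>F j in sequentially. hausdorff_distance (M (r j)) K < ennreal t"
    using lim t by (intro order_tendstoD(2)) auto
  then obtain j where j: "hausdorff_distance (M (r j)) K < ennreal t"
    by (auto simp: eventually_sequentially)
  obtain p where p: "p \<in> M (r j)" "dist p x < t" using closer_than_hausdorff_distance(2)[OF j x(1)] by blast
  obtain q where q: "q \<in> M (r j)" "dist q y < t" using closer_than_hausdorff_distance(2)[OF j yK] by blast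
  have qx: "2 * t < dist x q" using yx q(2) dist_triangle[of x y q] by simp
  \<comment> \<open>The connected surface passes from within \<open>t\<close> of \<open>x\<close> to outside \<open>2 t\<close>, so it meets the
    shell between, where there is no point of \<open>K\<close>.\<close>
  have "connected (dist x ` M (r j))"
    by (intro connected_continuous_image conn continuous_intros)
  then have "\<exists>z\<in>M (r j). dist x z = 3 / 2 * t"
  proof -
    have "3 / 2 * t \<in> dist x ` M (r j)"
    proof (rule connectedD_interval[OF \<open>connected (dist x ` M (r j))\<close>, of "dist x p" "dist x q"])
      show "dist x p \<in> dist x ` M (r j)" "dist x q \<in> dist x ` M (r j)" using p q by auto
      show "dist x p \<le> 3 / 2 * t" using p(2) t by (simp add: dist_commute)
      show "3 / 2 * t \<le> dist x q" using qx t by simp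
    qed
    then show ?thesis by auto
  qed
  then obtain z where z: "z \<in> M (r j)" "dist x z = 3 / 2 * t" by blast
  obtain b where b: "b \<in> K" "dist z b < t" using closer_than_hausdorff_distance(1)[OF j z(1)] by blast
  have "dist x b < 3 * t" using dist_triangle[of x b z] b z t by simp
  then have "b = x" using b(1) isolated by blast
  then show False using b z t by (simp add: dist_commute)
qed

text \<open>Lower semicontinuity of the energy away from \<open>x\<close>: for a test field \<open>X\<close> supported in the
  open set \<open>W\<close>, the quantity \<open>2 \<integral> H \<bullet> X - \<integral> \<bar>X\<bar>\<^sup>2\<close> converges, and it is at most the energy in \<open>W\<close>.\<close>

lemma test_field_bound:
  assumes k: "finite_energy k" and X: "C1_compactly_supported X" "continuous_on UNIV X"
    and K: "compact K" "K \<subseteq> W" "\<And>x. x \<notin> K \<Longrightarrow> X x = 0" and W: "open W"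
  shows "- 2 * first_variation (induced_varifold (M k)) X - (\<integral>x. (norm (X x))\<^sup>2 \<partial>\<mu> k) \<le> energy k W"
proof -
  interpret finite_measure "\<mu> k" using k by (rule finite_mu)
  have fv: "first_variation (induced_varifold (M k)) X = - (\<integral>x. H k x \<bullet> X x \<partial>\<mu> k)"
    using gmc_H[OF k] X(1) unfolding generalised_mean_curvature_def mass_k by blast
  have Xm: "X \<in> borel_measurable borel" using X(2) by (rule borel_measurable_continuous_onI)
  note Hm = H_measurable[OF k]
  have "continuous_on UNIV (\<lambda>x. (norm (X x))\<^sup>2)" by (intro continuous_intros X(2))
  then have intX: "integrable (\<mu> k) (\<lambda>x. (norm (X x))\<^sup>2)"
    by (rule integrable_continuous_compact_support[OF sets_surface_measure _ K(1)])
      (use K(3) in \<open>auto simp: emeasure_eq_measure\<close>)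
  have intHX: "integrable (\<mu> k) (\<lambda>x. H k x \<bullet> X x)"
    using Hm Xm by (intro integrable_inner_of_squares[OF H_L2(1)[OF k] intX]) simp_all
  have "- 2 * first_variation (induced_varifold (M k)) X - (\<integral>x. (norm (X x))\<^sup>2 \<partial>\<mu> k)
     = (\<integral>x. 2 * (H k x \<bullet> X x) - (norm (X x))\<^sup>2 \<partial>\<mu> k)"
    unfolding fv using intX intHX by simp
  also have "\<dots> \<le> energy k W"
    unfolding energy_def
  proof (rule integral_mono)
    show "integrable (\<mu> k) (\<lambda>x. 2 * (H k x \<bullet> X x) - (norm (X x))\<^sup>2)" using intX intHX by simp
    show "integrable (\<mu> k) (\<lambda>x. indicator W x * (norm (H k x))\<^sup>2)" using k W by (intro integrable_energy) auto
    show "2 * (H k x \<bullet> X x) - (norm (X x))\<^sup>2 \<le> indicator W x * (norm (H k x))\<^sup>2" for x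
    proof (cases "x \<in> W")
      case True
      have "0 \<le> (H k x - X x) \<bullet> (H k x - X x)" by simp
      then show ?thesis using True by (simp add: inner_diff_left inner_diff_right inner_commute power2_norm_eq_inner)
    next
      case False
      then have "X x = 0" using K by blast
      then show ?thesis by simp
    qed
  qed
  finally show ?thesis .
qed

text \<open>A point \<open>x\<close> outside the support would concentrate the energy \<open>\<epsilon>\<close> in a small ball, so that the
  energy outside the ball is asymptotically at most \<open>w - \<epsilon>\<close>, where \<open>w\<close> is the energy of the limit. By
  lower semicontinuity this bounds the energy of the limit outside the ball, which is \<open>w\<close>, since
  the ball is null.\<close>

theorem limit_eq_spt_of_energy_convergence:
  assumes r: "strict_mono r" and K: "closed K" and lim: "(\<lambda>j. hausdorff_distance (M (r j)) K) \<longlonglongrightarrow> 0"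
    and Wconv: "(\<lambda>k. willmore (induced_varifold (M k))) \<longlonglongrightarrow> willmore V"
  shows "K = spt \<nu>"
proof (rule ccontr)
  assume "K \<noteq> spt \<nu>"
  then obtain x where x: "x \<in> K" "x \<notin> spt \<nu>" using spt_subset_limit[OF r K lim] by blast
  obtain s where s: "0 < s" "emeasure \<nu> (ball x s) = 0" using not_in_spt[OF sets_mass_measure x(2)] by blast
  define \<rho> where "\<rho> = s / 2"
  have \<rho>: "0 < \<rho>" "\<rho> < s" using s by (auto simp: \<rho>_def)
  define W where "W = - cball x \<rho>"
  have W: "open W" by (simp add: W_def open_Compl)
  have nullW: "emeasure \<nu> (- W) = 0"
  proof -
    have "emeasure \<nu> (- W) \<le> emeasure \<nu> (ball x s)" using \<rho> by (intro emeasure_mono) (auto simp: W_def)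
    then show ?thesis using s(2) by simp
  qed
  have filt: "filterlim r sequentially sequentially" using r by (rule filterlim_subseq)
  obtain C where C: "0 \<le> C" "\<forall>\<^sub>F k in sequentially. finite_energy k \<and> willmore (induced_varifold (M k)) \<le> ennreal C"
    using eventually_bounded by blast
  have "willmore V \<le> ennreal C"
    using C(2) by (intro tendsto_upperbound[OF Wconv]) (auto elim: eventually_mono)
  then have Wfin: "willmore V < \<infinity>" by (auto intro: le_less_trans)
  define h where "h = (SOME H. generalised_mean_curvature V H)"
  have gmc: "generalised_mean_curvature V h" and Wh: "willmore V = (\<integral>\<^sup>+x. ennreal ((norm (h x))\<^sup>2) \<partial>\<nu>)"
    unfolding h_def using willmore_finite[OF Wfin] by auto
  have hm: "h \<in> borel_measurable borel" using gmc unfolding generalised_mean_curvature_def by blast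
  have hm': "h \<in> borel_measurable \<nu>" using hm by (simp add: mass_measure_def)
  have h2int: "integrable \<nu> (\<lambda>x. (norm (h x))\<^sup>2)"
    using hm' Wfin Wh by (intro integrableI_nonneg) auto
  define w where "w = (\<integral>x. (norm (h x))\<^sup>2 \<partial>\<nu>)"
  have w: "willmore V = ennreal w" "0 \<le> w"
    unfolding Wh w_def using nn_integral_eq_integral[OF h2int] by (auto intro: Bochner_Integration.integral_nonneg)
  define \<epsilon> where "\<epsilon> = planar_factor / 8"
  have \<epsilon>: "0 < \<epsilon>" using planar_factor_pos by (simp add: \<epsilon>_def)
  have evg: "\<forall>\<^sub>F j in sequentially. finite_energy (r j)"
    using filterlim_iff[THEN iffD1, OF filt] C(2) by (auto elim: eventually_mono)
  have elim_w: "(\<lambda>j. energy (r j) UNIV) \<longlonglongrightarrow> w"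
  proof -
    have "(\<lambda>j. willmore (induced_varifold (M (r j)))) \<longlonglongrightarrow> ennreal w"
      by (rule filterlim_compose[OF Wconv[unfolded w(1)] filt])
    then have "(\<lambda>j. ennreal (energy (r j) UNIV)) \<longlonglongrightarrow> ennreal w"
    proof (rule Lim_transform_eventually)
      show "\<forall>\<^sub>F j in sequentially. willmore (induced_varifold (M (r j))) = ennreal (energy (r j) UNIV)"
        using evg by eventually_elim (rule H_L2(2))
    qed
    then show ?thesis using energy_nonneg w(2) by (subst (asm) tendsto_ennreal_iff) auto
  qed
  have "emeasure \<nu> (ball x \<rho>) = 0" by (rule emeasure_ball_mono_zero[OF sets_mass_measure s(2)]) (use \<rho> in simp)
  then have conc: "\<forall>\<^sub>F j in sequentially. \<epsilon> \<le> energy (r j) (ball x \<rho>)"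
    unfolding \<epsilon>_def by (rule energy_concentration[OF r lim x(1) \<rho>(1)])
  have outer: "\<forall>\<^sub>F j in sequentially. energy (r j) W \<le> energy (r j) UNIV - \<epsilon>"
    using conc evg
  proof eventually_elim
    case (elim j)
    have "(\<Sum>b\<in>UNIV. energy (r j) (if b then W else ball x \<rho>)) \<le> energy (r j) UNIV"
      by (rule sum_energy_le[OF elim(2)]) (auto simp: W_def disjoint_family_on_def split: if_splits)
    then show ?case using elim(1) by (simp add: UNIV_bool)
  qed
  have test: "- 2 * first_variation V X - (\<integral>x. (norm (X x))\<^sup>2 \<partial>\<nu>) \<le> w - \<epsilon>"
    if X: "C1_compactly_supported X" "continuous_on UNIV X" and L: "compact L" "L \<subseteq> W" "\<And>x. x \<notin> L \<Longrightarrow> X x = 0" for X L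
  proof -
    have contN: "continuous_on UNIV (\<lambda>x. (norm (X x))\<^sup>2)" by (intro continuous_intros X(2))
    have "(\<lambda>k. \<integral>x. (norm (X x))\<^sup>2 \<partial>\<mu> k) \<longlonglongrightarrow> (\<integral>x. (norm (X x))\<^sup>2 \<partial>\<nu>)"
      using varifold_converges_mass[OF conv sets_V sets_k contN L(1)] L(3) unfolding mass_k by simp
    then have "(\<lambda>k. - 2 * first_variation (induced_varifold (M k)) X - (\<integral>x. (norm (X x))\<^sup>2 \<partial>\<mu> k))
        \<longlonglongrightarrow> - 2 * first_variation V X - (\<integral>x. (norm (X x))\<^sup>2 \<partial>\<nu>)"
      by (intro tendsto_intros varifold_converges_first_variation[OF conv X(1)])
    then have "(\<lambda>j. - 2 * first_variation (induced_varifold (M (r j))) X - (\<integral>x. (norm (X x))\<^sup>2 \<partial>\<mu> (r j)))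
        \<longlonglongrightarrow> - 2 * first_variation V X - (\<integral>x. (norm (X x))\<^sup>2 \<partial>\<nu>)"
      using filt by (rule filterlim_compose)
    moreover have "(\<lambda>j. energy (r j) UNIV - \<epsilon>) \<longlonglongrightarrow> w - \<epsilon>" by (intro tendsto_intros elim_w)
    moreover have "\<forall>\<^sub>F j in sequentially. - 2 * first_variation (induced_varifold (M (r j))) X - (\<integral>x. (norm (X x))\<^sup>2 \<partial>\<mu> (r j))
        \<le> energy (r j) UNIV - \<epsilon>"
      using outer evg
    proof eventually_elim
      case (elim j)
      show ?case using test_field_bound[OF elim(2) X L W] elim(1) by linarith
    qed
    ultimately show ?thesis by (intro tendsto_le[OF sequentially_bot])
  qed
  \<comment> \<open>If \<open>X\<close> is close to \<open>h\<close> in \<open>L\<^sup>2\<close>, then the left-hand side in \<open>test\<close> is close to \<open>w\<close>.\<close>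
  have approx: "\<exists>g. C1_test W g \<and> (\<integral>\<^sup>+z. ennreal ((h z \<bullet> axis i 1 - g z)\<^sup>2) \<partial>\<nu>) < ennreal (\<epsilon> / 3)" for i :: 3
  proof -
    have "L2_approximable W \<nu> (\<lambda>z. h z \<bullet> axis i 1)"
    proof (rule tests_dense_in_L2[OF sets_mass_measure W _ _ _ nullW])
      show "emeasure \<nu> K < \<infinity>" if "compact K" for K by (rule mass_measure_compact_finite[OF varifold_V that])
      show "(\<lambda>z. h z \<bullet> axis i 1) \<in> borel_measurable \<nu>" using hm' by measurable
      have "(\<integral>\<^sup>+z. ennreal ((h z \<bullet> axis i 1)\<^sup>2) \<partial>\<nu>) \<le> (\<integral>\<^sup>+z. ennreal ((norm (h z))\<^sup>2) \<partial>\<nu>)"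
      proof (intro nn_integral_mono ennreal_leI)
        fix z
        have "\<bar>h z \<bullet> axis i 1\<bar> \<le> norm (h z)" using Cauchy_Schwarz_ineq2[of "h z" "axis i 1"] by simp
        then show "(h z \<bullet> axis i 1)\<^sup>2 \<le> (norm (h z))\<^sup>2" using abs_le_square_iff[of "h z \<bullet> axis i 1" "norm (h z)"] by simp
      qed
      then show "(\<integral>\<^sup>+z. ennreal ((h z \<bullet> axis i 1)\<^sup>2) \<partial>\<nu>) < \<infinity>" using Wfin Wh by (auto intro: le_less_trans)
    qed
    then show ?thesis unfolding L2_approximable_def using \<epsilon> by simp
  qed
  have "\<exists>g. \<forall>i :: 3. C1_test W (g i) \<and> (\<integral>\<^sup>+z. ennreal ((h z \<bullet> axis i 1 - g i z)\<^sup>2) \<partial>\<nu>) < ennreal (\<epsilon> / 3)"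
    by (rule choice) (rule allI, rule approx)
  then obtain g where "\<forall>i :: 3. C1_test W (g i) \<and> (\<integral>\<^sup>+z. ennreal ((h z \<bullet> axis i 1 - g i z)\<^sup>2) \<partial>\<nu>) < ennreal (\<epsilon> / 3)" ..
  then have g: "C1_test W (g i)" "(\<integral>\<^sup>+z. ennreal ((h z \<bullet> axis i 1 - g i z)\<^sup>2) \<partial>\<nu>) < ennreal (\<epsilon> / 3)" for i
    by blast+
  define X where "X z = (\<Sum>i\<in>UNIV. g i z *\<^sub>R (axis i 1 :: real^3))" for z
  have Xi: "X z $ i = g i z" for z i by (simp add: X_def axis_def if_distrib cong: if_cong)
  have "\<forall>i. \<exists>K. compact K \<and> K \<subseteq> W \<and> (\<forall>z. z \<notin> K \<longrightarrow> g i z = 0)"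
    using g(1) unfolding C1_test_def by blast
  then obtain L0 where L0: "\<And>i :: 3. compact (L0 i)" "\<And>i. L0 i \<subseteq> W" "\<And>i z. z \<notin> L0 i \<Longrightarrow> g i z = 0"
    by metis
  define L where "L = (\<Union>i. L0 i)"
  have L': "compact L" "L \<subseteq> W" using L0 by (auto simp: L_def intro: compact_UN)
  have L0X: "X z = 0" if "z \<notin> L" for z using L0(3) that by (simp add: L_def X_def)
  have "\<exists>X'. (\<forall>z. ((\<lambda>z. g i z *\<^sub>R (axis i 1 :: real^3)) has_derivative blinfun_apply (X' z)) (at z)) \<and> continuous_on UNIV X'" for i
    by (rule C1_test_times_vector[OF g(1)[of i], of "axis i 1"]) blast
  then obtain X' where X': "\<And>i z. ((\<lambda>z. g i z *\<^sub>R (axis i 1 :: real^3)) has_derivative blinfun_apply (X' i z)) (at z)"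
    "\<And>i. continuous_on UNIV (X' i)" by metis
  have contX: "continuous_on UNIV X"
    unfolding X_def using C1_test_continuous[OF g(1)] by (intro continuous_intros)
  have C1X: "C1_compactly_supported X"
    unfolding C1_compactly_supported_def
  proof (intro conjI exI[of _ "\<lambda>z. \<Sum>i\<in>UNIV. X' i z"] exI[of _ L] allI impI)
    fix z
    have "(X has_derivative (\<lambda>v. \<Sum>i\<in>UNIV. X' i z v)) (at z)"
      unfolding X_def by (intro has_derivative_sum X'(1))
    moreover have "blinfun_apply (\<Sum>i\<in>UNIV. X' i z) = (\<lambda>v. \<Sum>i\<in>UNIV. X' i z v)"
      by (rule ext) (simp add: blinfun.sum_left)
    ultimately show "(X has_derivative blinfun_apply (\<Sum>i\<in>UNIV. X' i z)) (at z)" by simp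
  qed (use L0X L' X'(2) in \<open>auto intro!: continuous_on_sum\<close>)
  have fvX: "first_variation V X = - (\<integral>z. h z \<bullet> X z \<partial>\<nu>)"
    using gmc C1X unfolding generalised_mean_curvature_def by blast
  have Xm: "X \<in> borel_measurable \<nu>" using borel_measurable_continuous_onI[OF contX] by (simp add: mass_measure_def)
  have "continuous_on UNIV (\<lambda>z. (norm (X z))\<^sup>2)" by (intro continuous_intros contX)
  then have intX: "integrable \<nu> (\<lambda>z. (norm (X z))\<^sup>2)"
    by (rule integrable_continuous_compact_support[OF sets_mass_measure _ L'(1)])
      (use L0X mass_measure_compact_finite[OF varifold_V L'(1)] in auto)
  have intHX: "integrable \<nu> (\<lambda>z. h z \<bullet> X z)"
    using hm' Xm by (intro integrable_inner_of_squares[OF h2int intX]) simp_all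
  have sq: "(norm (h z - X z))\<^sup>2 = (norm (h z))\<^sup>2 - 2 * (h z \<bullet> X z) + (norm (X z))\<^sup>2" for z
    unfolding power2_norm_eq_inner by (simp add: inner_diff_left inner_diff_right inner_commute)
  have intD: "integrable \<nu> (\<lambda>z. (norm (h z - X z))\<^sup>2)" unfolding sq using h2int intX intHX by simp
  have "(\<integral>z. (norm (h z - X z))\<^sup>2 \<partial>\<nu>) = w - 2 * (\<integral>z. h z \<bullet> X z \<partial>\<nu>) + (\<integral>z. (norm (X z))\<^sup>2 \<partial>\<nu>)"
    unfolding sq w_def using h2int intX intHX by simp
  then have ge: "\<epsilon> \<le> (\<integral>z. (norm (h z - X z))\<^sup>2 \<partial>\<nu>)"
    using test[OF C1X contX L' L0X] unfolding fvX by simp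
  have "ennreal (\<integral>z. (norm (h z - X z))\<^sup>2 \<partial>\<nu>) = (\<integral>\<^sup>+z. ennreal ((norm (h z - X z))\<^sup>2) \<partial>\<nu>)"
    by (rule nn_integral_eq_integral[symmetric, OF intD]) simp
  also have "\<dots> = (\<integral>\<^sup>+z. (\<Sum>i\<in>UNIV. ennreal ((h z \<bullet> axis i 1 - g i z)\<^sup>2)) \<partial>\<nu>)"
  proof (rule nn_integral_cong)
    fix z
    have "(norm (h z - X z))\<^sup>2 = (\<Sum>i\<in>UNIV. (h z \<bullet> axis i 1 - g i z)\<^sup>2)"
      unfolding power2_norm_eq_inner inner_vec_def[of "h z - X z"] by (simp add: Xi inner_axis power2_eq_square)
    then show "ennreal ((norm (h z - X z))\<^sup>2) = (\<Sum>i\<in>UNIV. ennreal ((h z \<bullet> axis i 1 - g i z)\<^sup>2))" by simp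
  qed
  also have "\<dots> = (\<Sum>i\<in>UNIV. \<integral>\<^sup>+z. ennreal ((h z \<bullet> axis i 1 - g i z)\<^sup>2) \<partial>\<nu>)"
  proof (rule nn_integral_sum)
    fix i :: 3
    have "g i \<in> borel_measurable \<nu>"
      using borel_measurable_continuous_onI[OF C1_test_continuous[OF g(1)[of i]]] by (simp add: mass_measure_def)
    then show "(\<lambda>z. ennreal ((h z \<bullet> axis i 1 - g i z)\<^sup>2)) \<in> borel_measurable \<nu>" using hm' by measurable
  qed
  also have "\<dots> < ennreal (\<epsilon> / 3) + ennreal (\<epsilon> / 3) + ennreal (\<epsilon> / 3)"
    unfolding sum_3 by (intro add_strict_mono g(2))
  also have "\<dots> = ennreal \<epsilon>" using \<epsilon> by (simp flip: ennreal_plus)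
  finally have "(\<integral>z. (norm (h z - X z))\<^sup>2 \<partial>\<nu>) < \<epsilon>" using \<epsilon> by (simp add: ennreal_less_iff)
  then show False using ge by simp
qed

end

theorem lemma3p4:
  fixes M :: "nat \<Rightarrow> (real^3) set"
    and V :: "((real^3) \<times> (real^3^3)) measure"
  assumes "\<And>k. compact (M k)"
    and "\<And>k. C2_surface (M k)"
    and "\<And>k. orientable_surface (M k)"
    and "varifold V"
    and "varifold_converges (\<lambda>k. induced_varifold (M k)) V"
    and "limsup (\<lambda>k. willmore (induced_varifold (M k)) + emeasure hausdorff2 (M k)) < \<infinity>"
  shows "(\<forall>r K. strict_mono r \<and> closed K \<and>
            (\<lambda>j. hausdorff_distance (M (r j)) K) \<longlonglongrightarrow> 0 \<longrightarrow>
            (\<exists>F. finite F \<and> K = spt (mass_measure V) \<union> F)) \<and>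
         (((\<forall>k. connected (M k)) \<and> emeasure (mass_measure V) UNIV \<noteq> 0) \<or>
          (\<lambda>k. willmore (induced_varifold (M k))) \<longlonglongrightarrow> willmore V \<longrightarrow>
            (\<forall>r K. strict_mono r \<and> closed K \<and>
               (\<lambda>j. hausdorff_distance (M (r j)) K) \<longlonglongrightarrow> 0 \<longrightarrow>
               K = spt (mass_measure V)))"
proof -
  interpret converging_surfaces M V by unfold_locales (fact assms)+
  show ?thesis
  proof (intro conjI allI impI)
    fix r :: "nat \<Rightarrow> nat" and K
    assume *: "strict_mono r \<and> closed K \<and> (\<lambda>j. hausdorff_distance (M (r j)) K) \<longlonglongrightarrow> 0"
    show "\<exists>F. finite F \<and> K = spt (mass_measure V) \<union> F"
      using limit_minus_spt_finite[of r K] spt_subset_limit[of r K] *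
      by (intro exI[of _ "K - spt (mass_measure V)"]) auto
  next
    fix r :: "nat \<Rightarrow> nat" and K
    assume "((\<forall>k. connected (M k)) \<and> emeasure (mass_measure V) UNIV \<noteq> 0) \<or>
          (\<lambda>k. willmore (induced_varifold (M k))) \<longlonglongrightarrow> willmore V"
      and "strict_mono r \<and> closed K \<and> (\<lambda>j. hausdorff_distance (M (r j)) K) \<longlonglongrightarrow> 0"
    then show "K = spt (mass_measure V)"
      using limit_eq_spt_of_connected[of r K] limit_eq_spt_of_energy_convergence[of r K] by blast
  qed
qed

end
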